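(* Let $-n<q<0$. Then ${\rm Pos}(T_q)$ consists exactly of those functions $h\in C_e^\infty(S^{n-1})$ such that the distribution $h\cdot r^q$ is positive definite.
   Context: $C_e^\infty(S^{n-1})$ is the space of even real-valued infinitely differentiable functions on $S^{n-1}$, ordered pointwise. For $h$ on $S^{n-1}$ and real $s$, $h\cdot r^s(x)=|x|_2^s h(x/|x|_2)$ on $\mathbb{R}^n\setminus\{0\}$, viewed as a Schwartz distribution. Fourier transform: $\hat\phi(x)=\int_{\mathbb{R}^n}\phi(\xi)e^{-i(x,\xi)}d\xi$, extended to distributions by $\langle\hat h,\phi\rangle=\langle h,\hat\phi\rangle$. An even distribution is positive definite if its Fourier transform is nonnegative on every nonnegative even Schwartz test function. For $-n<q<0$ and $f\in C_e^\infty(S^{n-1})$, the Fourier transform of the distribution $f\cdot r^{-n-q}$ is of the form $g\cdot r^q$ with $g\in C_e^\infty(S^{n-1})$ (a known fact); the operator $T_q:C_e^\infty(S^{n-1})\to C_e^\infty(S^{n-1})$ is defined by $T_qf=g$, i.e. $T_qf(\xi)=(f\cdot r^{-n-q})^\wedge(\xi)$ for $\xi\in S^{n-1}$. For a linear operator $T:C_e^\infty(S^{n-1})\to C_e^\infty(S^{n-1})$, ${\rm Pos}(T)$ is the set of $h\in C_e^\infty(S^{n-1})$ such that $\int_{S^{n-1}}f(x)h(x)\,dx\ge0$ for every $f\in C_e^\infty(S^{n-1})$ with $Tf(x)\ge 0$ for all $x\in S^{n-1}$. *)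

theory Defs
  imports "HOL-Analysis.Analysis"
begin

text \<open>Dimension n = CARD('n); R^n = real^'n; S^{n-1} = sphere 0 1.
 Functions on the sphere are represented as functions on real^'n of which only
 the values on the sphere matter.\<close>

definition partial_dir :: "'n::finite \<Rightarrow> (real^'n \<Rightarrow> 'b::real_normed_vector) \<Rightarrow> real^'n \<Rightarrow> 'b" where
  "partial_dir i f = (\<lambda>x. frechet_derivative f (at x) (axis i 1))"

fun iter_partials :: "'n::finite list \<Rightarrow> (real^'n \<Rightarrow> 'b::real_normed_vector) \<Rightarrow> real^'n \<Rightarrow> 'b" where
  "iter_partials [] f = f"
| "iter_partials (i # is) f = partial_dir i (iter_partials is f)"

definition smooth_on_open :: "(real^'n::finite) set \<Rightarrow> (real^'n \<Rightarrow> 'b::real_normed_vector) \<Rightarrow> bool" where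
  "smooth_on_open S f \<longleftrightarrow> (\<forall>is. iter_partials is f differentiable_on S)"

definition Ce_inf :: "(real^'n::finite \<Rightarrow> real) set" where
  "Ce_inf = {h. (\<forall>x\<in>sphere 0 1. h (-x) = h x) \<and>
                 smooth_on_open (-{0}) (\<lambda>x. h (x /\<^sub>R norm x))}"

definition schwartz :: "(real^'n::finite \<Rightarrow> complex) set" where
  "schwartz = {\<phi>. smooth_on_open UNIV \<phi> \<and>
      (\<forall>is (k::nat). \<exists>C. \<forall>x. norm x ^ k * norm (iter_partials is \<phi> x) \<le> C)}"

definition fourier :: "(real^'n::finite \<Rightarrow> complex) \<Rightarrow> real^'n \<Rightarrow> complex" where
  "fourier \<phi> = (\<lambda>x. LINT \<xi>|lborel. \<phi> \<xi> * cis (- (x \<bullet> \<xi>)))"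

text \<open>h . r^s as a function on R^n minus 0 (locally integrable for s > -n).\<close>
definition hr :: "(real^'n::finite \<Rightarrow> real) \<Rightarrow> real \<Rightarrow> real^'n \<Rightarrow> real" where
  "hr h s = (\<lambda>x. norm x powr s * h (x /\<^sub>R norm x))"

definition dpair :: "(real^'n::finite \<Rightarrow> real) \<Rightarrow> (real^'n \<Rightarrow> complex) \<Rightarrow> complex" where
  "dpair u \<phi> = (LINT x|lborel. complex_of_real (u x) * \<phi> x)"

text \<open>Positive definite: Fourier transform nonnegative on nonnegative even Schwartz functions,
 with <hat u, phi> = <u, hat phi>.\<close>
definition positive_definite :: "(real^'n::finite \<Rightarrow> real) \<Rightarrow> bool" where
  "positive_definite u \<longleftrightarrow>
     (\<forall>\<phi>\<in>schwartz. (\<forall>x. \<phi> (-x) = \<phi> x) \<and> (\<forall>x. Im (\<phi> x) = 0 \<and> 0 \<le> Re (\<phi> x)) \<longrightarrow>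
        Im (dpair u (fourier \<phi>)) = 0 \<and> 0 \<le> Re (dpair u (fourier \<phi>)))"

definition T_op :: "real \<Rightarrow> (real^'n::finite \<Rightarrow> real) \<Rightarrow> real^'n \<Rightarrow> real" where
  "T_op q f = (SOME g. g \<in> Ce_inf \<and>
      (\<forall>\<phi>\<in>schwartz. dpair (hr f (- real CARD('n) - q)) (fourier \<phi>) = dpair (hr g q) \<phi>))"

text \<open>Integral over S^{n-1} w.r.t. surface measure, via polar coordinates:
 int_S psi = n * int_{B(0,1)} psi(x/|x|) dx.\<close>
definition sphere_integral :: "(real^'n::finite \<Rightarrow> real) \<Rightarrow> real" where
  "sphere_integral \<psi> = real CARD('n) * (LINT x|lborel. indicator (ball 0 1) x * \<psi> (x /\<^sub>R norm x))"

definition Pos :: "((real^'n::finite \<Rightarrow> real) \<Rightarrow> (real^'n \<Rightarrow> real)) \<Rightarrow> (real^'n \<Rightarrow> real) set" where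
  "Pos T = {h\<in>Ce_inf. \<forall>f\<in>Ce_inf. (\<forall>x\<in>sphere 0 1. 0 \<le> T f x) \<longrightarrow>
                          0 \<le> sphere_integral (\<lambda>x. f x * h x)}"

end

theory Submission
  imports Defs "HOL-Probability.Probability"
begin

text \<open>For a Schwartz function \<open>F\<close> let \<open>M a F x\<close> be the Mellin integral of \<open>exp (a t) F (exp t x)\<close> over
  real \<open>t\<close>; it is smooth off the origin and homogeneous of degree \<open>-a\<close>. Put \<open>a = n + q\<close> and
  \<open>b = -q\<close>. For an even Schwartz function \<open>\<phi>\<close> with Fourier transform \<open>\<phi>^\<close>, Fubini and Fourier
  inversion show that the Fourier transform of \<open>M a \<phi>^\<close> is \<open>(2 pi)^n M b \<phi>\<close>, that is
  \<open>T_q (M a \<phi>^) = (2 pi)^n M b \<phi>\<close>, while polar coordinates give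
  \<open>\<langle>h r^q, \<phi>^\<rangle>\<close> as the integral of \<open>h M a \<phi>^\<close> over the sphere. Multiplying a function on the sphere
  by the radial factor \<open>exp (- (ln |x|)^2)\<close>, which is flat at 0 and at infinity, yields a Schwartz
  function whose Mellin integrals are multiples of the given function on the sphere. Hence every
  function in \<open>C_e^\<infinity>\<close> is some \<open>M a \<phi>^\<close> and some \<open>M b \<phi>\<close>; this proves that \<open>T_q\<close> is well defined and
  injective, and a nonnegative \<open>\<phi>\<close> corresponds to a nonnegative \<open>T_q f\<close> in both directions.\<close>

section \<open>Smooth functions with derivative bounds\<close>

text \<open>The condition \<open>-n < q < 0\<close> says that both exponents \<open>n + q\<close>
  and \<open>-q\<close> are positive. Then \<open>r^q\<close> and \<open>r^(-n-q)\<close> are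
  locally integrable, so the distributions are absolutely convergent integrals without
  regularisation, and the Mellin integrals converge at the origin end of each ray. Two obstacles
  shape the proof. \<open>T_op\<close> is a choice subject to a weak identity, so its values on the
  sphere are accessible only through pairings: they are recovered by testing a difference of two
  candidates against its own cutoff extension, which produces the integral of a square. The surface
  integral is given as an integral over the unit ball, so polar coordinates are set up as an average
  over the ball of integrals along rays, without a surface measure. Writing the radius as
  \<open>exp t\<close> turns dilations into translations; in this variable the cutoff is a Gaussian,
  which absorbs the power growth that a smooth homogeneous function and all its derivatives have at
  0 and at infinity.\<close>

lemma partial_dir_eqI: "(f has_derivative D) (at x) \<Longrightarrow> partial_dir i f x = D (axis i 1)"
  unfolding partial_dir_def using frechet_derivative_at by metis

lemma has_derivative_partial_dir:
  fixes f :: "real^'n::finite \<Rightarrow> 'b::real_normed_vector"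
  assumes "f differentiable at x"
  shows "(f has_derivative (\<lambda>v. \<Sum>i\<in>UNIV. v $ i *\<^sub>R partial_dir i f x)) (at x)"
proof -
  have D: "(f has_derivative frechet_derivative f (at x)) (at x)"
    using assms frechet_derivative_works by blast
  then interpret linear "frechet_derivative f (at x)"
    using has_derivative_linear by blast
  have "frechet_derivative f (at x) v = (\<Sum>i\<in>UNIV. v $ i *\<^sub>R partial_dir i f x)" for v
  proof -
    have "frechet_derivative f (at x) v = frechet_derivative f (at x) (\<Sum>i\<in>UNIV. v $ i *\<^sub>R axis i 1)"
      by (metis (no_types, lifting) basis_expansion scalar_mult_eq_scaleR sum.cong)
    then show ?thesis
      by (simp add: sum scale partial_dir_def)
  qed
  then have "frechet_derivative f (at x) = (\<lambda>v. \<Sum>i\<in>UNIV. v $ i *\<^sub>R partial_dir i f x)"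
    by blast
  with D show ?thesis by simp
qed

lemma partial_dir_cong:
  assumes "open S" "x \<in> S" "\<And>y. y \<in> S \<Longrightarrow> f y = g y" "f differentiable at x"
  shows "partial_dir i f x = partial_dir i g x"
  using assms frechet_derivative_transform_within_open[of f x S g] by (simp add: partial_dir_def)

lemma differentiable_cong_open:
  assumes "open S" "x \<in> S" "\<And>y. y \<in> S \<Longrightarrow> f y = g y" "f differentiable at x"
  shows "g differentiable at x"
  using assms by (meson differentiable_def has_derivative_transform_within_open)

lemma iter_partials_snoc: "iter_partials (is @ [i]) f = iter_partials is (partial_dir i f)"
  by (induction "is") auto

text \<open>The predicate \<open>b\<close> bounds a function and its partial derivatives through their norms, so one
  notion covers smooth, moderate, flat and Schwartz functions.\<close>

fun Ck_bounded ::
  "((real^'n::finite \<Rightarrow> real) \<Rightarrow> bool) \<Rightarrow> (real^'n) set \<Rightarrow> nat \<Rightarrow> (real^'n \<Rightarrow> 'b::real_normed_vector) \<Rightarrow> bool"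
where
  "Ck_bounded b S 0 f \<longleftrightarrow> b (\<lambda>x. norm (f x))"
| "Ck_bounded b S (Suc k) f \<longleftrightarrow> b (\<lambda>x. norm (f x)) \<and> (\<forall>x\<in>S. f differentiable at x) \<and>
     (\<forall>i. Ck_bounded b S k (partial_dir i f))"

text \<open>Domination by a multiple of a sum is what the closure of \<open>Ck_bounded\<close> under
  sums and bounded linear maps requires. Since the domination is only demanded on \<open>S\<close>,
  membership is insensitive to values off \<open>S\<close>, so a function may be replaced by one
  that agrees with it on \<open>S\<close>.\<close>

definition bound_class :: "(real^'n::finite) set \<Rightarrow> ((real^'n \<Rightarrow> real) \<Rightarrow> bool) \<Rightarrow> bool" where
  "bound_class S b \<longleftrightarrow>
     (\<forall>u v w K. b u \<longrightarrow> b v \<longrightarrow> 0 \<le> K \<longrightarrow> (\<forall>x\<in>S. 0 \<le> w x \<and> w x \<le> K * (u x + v x)) \<longrightarrow> b w)"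

lemma bound_classD:
  assumes "bound_class S b" "b u" "b v" "0 \<le> K" "\<And>x. x \<in> S \<Longrightarrow> 0 \<le> w x"
    "\<And>x. x \<in> S \<Longrightarrow> w x \<le> K * (u x + v x)"
  shows "b w"
  using assms unfolding bound_class_def by blast

lemma bound_classD1:
  assumes "bound_class S b" "b u" "0 \<le> K" "\<And>x. x \<in> S \<Longrightarrow> 0 \<le> w x"
    "\<And>x. x \<in> S \<Longrightarrow> w x \<le> K * u x"
  shows "b w"
  by (rule bound_classD[OF assms(1,2,2), of "K/2"]) (use assms in \<open>auto simp: algebra_simps\<close>)

lemma Ck_bounded_bound: "Ck_bounded b S k f \<Longrightarrow> b (\<lambda>x. norm (f x))"
  by (cases k) auto

lemma Ck_bounded_Suc: "Ck_bounded b S (Suc k) f \<Longrightarrow> Ck_bounded b S k f"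
  by (induction k arbitrary: f) (auto simp: Ck_bounded_bound)

lemma Ck_bounded_cong:
  assumes "open S" "bound_class S b"
  shows "Ck_bounded b S k f \<Longrightarrow> (\<And>x. x \<in> S \<Longrightarrow> f x = g x) \<Longrightarrow> Ck_bounded b S k g"
proof (induction k arbitrary: f g)
  case 0
  then show ?case using bound_classD1[OF assms(2), of "\<lambda>x. norm (f x)" 1 "\<lambda>x. norm (g x)"] by auto
next
  case (Suc k)
  have "b (\<lambda>x. norm (g x))"
    using Suc bound_classD1[OF assms(2), of "\<lambda>x. norm (f x)" 1 "\<lambda>x. norm (g x)"] by auto
  moreover have "\<forall>x\<in>S. g differentiable at x"
    using Suc.prems by (auto intro: differentiable_cong_open[OF assms(1), of _ f g])
  moreover have "Ck_bounded b S k (partial_dir i g)" for i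
    by (rule Suc.IH[of "partial_dir i f"])
       (use Suc.prems in \<open>auto intro: partial_dir_cong[OF assms(1)]\<close>)
  ultimately show ?case by auto
qed

lemma Ck_bounded_add:
  assumes "open S" "bound_class S b"
  shows "Ck_bounded b S k f \<Longrightarrow> Ck_bounded b S k g \<Longrightarrow> Ck_bounded b S k (\<lambda>x. f x + g x)"
proof (induction k arbitrary: f g)
  case 0
  then show ?case
    using bound_classD[OF assms(2), of "\<lambda>x. norm (f x)" "\<lambda>x. norm (g x)" 1 "\<lambda>x. norm (f x + g x)"]
    by (auto simp: norm_triangle_ineq)
next
  case (Suc k)
  have "b (\<lambda>x. norm (f x + g x))"
    using Suc bound_classD[OF assms(2), of "\<lambda>x. norm (f x)" "\<lambda>x. norm (g x)" 1 "\<lambda>x. norm (f x + g x)"]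
    by (auto simp: norm_triangle_ineq)
  moreover have "Ck_bounded b S k (partial_dir i (\<lambda>x. f x + g x))" for i
  proof (rule Ck_bounded_cong[OF assms Suc.IH[of "partial_dir i f" "partial_dir i g"]])
    fix x assume "x \<in> S"
    then have "(f has_derivative frechet_derivative f (at x)) (at x)"
      "(g has_derivative frechet_derivative g (at x)) (at x)"
      using Suc.prems by (auto intro!: frechet_derivative_works[THEN iffD1])
    from partial_dir_eqI[OF has_derivative_add[OF this], of i]
    show "partial_dir i f x + partial_dir i g x = partial_dir i (\<lambda>x. f x + g x) x"
      by (simp add: partial_dir_def)
  qed (use Suc.prems in auto)
  ultimately show ?case using Suc.prems by auto
qed

lemma Ck_bounded_linear:
  assumes "open S" "bound_class S b" "bounded_linear L"
  shows "Ck_bounded b S k f \<Longrightarrow> Ck_bounded b S k (\<lambda>x. L (f x))"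
proof (induction k arbitrary: f)
  case 0
  obtain K where K: "K \<ge> 0" "\<And>x. norm (L x) \<le> norm x * K"
    using bounded_linear.nonneg_bounded[OF assms(3)] by blast
  show ?case
    using 0 K bound_classD1[OF assms(2), of "\<lambda>x. norm (f x)" K "\<lambda>x. norm (L (f x))"]
    by (auto simp: mult.commute)
next
  case (Suc k)
  obtain K where K: "K \<ge> 0" "\<And>x. norm (L x) \<le> norm x * K"
    using bounded_linear.nonneg_bounded[OF assms(3)] by blast
  have "b (\<lambda>x. norm (L (f x)))"
    using Suc.prems K bound_classD1[OF assms(2), of "\<lambda>x. norm (f x)" K "\<lambda>x. norm (L (f x))"]
    by (auto simp: mult.commute)
  moreover have D: "((\<lambda>x. L (f x)) has_derivative (\<lambda>v. L (frechet_derivative f (at x) v))) (at x)" if "x \<in> S" for x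
    using that Suc.prems by (auto intro!: frechet_derivative_works[THEN iffD1] bounded_linear.has_derivative[OF assms(3)])
  moreover have "Ck_bounded b S k (partial_dir i (\<lambda>x. L (f x)))" for i
    by (rule Ck_bounded_cong[OF assms(1,2) Suc.IH[of "partial_dir i f"]])
      (use Suc.prems partial_dir_eqI[OF D, of _ i] in \<open>auto simp: partial_dir_def\<close>)
  ultimately show ?case by (auto simp: differentiable_def)
qed

text \<open>Induction through the Leibniz rule. Three separate predicates let one proof serve all
  products that occur: moderate by moderate, moderate by flat, and linearly growing by rapidly
  decreasing.\<close>

lemma Ck_bounded_scaleR:
  fixes f :: "real^'n::finite \<Rightarrow> real" and g :: "real^'n \<Rightarrow> 'b::real_normed_vector"
  assumes "open S" "bound_class S b3" "\<And>u v. b1 u \<Longrightarrow> b2 v \<Longrightarrow> b3 (\<lambda>x. u x * v x)"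
  shows "Ck_bounded b1 S k f \<Longrightarrow> Ck_bounded b2 S k g \<Longrightarrow> Ck_bounded b3 S k (\<lambda>x. f x *\<^sub>R g x)"
proof (induction k arbitrary: f g)
  case 0
  then show ?case using assms(3) by auto
next
  case (Suc k)
  have "b3 (\<lambda>x. norm (f x *\<^sub>R g x))"
    using Suc assms(3) by auto
  moreover have D: "((\<lambda>x. f x *\<^sub>R g x) has_derivative
      (\<lambda>v. f x *\<^sub>R frechet_derivative g (at x) v + frechet_derivative f (at x) v *\<^sub>R g x)) (at x)"
    if "x \<in> S" for x
    by (rule has_derivative_scaleR)
       (use that Suc.prems in \<open>auto intro!: frechet_derivative_works[THEN iffD1]\<close>)
  moreover have "Ck_bounded b3 S k (partial_dir i (\<lambda>x. f x *\<^sub>R g x))" for i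
  proof (rule Ck_bounded_cong[OF assms(1,2)])
    show "Ck_bounded b3 S k (\<lambda>x. f x *\<^sub>R partial_dir i g x + partial_dir i f x *\<^sub>R g x)"
      by (rule Ck_bounded_add[OF assms(1,2)]; rule Suc.IH)
         (use Suc.prems Suc.prems[THEN Ck_bounded_Suc] in auto)
  qed (use partial_dir_eqI[OF D, of _ i] in \<open>auto simp: partial_dir_def\<close>)
  ultimately show ?case by (auto simp: differentiable_def)
qed

text \<open>The bridge to the given definitions. \<open>iter_partials\<close> adds derivatives on
  the outside, whereas \<open>Ck_bounded\<close> consumes the innermost one first; hence the
  induction on lists from the right.\<close>

lemma Ck_bounded_all_iff:
  "(\<forall>k. Ck_bounded b S k f) \<longleftrightarrow>
   (\<forall>is. (\<forall>x\<in>S. iter_partials is f differentiable at x) \<and> b (\<lambda>x. norm (iter_partials is f x)))"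
proof (intro iffI allI)
  fix "is" assume "\<forall>k. Ck_bounded b S k f"
  then show "(\<forall>x\<in>S. iter_partials is f differentiable at x) \<and> b (\<lambda>x. norm (iter_partials is f x))"
  proof (induction "is" arbitrary: f rule: rev_induct)
    case Nil
    from Nil[rule_format, of "Suc 0"] show ?case by auto
  next
    case (snoc i "is")
    have "Ck_bounded b S k (partial_dir i f)" for k
      using snoc.prems[rule_format, of "Suc k"] by auto
    then show ?case using snoc.IH[of "partial_dir i f"] by (simp add: iter_partials_snoc)
  qed
next
  fix k assume "\<forall>is. (\<forall>x\<in>S. iter_partials is f differentiable at x) \<and> b (\<lambda>x. norm (iter_partials is f x))"
  then show "Ck_bounded b S k f"
  proof (induction k arbitrary: f)
    case 0
    from 0[rule_format, of "[]"] show ?case by auto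
  next
    case (Suc k)
    have "Ck_bounded b S k (partial_dir i f)" for i
      using Suc.prems Suc.IH[of "partial_dir i f"] by (metis iter_partials_snoc)
    with Suc.prems[rule_format, of "[]"] show ?case by auto
  qed
qed

text \<open>A family of functions that is closed under partial derivatives, up to equality on
  \<open>S\<close>, has all its members in every class as soon as each member satisfies the bound
  itself. Homogeneous functions, flat functions, Mellin integrals and Fourier transforms are such
  families, so none of them needs an estimate for higher derivatives.\<close>

lemma Ck_bounded_coinduct:
  assumes "open S" "bound_class S b" "P f"
    and bd: "\<And>f. P f \<Longrightarrow> b (\<lambda>x. norm (f x))"
    and diff: "\<And>f x. P f \<Longrightarrow> x \<in> S \<Longrightarrow> f differentiable at x"
    and part: "\<And>f i. P f \<Longrightarrow> \<exists>g. P g \<and> (\<forall>x\<in>S. partial_dir i f x = g x)"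
  shows "Ck_bounded b S k f"
  using \<open>P f\<close>
proof (induction k arbitrary: f)
  case 0
  then show ?case using bd by auto
next
  case (Suc k)
  have "Ck_bounded b S k (partial_dir i f)" for i
  proof -
    obtain g where "P g" "\<forall>x\<in>S. partial_dir i f x = g x" using part[OF Suc.prems] by blast
    with Suc.IH[of g] Ck_bounded_cong[OF assms(1,2), of k g "partial_dir i f"] show ?thesis by auto
  qed
  then show ?case using bd[OF Suc.prems] diff[OF Suc.prems] by auto
qed

lemma smooth_on_open_iff:
  assumes "open S"
  shows "smooth_on_open S f \<longleftrightarrow> (\<forall>k. Ck_bounded (\<lambda>_. True) S k f)"
  using assms by (auto simp: Ck_bounded_all_iff smooth_on_open_def differentiable_on_eq_differentiable_at)

definition rapid :: "(real^'n::finite \<Rightarrow> real) \<Rightarrow> bool" where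
  "rapid u \<longleftrightarrow> (\<forall>k::nat. \<exists>C. \<forall>x. norm x ^ k * \<bar>u x\<bar> \<le> C)"

lemma schwartz_iff: "\<phi> \<in> schwartz \<longleftrightarrow> (\<forall>k. Ck_bounded rapid UNIV k \<phi>)"
  by (auto simp: Ck_bounded_all_iff smooth_on_open_def differentiable_on_eq_differentiable_at schwartz_def rapid_def)

lemma bound_class_True: "bound_class S (\<lambda>_. True)"
  by (simp add: bound_class_def)

lemma bound_class_rapid: "bound_class UNIV rapid"
  unfolding bound_class_def rapid_def
proof (intro allI impI)
  fix u v w :: "real^'a \<Rightarrow> real" and K :: real and k :: nat
  assume *: "\<forall>k. \<exists>C. \<forall>x. norm x ^ k * \<bar>u x\<bar> \<le> C" "\<forall>k. \<exists>C. \<forall>x. norm x ^ k * \<bar>v x\<bar> \<le> C" "0 \<le> K"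
     "\<forall>x\<in>UNIV. 0 \<le> w x \<and> w x \<le> K * (u x + v x)"
  obtain C D where CD: "\<forall>x. norm x ^ k * \<bar>u x\<bar> \<le> C" "\<forall>x. norm x ^ k * \<bar>v x\<bar> \<le> D" using * by metis
  have "norm x ^ k * \<bar>w x\<bar> \<le> K * (C + D)" for x
  proof -
    have "K * (u x + v x) \<le> K * (\<bar>u x\<bar> + \<bar>v x\<bar>)" using * by (intro mult_left_mono) auto
    then have "\<bar>w x\<bar> \<le> K * (\<bar>u x\<bar> + \<bar>v x\<bar>)" using *(4)[rule_format, of x] by simp
    then have "norm x ^ k * \<bar>w x\<bar> \<le> norm x ^ k * (K * (\<bar>u x\<bar> + \<bar>v x\<bar>))" by (intro mult_left_mono) auto
    also have "\<dots> = K * (norm x ^ k * \<bar>u x\<bar> + norm x ^ k * \<bar>v x\<bar>)" by (simp add: algebra_simps)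
    also have "\<dots> \<le> K * (C + D)" using CD * by (intro mult_left_mono add_mono) auto
    finally show ?thesis .
  qed
  then show "\<exists>C. \<forall>x. norm x ^ k * \<bar>w x\<bar> \<le> C" by blast
qed

section \<open>Growth and decay at the origin and at infinity\<close>

definition moderate :: "(real^'n::finite \<Rightarrow> real) \<Rightarrow> bool" where
  "moderate u \<longleftrightarrow> (\<exists>C\<ge>0. \<exists>k\<ge>0. \<forall>x. x \<noteq> 0 \<longrightarrow> \<bar>u x\<bar> \<le> C * exp (k * \<bar>ln (norm x)\<bar>))"

text \<open>For r > 0, \<open>exp \<bar>ln r\<bar>\<close> is the larger of r and 1/r. So
  \<open>moderate\<close> means at most power growth at both ends of every ray, and
  \<open>superflat\<close> means decay faster than every power at both ends.\<close>

definition superflat :: "(real^'n::finite \<Rightarrow> real) \<Rightarrow> bool" where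
  "superflat u \<longleftrightarrow> (\<forall>k. \<exists>C\<ge>0. \<forall>x. x \<noteq> 0 \<longrightarrow> \<bar>u x\<bar> \<le> C * exp (- k * \<bar>ln (norm x)\<bar>))"

lemma bound_class_moderate: "bound_class (-{0}) moderate"
  unfolding bound_class_def moderate_def
proof (intro allI impI)
  fix u v w :: "real^'a \<Rightarrow> real" and K :: real
  let ?L = "\<lambda>x::real^'a. \<bar>ln (norm x)\<bar>"
  assume *: "\<exists>C\<ge>0. \<exists>k\<ge>0. \<forall>x. x \<noteq> 0 \<longrightarrow> \<bar>u x\<bar> \<le> C * exp (k * ?L x)"
     "\<exists>C\<ge>0. \<exists>k\<ge>0. \<forall>x. x \<noteq> 0 \<longrightarrow> \<bar>v x\<bar> \<le> C * exp (k * ?L x)" "0 \<le> K"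
     "\<forall>x\<in>-{0}. 0 \<le> w x \<and> w x \<le> K * (u x + v x)"
  obtain C k where C: "C \<ge> 0" "k \<ge> 0" "\<forall>x. x \<noteq> 0 \<longrightarrow> \<bar>u x\<bar> \<le> C * exp (k * ?L x)" using *(1) by blast
  obtain D l where D: "D \<ge> 0" "l \<ge> 0" "\<forall>x. x \<noteq> 0 \<longrightarrow> \<bar>v x\<bar> \<le> D * exp (l * ?L x)" using *(2) by blast
  have "\<bar>w x\<bar> \<le> K * (C + D) * exp ((k + l) * ?L x)" if "x \<noteq> 0" for x
  proof -
    have "\<bar>w x\<bar> \<le> K * (u x + v x)" using *(4) that by auto
    also have "\<dots> \<le> K * (C * exp ((k + l) * ?L x) + D * exp ((k + l) * ?L x))"
    proof (intro mult_left_mono add_mono)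
      have "u x \<le> C * exp (k * ?L x)" using C that by force
      also have "\<dots> \<le> C * exp ((k + l) * ?L x)" using C D by (intro mult_left_mono) (auto simp: algebra_simps)
      finally show "u x \<le> \<dots>" .
      have "v x \<le> D * exp (l * ?L x)" using D that by force
      also have "\<dots> \<le> D * exp ((k + l) * ?L x)" using C D by (intro mult_left_mono) (auto simp: algebra_simps)
      finally show "v x \<le> \<dots>" .
    qed (use * in auto)
    finally show ?thesis by (simp add: algebra_simps)
  qed
  then show "\<exists>C\<ge>0. \<exists>k\<ge>0. \<forall>x. x \<noteq> 0 \<longrightarrow> \<bar>w x\<bar> \<le> C * exp (k * ?L x)"
    using C(1,2) D(1,2) *(3) by (intro exI[of _ "K * (C + D)"] conjI exI[of _ "k + l"]) auto
qed

lemma bound_class_superflat: "bound_class (-{0}) superflat"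
  unfolding bound_class_def superflat_def
proof (intro allI impI)
  fix u v w :: "real^'a \<Rightarrow> real" and K k :: real
  let ?e = "\<lambda>x::real^'a. exp (- k * \<bar>ln (norm x)\<bar>)"
  assume *: "\<forall>k. \<exists>C\<ge>0. \<forall>x. x \<noteq> 0 \<longrightarrow> \<bar>u x\<bar> \<le> C * exp (- k * \<bar>ln (norm x)\<bar>)"
     "\<forall>k. \<exists>C\<ge>0. \<forall>x. x \<noteq> 0 \<longrightarrow> \<bar>v x\<bar> \<le> C * exp (- k * \<bar>ln (norm x)\<bar>)" "0 \<le> K"
     "\<forall>x\<in>-{0}. 0 \<le> w x \<and> w x \<le> K * (u x + v x)"
  obtain C where C: "C \<ge> 0" "\<forall>x. x \<noteq> 0 \<longrightarrow> \<bar>u x\<bar> \<le> C * ?e x" using *(1) by blast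
  obtain D where D: "D \<ge> 0" "\<forall>x. x \<noteq> 0 \<longrightarrow> \<bar>v x\<bar> \<le> D * ?e x" using *(2) by blast
  have "\<bar>w x\<bar> \<le> K * (C + D) * ?e x" if "x \<noteq> 0" for x
  proof -
    have "\<bar>w x\<bar> \<le> K * (u x + v x)" using *(4) that by auto
    also have "\<dots> \<le> K * (C * ?e x + D * ?e x)"
      using C(2)[rule_format, OF that] D(2)[rule_format, OF that] *(3)
      by (intro mult_left_mono add_mono) auto
    finally show ?thesis by (simp add: algebra_simps)
  qed
  then show "\<exists>C\<ge>0. \<forall>x. x \<noteq> 0 \<longrightarrow> \<bar>w x\<bar> \<le> C * ?e x"
    using C(1) D(1) *(3) by (intro exI[of _ "K * (C + D)"]) auto
qed

lemma moderate_mult: "moderate u \<Longrightarrow> moderate v \<Longrightarrow> moderate (\<lambda>x. u x * v x)"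
proof -
  assume "moderate u" "moderate v"
  then obtain C k D l where C: "C \<ge> 0" "k \<ge> 0" "\<forall>x. x \<noteq> 0 \<longrightarrow> \<bar>u x\<bar> \<le> C * exp (k * \<bar>ln (norm x)\<bar>)"
    and D: "D \<ge> 0" "l \<ge> 0" "\<forall>x. x \<noteq> 0 \<longrightarrow> \<bar>v x\<bar> \<le> D * exp (l * \<bar>ln (norm x)\<bar>)"
    unfolding moderate_def by metis
  have "\<bar>u x * v x\<bar> \<le> C * D * exp ((k + l) * \<bar>ln (norm x)\<bar>)" if "x \<noteq> 0" for x
  proof -
    have "\<bar>u x * v x\<bar> \<le> (C * exp (k * \<bar>ln (norm x)\<bar>)) * (D * exp (l * \<bar>ln (norm x)\<bar>))"
      unfolding abs_mult using C D that by (intro mult_mono) auto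
    then show ?thesis by (simp add: algebra_simps exp_add)
  qed
  then show ?thesis unfolding moderate_def
    using C(1,2) D(1,2) by (intro exI[of _ "C * D"] conjI exI[of _ "k + l"]) auto
qed

lemma moderate_mult_superflat: "moderate u \<Longrightarrow> superflat v \<Longrightarrow> superflat (\<lambda>x. u x * v x)"
  unfolding superflat_def
proof
  fix k
  assume "moderate u" and v: "\<forall>k. \<exists>C\<ge>0. \<forall>x. x \<noteq> 0 \<longrightarrow> \<bar>v x\<bar> \<le> C * exp (- k * \<bar>ln (norm x)\<bar>)"
  then obtain C l where C: "C \<ge> 0" "l \<ge> 0" "\<forall>x. x \<noteq> 0 \<longrightarrow> \<bar>u x\<bar> \<le> C * exp (l * \<bar>ln (norm x)\<bar>)"
    unfolding moderate_def by metis
  \<comment> \<open>Asking for the decay rate \<open>k + l\<close> pays for the growth rate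
    \<open>l\<close> of the other factor.\<close>
  obtain D where D: "D \<ge> 0" "\<forall>x. x \<noteq> 0 \<longrightarrow> \<bar>v x\<bar> \<le> D * exp (- (k + l) * \<bar>ln (norm x)\<bar>)"
    using v by blast
  have "\<bar>u x * v x\<bar> \<le> C * D * exp (- k * \<bar>ln (norm x)\<bar>)" if "x \<noteq> 0" for x
  proof -
    have "\<bar>u x * v x\<bar> \<le> (C * exp (l * \<bar>ln (norm x)\<bar>)) * (D * exp (- (k + l) * \<bar>ln (norm x)\<bar>))"
      unfolding abs_mult using C D that by (intro mult_mono) auto
    also have "\<dots> = C * D * (exp (l * \<bar>ln (norm x)\<bar>) * exp (- (k + l) * \<bar>ln (norm x)\<bar>))"
      by simp
    also have "\<dots> = C * D * exp (- k * \<bar>ln (norm x)\<bar>)"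
      by (subst exp_add[symmetric]) (simp add: algebra_simps)
    finally show ?thesis .
  qed
  then show "\<exists>C\<ge>0. \<forall>x. x \<noteq> 0 \<longrightarrow> \<bar>u x * v x\<bar> \<le> C * exp (- k * \<bar>ln (norm x)\<bar>)"
    using C(1) D(1) by (intro exI[of _ "C * D"]) auto
qed

lemma open_nonzero: "open (- {0::real^'n::finite})" 
  by (simp add: open_Compl)

abbreviation moderate_Ck :: "nat \<Rightarrow> (real^'n::finite \<Rightarrow> 'b::real_normed_vector) \<Rightarrow> bool" where
  "moderate_Ck \<equiv> Ck_bounded moderate (-{0})"

lemmas moderate_Ck_cong = Ck_bounded_cong[OF open_nonzero bound_class_moderate]
lemma moderate_Ck_scaleR:
  "moderate_Ck k f \<Longrightarrow> moderate_Ck k g \<Longrightarrow> moderate_Ck k (\<lambda>x. f x *\<^sub>R g x)"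
  by (rule Ck_bounded_scaleR[OF open_nonzero bound_class_moderate moderate_mult])

lemma superflat_Ck_scaleR:
  "moderate_Ck k f \<Longrightarrow> Ck_bounded superflat (-{0}) k g \<Longrightarrow> Ck_bounded superflat (-{0}) k (\<lambda>x. f x *\<^sub>R g x)"
  by (rule Ck_bounded_scaleR[OF open_nonzero bound_class_superflat moderate_mult_superflat])


lemma moderate_powr: "moderate (\<lambda>x::real^'n::finite. norm x powr p)"
  unfolding moderate_def
  by (rule exI[of _ 1], simp, rule exI[of _ "\<bar>p\<bar>"])
     (auto simp: powr_def abs_mult[symmetric] intro: order_trans[OF abs_ge_self])

lemma partial_dir_const: "partial_dir i (\<lambda>_. c) = (\<lambda>_. 0)"
  by (simp add: partial_dir_def)

lemma moderate_Ck_const: "moderate_Ck k (\<lambda>_::real^'n::finite. c::'b::real_normed_vector)"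
proof (induction k arbitrary: c)
  have "moderate (\<lambda>x::real^'n. norm c)" for c :: 'b
    unfolding moderate_def by (intro exI[of _ "norm c"] conjI exI[of _ 0]) auto
  note [simp] = this
  case 0 show ?case by simp
  case (Suc k) then show ?case by (simp add: partial_dir_const)
qed

lemma has_derivative_component: "((\<lambda>x::real^'n::finite. x $ j) has_derivative (\<lambda>v. v $ j)) (at x)"
  by (rule bounded_linear_imp_has_derivative) (rule bounded_linear_vec_nth)

lemma partial_dir_component: "partial_dir i (\<lambda>x::real^'n::finite. x $ j) = (\<lambda>_. axis i 1 $ j)"
  using partial_dir_eqI[OF has_derivative_component] by blast

lemma moderate_Ck_component: "moderate_Ck k (\<lambda>x::real^'n::finite. x $ j)"
proof -
  have "moderate (\<lambda>x::real^'n. \<bar>x $ j\<bar>)"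
    by (rule bound_classD1[OF bound_class_moderate moderate_powr[of 1], of 1])
       (auto simp: component_le_norm_cart)
  then show ?thesis
    using has_derivative_component
    by (cases k) (auto simp: partial_dir_component differentiable_def moderate_Ck_const)
qed

lemma has_derivative_norm_powr:
  fixes x :: "real^'n::finite"
  assumes "x \<noteq> 0"
  shows "((\<lambda>x. norm x powr p) has_derivative (\<lambda>v. p * norm x powr (p - 2) * (x \<bullet> v))) (at x)"
proof -
  have "((\<lambda>x. norm x powr p) has_derivative (\<lambda>v. (v \<bullet> sgn x) * (p * norm x powr (p - 1)))) (at x)"
    by (rule DERIV_compose_FDERIV[OF _ has_derivative_norm[OF assms]])
       (use assms in \<open>auto intro!: derivative_eq_intros\<close>)
  moreover have "norm x powr (p - 1) = norm x powr (p - 2) * norm x"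
    using assms powr_mult_base[of "norm x" "p - 2"] by (simp add: mult.commute)
  ultimately show ?thesis
    using assms by (simp add: sgn_div_norm divide_simps inner_commute mult_ac)
qed

lemma moderate_Ck_powr: "moderate_Ck k (\<lambda>x::real^'n::finite. norm x powr p)"
proof (induction k arbitrary: p)
  case 0
  then show ?case using moderate_powr by auto
next
  case (Suc k)
  have "moderate_Ck k (partial_dir i (\<lambda>x::real^'n. norm x powr p))" for i
  proof (rule moderate_Ck_cong)
    show "moderate_Ck k (\<lambda>x::real^'n. p *\<^sub>R (x $ i *\<^sub>R norm x powr (p - 2)))"
      by (intro moderate_Ck_scaleR moderate_Ck_const moderate_Ck_component Suc)
    show "p *\<^sub>R (x $ i *\<^sub>R norm x powr (p - 2)) = partial_dir i (\<lambda>x. norm x powr p) x" if "x \<in> -{0}" for x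
      using that by (subst partial_dir_eqI[OF has_derivative_norm_powr]) (auto simp: inner_axis)
  qed
  then show ?case
    using moderate_powr by (auto simp: differentiable_def intro: has_derivative_norm_powr)
qed

lemma has_derivative_ln_norm:
  fixes x :: "real^'n::finite"
  assumes "x \<noteq> 0"
  shows "((\<lambda>x. ln (norm x)) has_derivative (\<lambda>v. norm x powr (-2) * (x \<bullet> v))) (at x)"
proof -
  have "((\<lambda>x. ln (norm x)) has_derivative (\<lambda>v. (v \<bullet> sgn x) * inverse (norm x))) (at x)"
    by (rule DERIV_compose_FDERIV[OF DERIV_ln has_derivative_norm[OF assms]])
       (use assms in auto)
  moreover have "norm x powr (-2) = inverse (norm x) * inverse (norm x)"
    using assms by (simp add: powr_minus power2_eq_square)
  ultimately show ?thesis
    by (simp add: sgn_div_norm mult_ac inner_commute)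
qed

lemma moderate_Ck_ln: "moderate_Ck k (\<lambda>x::real^'n::finite. ln (norm x))"
proof -
  have b: "moderate (\<lambda>x::real^'n. \<bar>ln (norm x)\<bar>)"
    unfolding moderate_def
  proof (intro exI[of _ 1] conjI allI impI)
    fix x :: "real^'n"
    have "\<bar>ln (norm x)\<bar> \<le> exp \<bar>ln (norm x)\<bar>" using exp_ge_add_one_self[of "\<bar>ln (norm x)\<bar>"] by linarith
    then show "\<bar>\<bar>ln (norm x)\<bar>\<bar> \<le> 1 * exp (1 * \<bar>ln (norm x)\<bar>)" by simp
  qed auto
  have "moderate_Ck k (partial_dir i (\<lambda>x::real^'n. ln (norm x)))" for i k
  proof (rule moderate_Ck_cong)
    show "moderate_Ck k (\<lambda>x::real^'n. x $ i *\<^sub>R norm x powr (- 2))"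
      by (intro moderate_Ck_scaleR moderate_Ck_component moderate_Ck_powr)
    show "x $ i *\<^sub>R norm x powr (- 2) = partial_dir i (\<lambda>x. ln (norm x)) x" if "x \<in> -{0}" for x
      using that by (subst partial_dir_eqI[OF has_derivative_ln_norm]) (auto simp: inner_axis)
  qed
  then show ?thesis
    using b has_derivative_ln_norm by (cases k) (auto simp: differentiable_def)
qed

text \<open>A cutoff adapted to the dilation structure: as a function of \<open>ln (norm x)\<close> it is a Gaussian,
  hence it vanishes to infinite order at 0 and at infinity.\<close>

definition lognormal :: "real^'n::finite \<Rightarrow> real" where
  "lognormal x = exp (- (ln (norm x))\<^sup>2)"

lemma has_derivative_lognormal:
  fixes x :: "real^'n::finite"
  assumes "x \<noteq> 0"
  shows "(lognormal has_derivative (\<lambda>v. - 2 * ln (norm x) * (norm x powr (-2) * (x \<bullet> v)) * lognormal x)) (at x)"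
  unfolding lognormal_def[abs_def]
proof -
  have "((\<lambda>y. exp (- y\<^sup>2)) has_real_derivative (- 2 * ln (norm x) * exp (- (ln (norm x))\<^sup>2))) (at (ln (norm x)))"
    by (auto intro!: derivative_eq_intros)
  from DERIV_compose_FDERIV[OF this has_derivative_ln_norm[OF assms]]
  show "((\<lambda>x. exp (- (ln (norm x))\<^sup>2)) has_derivative
     (\<lambda>v. - 2 * ln (norm x) * (norm x powr (-2) * (x \<bullet> v)) * exp (- (ln (norm x))\<^sup>2))) (at x)"
    by (simp add: mult_ac)
qed

lemma superflat_lognormal: "superflat (\<lambda>x::real^'n::finite. \<bar>lognormal x\<bar>)"
  unfolding superflat_def
proof (intro allI exI[of _ "exp (k\<^sup>2 / 4)" for k] conjI impI)
  fix k :: real and x :: "real^'n"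
  \<comment> \<open>Completing the square: k s - s^2 is at most k^2/4, the origin of the
    constant.\<close>
  have "(\<bar>ln (norm x)\<bar> - k / 2)\<^sup>2 \<ge> 0" by simp
  then have "- (ln (norm x))\<^sup>2 \<le> k\<^sup>2 / 4 + (- k * \<bar>ln (norm x)\<bar>)"
    by (simp add: power2_eq_square algebra_simps abs_mult[symmetric])
  then show "\<bar>\<bar>lognormal x\<bar>\<bar> \<le> exp (k\<^sup>2 / 4) * exp (- k * \<bar>ln (norm x)\<bar>)"
    unfolding lognormal_def exp_add[symmetric] by simp
qed auto

text \<open>Each partial derivative is a moderate factor times \<open>lognormal\<close> itself, so
  the induction hypothesis applies to the same function.\<close>

lemma superflat_Ck_lognormal: "Ck_bounded superflat (-{0}) k (lognormal :: real^'n::finite \<Rightarrow> real)"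
proof (induction k)
  case 0
  then show ?case using superflat_lognormal by auto
next
  case (Suc k)
  have "Ck_bounded superflat (-{0}) k (partial_dir i (lognormal :: real^'n \<Rightarrow> real))" for i
  proof (rule Ck_bounded_cong[OF open_nonzero bound_class_superflat])
    show "Ck_bounded superflat (-{0}) k
            (\<lambda>x::real^'n. ((- 2) *\<^sub>R ln (norm x) *\<^sub>R x $ i *\<^sub>R norm x powr (- 2)) *\<^sub>R lognormal x)"
      by (intro superflat_Ck_scaleR[OF _ Suc] moderate_Ck_scaleR moderate_Ck_const moderate_Ck_component moderate_Ck_powr moderate_Ck_ln)
    show "((- 2) *\<^sub>R ln (norm x) *\<^sub>R x $ i *\<^sub>R norm x powr (- 2)) *\<^sub>R lognormal x
        = partial_dir i lognormal x" if "x \<in> -{0}" for x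
      using that by (subst partial_dir_eqI[OF has_derivative_lognormal]) (auto simp: inner_axis)
  qed
  then show ?case
    using superflat_lognormal has_derivative_lognormal by (auto simp: differentiable_def)
qed

section \<open>Homogeneous functions\<close>

definition homogeneous :: "real \<Rightarrow> (real^'n::finite \<Rightarrow> 'b::real_normed_vector) \<Rightarrow> bool" where
  "homogeneous d f \<longleftrightarrow> (\<forall>t>0. \<forall>x. x \<noteq> 0 \<longrightarrow> f (t *\<^sub>R x) = t powr d *\<^sub>R f x)"

text \<open>Differentiate \<open>f (t *\<^sub>R x)\<close> in x twice, once by the chain rule and
  once through homogeneity, and compare; the chain rule contributes the factor t that lowers the
  degree.\<close>

lemma homogeneous_partial_dir:
  fixes f :: "real^'n::finite \<Rightarrow> 'b::real_normed_vector"
  assumes "homogeneous d f" "\<And>x. x \<noteq> 0 \<Longrightarrow> f differentiable at x"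
  shows "homogeneous (d - 1) (partial_dir i f)"
  unfolding homogeneous_def
proof (intro allI impI)
  fix t :: real and x :: "real^'n" assume t: "t > 0" and x: "x \<noteq> 0"
  have D: "(f has_derivative frechet_derivative f (at x)) (at x)" if "x \<noteq> 0" for x
    using assms(2) that frechet_derivative_works by blast
  have "((\<lambda>x. t *\<^sub>R x) has_derivative (\<lambda>v. t *\<^sub>R v)) (at x)"
    by (auto intro!: derivative_eq_intros)
  from has_derivative_compose[OF this D] t x
  have 1: "((\<lambda>x. f (t *\<^sub>R x)) has_derivative (\<lambda>v. frechet_derivative f (at (t *\<^sub>R x)) (t *\<^sub>R v))) (at x)"
    by simp
  have "((\<lambda>x. t powr d *\<^sub>R f x) has_derivative (\<lambda>v. t powr d *\<^sub>R frechet_derivative f (at x) v)) (at x)"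
    by (rule has_derivative_scaleR_right[OF D[OF x]])
  then have 2: "((\<lambda>x. f (t *\<^sub>R x)) has_derivative (\<lambda>v. t powr d *\<^sub>R frechet_derivative f (at x) v)) (at x)"
    by (rule has_derivative_transform_within_open[OF _ open_nonzero])
       (use x t assms(1) in \<open>auto simp: homogeneous_def\<close>)
  have "linear (frechet_derivative f (at (t *\<^sub>R x)))"
    using D[of "t *\<^sub>R x"] x t has_derivative_linear by auto
  then have "t *\<^sub>R partial_dir i f (t *\<^sub>R x) = frechet_derivative f (at (t *\<^sub>R x)) (t *\<^sub>R axis i 1)"
    by (simp add: partial_dir_def linear_scale)
  also have "\<dots> = t powr d *\<^sub>R partial_dir i f x"
    using fun_cong[OF has_derivative_unique[OF 1 2], of "axis i 1"] by (simp add: partial_dir_def)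
  finally have "t *\<^sub>R partial_dir i f (t *\<^sub>R x) = t powr d *\<^sub>R partial_dir i f x" .
  then have "inverse t *\<^sub>R t *\<^sub>R partial_dir i f (t *\<^sub>R x) = inverse t *\<^sub>R t powr d *\<^sub>R partial_dir i f x"
    by (rule arg_cong)
  then have "partial_dir i f (t *\<^sub>R x) = (inverse t * t powr d) *\<^sub>R partial_dir i f x"
    using t by simp
  also have "inverse t * t powr d = t powr (d - 1)"
    using t by (simp add: powr_diff divide_inverse_commute)
  finally show "partial_dir i f (t *\<^sub>R x) = t powr (d - 1) *\<^sub>R partial_dir i f x" .
qed

lemma homogeneous_moderate:
  fixes f :: "real^'n::finite \<Rightarrow> 'b::real_normed_vector"
  assumes "homogeneous d f" "\<And>x. x \<noteq> 0 \<Longrightarrow> f differentiable at x"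
  shows "moderate (\<lambda>x. norm (f x))"
proof -
  have "continuous_on (sphere 0 1) f"
    by (intro continuous_at_imp_continuous_on ballI differentiable_imp_continuous_within assms(2)) auto
  then have "bounded (f ` sphere 0 1)"
    by (intro compact_imp_bounded compact_continuous_image) auto
  then obtain C where C: "\<forall>y\<in>f ` sphere 0 1. norm y \<le> C" "C > 0" by (metis bounded_pos)
  show ?thesis
  proof (rule bound_classD1[OF bound_class_moderate moderate_powr[of d], of C])
    fix x :: "real^'n" assume x: "x \<in> -{0}"
    then have "f x = norm x powr d *\<^sub>R f (x /\<^sub>R norm x)"
      using assms(1)[unfolded homogeneous_def, rule_format, of "norm x" "x /\<^sub>R norm x"] by auto
    moreover have "norm (f (x /\<^sub>R norm x)) \<le> C" using C x by auto
    ultimately show "norm (f x) \<le> C * norm x powr d"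
      by (metis abs_of_nonneg mult_right_mono norm_scaleR powr_ge_zero mult.commute)
  qed (use C in auto)
qed

text \<open>Growth bounds come for free with smoothness: a derivative is homogeneous again, and a
  homogeneous function is controlled by its maximum on the compact sphere.\<close>

lemma moderate_Ck_homogeneous:
  fixes f :: "real^'n::finite \<Rightarrow> 'b::real_normed_vector"
  assumes "homogeneous d f" "\<And>k. Ck_bounded (\<lambda>_. True) (-{0}) k f"
  shows "moderate_Ck k f"
proof (rule Ck_bounded_coinduct[where P = "\<lambda>f. (\<exists>d. homogeneous d f) \<and> (\<forall>k. Ck_bounded (\<lambda>_. True) (-{0}) k f)", OF open_nonzero bound_class_moderate])
  fix f :: "real^'n \<Rightarrow> 'b" and i
  assume P: "(\<exists>d. homogeneous d f) \<and> (\<forall>k. Ck_bounded (\<lambda>_. True) (-{0}) k f)"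
  then obtain d where d: "homogeneous d f" by blast
  have D: "Ck_bounded (\<lambda>_. True) (-{0}) (Suc k) f" for k using P by blast
  then have D0: "f differentiable at x" if "x \<noteq> 0" for x using that by auto
  then show "f differentiable at x" if "x \<in> -{0}" for x using that by auto
  show "moderate (\<lambda>x. norm (f x))" using homogeneous_moderate[OF d D0] .
  show "\<exists>g. ((\<exists>d. homogeneous d g) \<and> (\<forall>k. Ck_bounded (\<lambda>_. True) (-{0}) k g)) \<and> (\<forall>x\<in>-{0}. partial_dir i f x = g x)"
    using homogeneous_partial_dir[OF d D0] D by (intro exI[of _ "partial_dir i f"]) auto
qed (use assms in blast)

section \<open>Flat functions as Schwartz functions\<close>

lemma superflat_imp_rapid:
  assumes "superflat u" "u 0 = 0"
  shows "rapid u"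
  unfolding rapid_def
proof
  fix k :: nat
  obtain C where C: "C \<ge> 0" "\<And>x. x \<noteq> 0 \<Longrightarrow> \<bar>u x\<bar> \<le> C * exp (- real k * \<bar>ln (norm x)\<bar>)"
    using assms(1) unfolding superflat_def by metis
  have "norm x ^ k * \<bar>u x\<bar> \<le> C" for x
  proof (cases "x = 0")
    case False
    then have "norm x ^ k = exp (real k * ln (norm x))" by (simp add: exp_of_nat_mult)
    then have "norm x ^ k * \<bar>u x\<bar> \<le> exp (real k * ln (norm x)) * (C * exp (- real k * \<bar>ln (norm x)\<bar>))"
      using C(2)[OF False] by (simp add: mult_left_mono)
    also have "\<dots> = C * exp (real k * ln (norm x) - real k * \<bar>ln (norm x)\<bar>)"
      by (simp add: exp_diff exp_minus field_simps)
    also have "\<dots> \<le> C" using C(1) by (intro mult_left_le) (auto simp: mult_left_mono)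
    finally show ?thesis .
  qed (use C assms(2) in auto)
  then show "\<exists>C. \<forall>x. norm x ^ k * \<bar>u x\<bar> \<le> C" by blast
qed

lemma superflat_has_derivative_0:
  fixes f :: "real^'n::finite \<Rightarrow> 'b::real_normed_vector"
  assumes "superflat (\<lambda>x. norm (f x))" "f 0 = 0"
  shows "(f has_derivative (\<lambda>_. 0)) (at 0)"
proof -
  \<comment> \<open>Rate 2 gives \<open>norm (f x) \<le> C * norm x ^ 2\<close> near and away from
    0, one power more than the difference quotient divides out.\<close>
  obtain C where C: "C \<ge> 0" "\<And>x. x \<noteq> 0 \<Longrightarrow> norm (f x) \<le> C * exp (- 2 * \<bar>ln (norm x)\<bar>)"
    using assms(1) unfolding superflat_def by (metis abs_norm_cancel)
  have "norm (norm (f x) / norm x) \<le> C * norm x" if "x \<noteq> 0" for x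
  proof -
    have "exp (- 2 * \<bar>ln (norm x)\<bar>) \<le> exp (2 * ln (norm x))" by simp
    also have "\<dots> = norm x ^ 2" using that exp_of_nat_mult[of 2 "ln (norm x)"] by simp
    finally have "norm (f x) \<le> C * norm x ^ 2" using C(1) C(2)[OF that] by (meson mult_left_mono order_trans)
    then have "norm (f x) / norm x \<le> C * norm x ^ 2 / norm x" by (rule divide_right_mono) simp
    also have "C * norm x ^ 2 / norm x = C * norm x" using that by (simp add: power2_eq_square)
    finally show ?thesis by (simp only: real_norm_def abs_divide abs_norm_cancel)
  qed
  then have "\<forall>\<^sub>F x in at 0. norm (norm (f x) / norm x) \<le> C * norm x"
    by (simp only: eventually_at_filter) (auto intro: always_eventually)
  moreover have "((\<lambda>x::real^'n. C * norm x) \<longlongrightarrow> 0) (at 0)"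
    by (auto intro!: tendsto_eq_intros)
  ultimately have "((\<lambda>x. norm (f x) / norm x) \<longlongrightarrow> 0) (at 0)"
    by (rule Lim_null_comparison)
  then show ?thesis
    using assms(2) by (simp add: has_derivative_at)
qed

text \<open>Only the origin is in question. Flatness forces the derivative there to be 0, so every
  partial derivative is again flat and vanishes at 0; this is the invariant of the
  coinduction.\<close>

lemma superflat_imp_schwartz:
  assumes "\<And>k. Ck_bounded superflat (-{0}) k f" "f 0 = 0"
  shows "f \<in> schwartz"
  unfolding schwartz_iff
proof
  fix k
  let ?P = "\<lambda>f. (\<forall>k. Ck_bounded superflat (-{0}) k f) \<and> f 0 = 0"
  show "Ck_bounded rapid UNIV k f"
  proof (rule Ck_bounded_coinduct[where P = ?P, OF open_UNIV bound_class_rapid])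
    fix f :: "real^'a \<Rightarrow> complex" and i assume f: "?P f"
    have D: "Ck_bounded superflat (-{0}) (Suc k) f" for k using f by blast
    then have b: "superflat (\<lambda>x. norm (f x))" using Ck_bounded_bound by blast
    show "rapid (\<lambda>x. norm (f x))" using superflat_imp_rapid[OF b] f by auto
    note d0 = superflat_has_derivative_0[OF b conjunct2[OF f]]
    show "f differentiable at x" for x
      using D[of 0] d0 by (cases "x = 0") (auto simp: differentiable_def)
    have "partial_dir i f 0 = 0" using partial_dir_eqI[OF d0] .
    then show "\<exists>g. ?P g \<and> (\<forall>x\<in>UNIV. partial_dir i f x = g x)"
      using D by (intro exI[of _ "partial_dir i f"]) auto
  qed (use assms in blast)
qed

text \<open>The value at 0 is imposed, because functions in \<open>Ce_inf\<close> are arbitrary off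
  the sphere and the product formula would involve \<open>h 0\<close>.\<close>

definition cutoff_extension :: "(real^'n::finite \<Rightarrow> real) \<Rightarrow> real^'n \<Rightarrow> complex" where
  "cutoff_extension h x = (if x = 0 then 0 else complex_of_real (h (x /\<^sub>R norm x) * lognormal x))"

lemma Ce_inf_moderate:
  fixes h :: "real^'n::finite \<Rightarrow> real"
  assumes "h \<in> Ce_inf"
  shows "moderate_Ck k (\<lambda>x. h (x /\<^sub>R norm x))"
proof (rule moderate_Ck_homogeneous[of 0])
  show "homogeneous 0 (\<lambda>x. h (x /\<^sub>R norm x))"
    unfolding homogeneous_def
  proof (intro allI impI)
    fix t :: real and x :: "real^'n" assume "t > 0" "x \<noteq> 0"
    then have "(t *\<^sub>R x) /\<^sub>R norm (t *\<^sub>R x) = x /\<^sub>R norm x" by (simp add: field_simps)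
    then show "h ((t *\<^sub>R x) /\<^sub>R norm (t *\<^sub>R x)) = t powr 0 *\<^sub>R h (x /\<^sub>R norm x)"
      using \<open>t > 0\<close> by (simp only: powr_zero_eq_one) simp
  qed
qed (use assms in \<open>auto simp: Ce_inf_def smooth_on_open_iff[OF open_nonzero]\<close>)

lemma cutoff_extension_schwartz:
  fixes h :: "real^'n::finite \<Rightarrow> real"
  assumes "h \<in> Ce_inf"
  shows "cutoff_extension h \<in> schwartz"
proof (rule superflat_imp_schwartz)
  fix k
  have "Ck_bounded superflat (-{0}) k (\<lambda>x. complex_of_real (h (x /\<^sub>R norm x) *\<^sub>R lognormal x))"
    by (intro Ck_bounded_linear[OF open_nonzero bound_class_superflat bounded_linear_of_real]
        superflat_Ck_scaleR Ce_inf_moderate[OF assms] superflat_Ck_lognormal)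
  then show "Ck_bounded superflat (-{0}) k (cutoff_extension h)"
    by (rule Ck_bounded_cong[OF open_nonzero bound_class_superflat]) (auto simp: cutoff_extension_def)
qed (simp add: cutoff_extension_def)

lemma Ce_inf_even: "h \<in> Ce_inf \<Longrightarrow> x \<noteq> 0 \<Longrightarrow> h (- x /\<^sub>R norm x) = h (x /\<^sub>R norm x)"
  by (auto simp: Ce_inf_def)

lemma cutoff_extension_even:
  "h \<in> Ce_inf \<Longrightarrow> cutoff_extension h (- x) = cutoff_extension h x"
  using Ce_inf_even[of h x] by (auto simp: cutoff_extension_def lognormal_def)

section \<open>Polar coordinates\<close>

lemma integrable_exp_abs:
  fixes c :: real assumes "0 < c"
  shows "integrable lborel (\<lambda>t::real. exp (- c * \<bar>t\<bar>))"
proof -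
  have 1: "integrable lborel (\<lambda>t. indicator {0<..} t *\<^sub>R exp (- (t * c)))"
    using integrable_I0i_exp_mscale[OF assms] by (simp add: set_integrable_def)
  have 2: "integrable lborel (\<lambda>t. indicator {0<..} (- t) *\<^sub>R exp (- (- t * c)))"
    using lborel_integrable_real_affine[OF 1, of "-1" 0] by simp
  have 3: "AE t::real in lborel. indicator {0<..} t *\<^sub>R exp (- (t * c)) +
          indicator {0<..} (- t) *\<^sub>R exp (- (- t * c)) = exp (- c * \<bar>t\<bar>)"
    using AE_lborel_singleton[of "0::real"] by eventually_elim (auto simp: indicator_def mult.commute)
  show ?thesis
    by (rule Bochner_Integration.integrable_cong_AE[THEN iffD1, OF _ _ 3 Bochner_Integration.integrable_add[OF 1 2]])
       measurable
qed

lemma nn_integral_lborel_scale: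
  fixes f :: "'a::euclidean_space \<Rightarrow> ennreal"
  assumes [measurable]: "f \<in> borel_measurable borel"
  shows "(\<integral>\<^sup>+x. f x \<partial>lborel) = ennreal (exp (real DIM('a) * t)) * (\<integral>\<^sup>+x. f (exp t *\<^sub>R x) \<partial>lborel)"
  by (subst lborel_affine[of "exp t" 0])
     (simp_all add: nn_integral_density nn_integral_distr nn_integral_cmult exp_of_nat_mult)

lemma lborel_scale_distr:
  "(lborel :: 'a::euclidean_space measure) = density (distr lborel borel (\<lambda>x. exp t *\<^sub>R x)) (\<lambda>_. ennreal (exp (real DIM('a) * t)))"
  using lborel_affine[of "exp t" "0::'a"] by (simp add: exp_of_nat_mult)

lemma integrable_lborel_scale:
  fixes f :: "'a::euclidean_space \<Rightarrow> 'b::{banach, second_countable_topology}"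
  assumes "integrable lborel f"
  shows "integrable lborel (\<lambda>x. f (exp t *\<^sub>R x))"
proof -
  have [measurable]: "f \<in> borel_measurable borel" using assms by auto
  have "integrable lborel (\<lambda>x. exp (real DIM('a) * t) *\<^sub>R f (exp t *\<^sub>R x))"
    using assms
    by (subst (asm) lborel_scale_distr[of t]) (simp add: integrable_density integrable_distr_eq)
  from integrable_scaleR_right[OF this, of "exp (- (real DIM('a) * t))"] show ?thesis
    by (simp add: exp_minus)
qed

lemma integral_lborel_scale:
  fixes f :: "'a::euclidean_space \<Rightarrow> 'b::{banach, second_countable_topology}"
  assumes [measurable]: "f \<in> borel_measurable borel"
  shows "(LINT x|lborel. f x) = exp (real DIM('a) * t) *\<^sub>R (LINT x|lborel. f (exp t *\<^sub>R x))"
  by (subst lborel_scale_distr[of t]) (simp add: integral_density integral_distr)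

text \<open>Put r = \<open>exp t * norm x\<close> for x in the unit ball. Then the ray integral of
  r^n f with respect to dr/r becomes an integral over t, with weight
  \<open>norm (exp t *\<^sub>R x) ^ n\<close>. Averaging over the ball with the factor n is the same
  normalisation as in \<open>sphere_integral\<close>.\<close>

definition polar_weight :: "'a::euclidean_space \<Rightarrow> real \<Rightarrow> real" where
  "polar_weight x t = real DIM('a) * indicator (ball 0 1) x * norm (exp t *\<^sub>R x) ^ DIM('a)"

lemma polar_weight_nonneg: "0 \<le> polar_weight x t"
  by (simp add: polar_weight_def)

lemma polar_weight_measurable [measurable]:
  "(\<lambda>(x::'a::euclidean_space, t). polar_weight x t) \<in> borel_measurable (borel \<Otimes>\<^sub>M borel)"
proof -
  have [measurable]: "ball (0::'a) 1 \<in> sets borel" by simp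
  show ?thesis unfolding polar_weight_def split_beta' by measurable
qed

lemma nn_integral_exp_tail:
  assumes "0 < c"
  shows "(\<integral>\<^sup>+t. ennreal (c * exp (- c * t)) * indicator {a<..} t \<partial>lborel) = ennreal (exp (- c * a))"
proof -
  have "(\<integral>\<^sup>+t. ennreal (c * exp (- c * t)) * indicator {a<..} t \<partial>lborel) =
        (\<integral>\<^sup>+t. ennreal (c * exp (- c * t)) * indicator {a..} t \<partial>lborel)"
  proof (rule nn_integral_cong_AE)
    show "AE t in lborel. ennreal (c * exp (- c * t)) * indicator {a<..} t = ennreal (c * exp (- c * t)) * indicator {a..} t"
      using AE_lborel_singleton[of a] by eventually_elim (auto simp: indicator_def)
  qed
  also have "\<dots> = ennreal (0 - - exp (- c * a))"
  proof (subst nn_integral_FTC_atLeast[where F = "\<lambda>t. - exp (- c * t)" and T = 0])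
    show "((\<lambda>t. - exp (- c * t)) \<longlongrightarrow> 0) at_top" using assms by real_asymp
  qed (use assms in \<open>auto intro!: derivative_eq_intros\<close>)
  finally show ?thesis by simp
qed

text \<open>Substitute y = \<open>exp t *\<^sub>R x\<close> for fixed t and exchange the integrals.
  What remains for fixed y is the integral of \<open>n * exp (- n * t)\<close> over t >
  \<open>ln (norm y)\<close>, that is \<open>norm y\<close> to the power -n, which cancels the
  weight.\<close>

lemma nn_integral_polar:
  fixes f :: "'a::euclidean_space \<Rightarrow> ennreal"
  assumes [measurable]: "f \<in> borel_measurable borel"
  shows "(\<integral>\<^sup>+x. f x \<partial>lborel) = (\<integral>\<^sup>+x. \<integral>\<^sup>+t. ennreal (polar_weight x t) * f (exp t *\<^sub>R x) \<partial>lborel \<partial>lborel)"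
proof -
  let ?n = "real DIM('a)"
  \<comment> \<open>The integrand after the substitution: \<open>exp (- n * t)\<close> is the
    Jacobian, and the unit ball has become the ball of radius \<open>exp t\<close>.\<close>
  let ?g = "\<lambda>t y. ennreal (?n * exp (- ?n * t) * indicator (ball 0 (exp t)) y * norm y ^ DIM('a)) * f y"
  have [measurable]: "(\<lambda>p::'a \<times> real. indicator (ball 0 (exp (snd p))) (fst p) :: real) \<in> borel_measurable (borel \<Otimes>\<^sub>M borel)"
    unfolding indicator_def mem_ball by measurable
  have [measurable]: "ball (0::'a) r \<in> sets borel" for r by simp
  have inner: "(\<integral>\<^sup>+x. ennreal (polar_weight x t) * f (exp t *\<^sub>R x) \<partial>lborel) = (\<integral>\<^sup>+y. ?g t y \<partial>lborel)" for t
  proof -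
    have "(\<integral>\<^sup>+y. ?g t y \<partial>lborel) = ennreal (exp (?n * t)) * (\<integral>\<^sup>+y. ?g t (exp t *\<^sub>R y) \<partial>lborel)"
      by (rule nn_integral_lborel_scale) measurable
    also have "\<dots> = (\<integral>\<^sup>+y. ennreal (exp (?n * t)) * ?g t (exp t *\<^sub>R y) \<partial>lborel)"
      by (rule nn_integral_cmult[symmetric]) measurable
    also have "\<dots> = (\<integral>\<^sup>+x. ennreal (polar_weight x t) * f (exp t *\<^sub>R x) \<partial>lborel)"
    proof (rule nn_integral_cong)
      fix x :: 'a
      have "exp (?n * t) * (?n * exp (- ?n * t) * indicator (ball 0 (exp t)) (exp t *\<^sub>R x) * norm (exp t *\<^sub>R x) ^ DIM('a))
         = polar_weight x t"
        by (simp add: polar_weight_def exp_minus field_simps indicator_def)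
      then show "ennreal (exp (?n * t)) * ?g t (exp t *\<^sub>R x) = ennreal (polar_weight x t) * f (exp t *\<^sub>R x)"
        by (simp only: mult.assoc[symmetric] ennreal_mult''[symmetric] exp_ge_zero)
           (simp add: ennreal_mult''[symmetric] mult.assoc[symmetric])
    qed
    finally show ?thesis by simp
  qed
  have "(\<integral>\<^sup>+x. \<integral>\<^sup>+t. ennreal (polar_weight x t) * f (exp t *\<^sub>R x) \<partial>lborel \<partial>lborel)
      = (\<integral>\<^sup>+t. \<integral>\<^sup>+x. ennreal (polar_weight x t) * f (exp t *\<^sub>R x) \<partial>lborel \<partial>lborel)"
    by (rule lborel_pair.Fubini') (simp add: split_beta')
  also have "\<dots> = (\<integral>\<^sup>+t. \<integral>\<^sup>+y. ?g t y \<partial>lborel \<partial>lborel)"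
    by (simp only: inner)
  also have "\<dots> = (\<integral>\<^sup>+y. \<integral>\<^sup>+t. ?g t y \<partial>lborel \<partial>lborel)"
    by (rule lborel_pair.Fubini') (simp add: split_beta')
  also have "\<dots> = (\<integral>\<^sup>+y. f y \<partial>lborel)"
  proof (rule nn_integral_cong_AE)
    show "AE y in lborel. (\<integral>\<^sup>+t. ?g t y \<partial>lborel) = f y"
      using AE_lborel_singleton[of "0::'a"]
    proof eventually_elim
      fix y :: 'a assume y: "y \<noteq> 0"
      have "(\<integral>\<^sup>+t. ?g t y \<partial>lborel) =
        (\<integral>\<^sup>+t. (ennreal (norm y ^ DIM('a)) * f y) * (ennreal (?n * exp (- ?n * t)) * indicator {ln (norm y)<..} t) \<partial>lborel)"
      proof (rule nn_integral_cong)
        fix t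
        have "norm y < exp t \<longleftrightarrow> ln (norm y) < t"
          using y by (metis exp_less_cancel_iff exp_ln zero_less_norm_iff)
        then show "?g t y = (ennreal (norm y ^ DIM('a)) * f y) * (ennreal (?n * exp (- ?n * t)) * indicator {ln (norm y)<..} t)"
          by (auto simp: indicator_def ennreal_mult' mult_ac)
      qed
      also have "\<dots> = (ennreal (norm y ^ DIM('a)) * f y) * ennreal (exp (- ?n * ln (norm y)))"
        by (subst nn_integral_cmult) (simp_all only: nn_integral_exp_tail of_nat_0_less_iff DIM_positive, measurable)
      also have "\<dots> = ennreal (norm y ^ DIM('a) * exp (- ?n * ln (norm y))) * f y"
        by (simp add: ennreal_mult' mult_ac)
      also have "norm y ^ DIM('a) * exp (- ?n * ln (norm y)) = 1"
        using y by (simp add: exp_minus exp_of_nat_mult)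
      finally show "(\<integral>\<^sup>+t. ?g t y \<partial>lborel) = f y" by simp
    qed
  qed
  finally show ?thesis by simp
qed

text \<open>As an identity of measures, the formula for nonnegative functions passes to Bochner
  integrals of vector-valued functions.\<close>

lemma lborel_polar:
  "(lborel :: 'a::euclidean_space measure) =
     distr (density (lborel \<Otimes>\<^sub>M lborel) (\<lambda>(x, t). ennreal (polar_weight x t))) borel (\<lambda>(x, t). exp t *\<^sub>R x)"
  (is "_ = distr (density ?L ?w) _ ?T")
proof (rule measure_eqI)
  fix A :: "'a set" assume "A \<in> sets lborel"
  then have [measurable]: "A \<in> sets borel" by simp
  have [measurable]: "?T \<in> borel_measurable (lborel \<Otimes>\<^sub>M lborel)" by (simp add: split_beta')
  have "emeasure (distr (density ?L ?w) borel ?T) A = (\<integral>\<^sup>+y. indicator A y \<partial>distr (density ?L ?w) borel ?T)"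
    by simp
  also have "\<dots> = (\<integral>\<^sup>+p. ?w p * indicator A (?T p) \<partial>?L)"
    by (subst nn_integral_distr, measurable) (subst nn_integral_density, measurable)
  also have "\<dots> = (\<integral>\<^sup>+x. \<integral>\<^sup>+t. ennreal (polar_weight x t) * indicator A (exp t *\<^sub>R x) \<partial>lborel \<partial>lborel)"
    by (subst lborel.nn_integral_fst[symmetric]) (simp_all add: split_beta')
  also have "\<dots> = emeasure lborel A"
    by (subst nn_integral_polar[symmetric]) auto
  finally show "emeasure lborel A = emeasure (distr (density ?L ?w) borel ?T) A" by simp
qed simp

lemma
  fixes f :: "'a::euclidean_space \<Rightarrow> 'b::{banach, second_countable_topology}"
  assumes f: "integrable lborel f"
  shows integrable_polar: "integrable (lborel \<Otimes>\<^sub>M lborel) (\<lambda>(x, t). polar_weight x t *\<^sub>R f (exp t *\<^sub>R x))"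
    and integral_polar: "(LINT x|lborel. f x) = (LINT x|lborel. LINT t|lborel. polar_weight x t *\<^sub>R f (exp t *\<^sub>R x))"
proof -
  have [measurable]: "f \<in> borel_measurable borel" using f by auto
  have [measurable]: "(\<lambda>(x, t). exp t *\<^sub>R (x::'a)) \<in> borel_measurable (lborel \<Otimes>\<^sub>M lborel)" by (simp add: split_beta')
  have eq: "(\<lambda>p. (case p of (x, t) \<Rightarrow> polar_weight x t) *\<^sub>R f (case p of (x, t) \<Rightarrow> exp t *\<^sub>R x)) =
     (\<lambda>(x, t). polar_weight x t *\<^sub>R f (exp t *\<^sub>R x))" by auto
  show i: "integrable (lborel \<Otimes>\<^sub>M lborel) (\<lambda>(x, t). polar_weight x t *\<^sub>R f (exp t *\<^sub>R x))"
    using f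
    by (subst (asm) lborel_polar)
       (simp add: integrable_distr_eq split_beta' integrable_density polar_weight_nonneg)
  have "(LINT x|lborel. f x) = (LINT p|(lborel \<Otimes>\<^sub>M lborel). (case p of (x, t) \<Rightarrow> polar_weight x t *\<^sub>R f (exp t *\<^sub>R x)))"
    by (subst lborel_polar)
       (simp add: integral_distr split_beta' integral_density polar_weight_nonneg)
  then show "(LINT x|lborel. f x) = (LINT x|lborel. LINT t|lborel. polar_weight x t *\<^sub>R f (exp t *\<^sub>R x))"
    by (subst lborel_pair.integral_fst[OF i])
qed

text \<open>In the logarithmic radius, Lebesgue measure along a ray has density r^n. The hypothesis
  therefore bounds the integrand on each ray by a two-sided exponential, uniformly over the
  rays.\<close>

lemma integrable_radial_bound:
  fixes f :: "'a::euclidean_space \<Rightarrow> 'b::{banach, second_countable_topology}"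
  assumes [measurable]: "f \<in> borel_measurable borel" and "0 < c" "0 \<le> C"
    and bd: "\<And>x. x \<noteq> 0 \<Longrightarrow> norm x ^ DIM('a) * norm (f x) \<le> C * exp (- c * \<bar>ln (norm x)\<bar>)"
  shows "integrable lborel f"
proof (rule integrableI_bounded)
  let ?n = "real DIM('a)"
  obtain K where K: "(\<integral>\<^sup>+t. ennreal (exp (- c * \<bar>t\<bar>)) \<partial>lborel) = ennreal K"
    using nn_integral_eq_integral[OF integrable_exp_abs[OF assms(2)]] by auto
  have "(\<integral>\<^sup>+x. norm (f x) \<partial>lborel) =
      (\<integral>\<^sup>+x. \<integral>\<^sup>+t. ennreal (polar_weight x t) * ennreal (norm (f (exp t *\<^sub>R x))) \<partial>lborel \<partial>lborel)"
    by (rule nn_integral_polar) measurable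
  also have "\<dots> \<le> (\<integral>\<^sup>+x. ennreal (?n * C * K) * indicator (ball 0 1) (x::'a) \<partial>lborel)"
  proof (rule nn_integral_mono_AE)
    show "AE x in lborel. (\<integral>\<^sup>+t. ennreal (polar_weight x t) * ennreal (norm (f (exp t *\<^sub>R x))) \<partial>lborel)
       \<le> ennreal (?n * C * K) * indicator (ball 0 1) x"
      using AE_lborel_singleton[of "0::'a"]
    proof eventually_elim
      fix x :: 'a assume x: "x \<noteq> 0"
      have "(\<integral>\<^sup>+t. ennreal (polar_weight x t) * ennreal (norm (f (exp t *\<^sub>R x))) \<partial>lborel)
        \<le> (\<integral>\<^sup>+t. ennreal (?n * C * indicator (ball 0 1) x) * ennreal (exp (- c * \<bar>ln (norm x) + 1 * t\<bar>)) \<partial>lborel)"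
      proof (rule nn_integral_mono)
        fix t
        have "ln (norm (exp t *\<^sub>R x)) = ln (norm x) + 1 * t" using x by (simp add: ln_mult)
        then have "norm (exp t *\<^sub>R x) ^ DIM('a) * norm (f (exp t *\<^sub>R x)) \<le> C * exp (- c * \<bar>ln (norm x) + 1 * t\<bar>)"
          using bd[of "exp t *\<^sub>R x"] x by (simp del: norm_scaleR)
        then have "?n * indicator (ball 0 1) x * (norm (exp t *\<^sub>R x) ^ DIM('a) * norm (f (exp t *\<^sub>R x)))
          \<le> ?n * indicator (ball 0 1) x * (C * exp (- c * \<bar>ln (norm x) + 1 * t\<bar>))"
          by (intro mult_left_mono) auto
        then show "ennreal (polar_weight x t) * ennreal (norm (f (exp t *\<^sub>R x)))
          \<le> ennreal (?n * C * indicator (ball 0 1) x) * ennreal (exp (- c * \<bar>ln (norm x) + 1 * t\<bar>))"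
          unfolding polar_weight_def using assms(3)
          by (subst ennreal_mult'[symmetric], simp)+ (intro ennreal_leI, simp only: mult_ac)
      qed
      also have "\<dots> = ennreal (?n * C * indicator (ball 0 1) x) * (\<integral>\<^sup>+t. ennreal (exp (- c * \<bar>ln (norm x) + 1 * t\<bar>)) \<partial>lborel)"
        by (rule nn_integral_cmult) measurable
      \<comment> \<open>Translation invariance in t removes the dependence on x; the factor
        \<open>1 * t\<close> gives the integrand the form that
        \<open>nn_integral_real_affine\<close> expects.\<close>
      also have "(\<integral>\<^sup>+t. ennreal (exp (- c * \<bar>ln (norm x) + 1 * t\<bar>)) \<partial>lborel) = ennreal K"
        using nn_integral_real_affine[of "\<lambda>t. ennreal (exp (- c * \<bar>t\<bar>))" 1 "ln (norm x)"] K by simp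
      finally show "(\<integral>\<^sup>+t. ennreal (polar_weight x t) * ennreal (norm (f (exp t *\<^sub>R x))) \<partial>lborel)
       \<le> ennreal (?n * C * K) * indicator (ball 0 1) x"
        using assms(3) by (auto simp: indicator_def ennreal_mult'[symmetric])
    qed
  qed
  also have "\<dots> = ennreal (?n * C * K) * emeasure lborel (ball (0::'a) 1)"
    by (rule nn_integral_cmult_indicator) simp
  also have "\<dots> < \<infinity>"
    using emeasure_bounded_finite[OF bounded_ball, of "0::'a" 1] by (simp add: ennreal_mult_less_top)
  finally show "(\<integral>\<^sup>+x. norm (f x) \<partial>lborel) < \<infinity>" .
qed simp

section \<open>Differentiation under the integral and Mellin integrals\<close>

text \<open>Dominated convergence is applied to the normalised first-order remainder of the
  integrand. The bound on the partial derivatives over the whole ball dominates it, through the mean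
  value inequality on a convex set.\<close>

lemma has_derivative_integral_dominated:
  fixes f :: "real^'n::finite \<Rightarrow> 't \<Rightarrow> 'b::{banach, second_countable_topology}"
  assumes "0 < r"
    and int: "\<And>x. x \<in> ball x0 r \<Longrightarrow> integrable M (f x)"
    and der: "\<And>x t. x \<in> ball x0 r \<Longrightarrow> ((\<lambda>x. f x t) has_derivative (\<lambda>v. \<Sum>i\<in>UNIV. v $ i *\<^sub>R p i x t)) (at x)"
    and bd: "\<And>x t i. x \<in> ball x0 r \<Longrightarrow> norm (p i x t) \<le> g t"
    and g: "integrable M g"
    and meas: "\<And>i. p i x0 \<in> borel_measurable M"
  shows "((\<lambda>x. LINT t|M. f x t) has_derivative (\<lambda>v. \<Sum>i\<in>UNIV. v $ i *\<^sub>R (LINT t|M. p i x0 t))) (at x0)"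
proof -
  let ?K = "real CARD('n)"
  let ?R = "\<lambda>x t. f x t - (f x0 t + (\<Sum>i\<in>UNIV. (x - x0) $ i *\<^sub>R p i x0 t))"
  have x0: "x0 \<in> ball x0 r" using assms(1) by simp
  have sum_bd: "norm (\<Sum>i\<in>UNIV. v $ i *\<^sub>R p i x t) \<le> (?K * g t) * norm v" if "x \<in> ball x0 r" for x t and v :: "real^'n"
  proof -
    have "norm (\<Sum>i\<in>UNIV. v $ i *\<^sub>R p i x t) \<le> (\<Sum>i\<in>(UNIV::'n set). norm v * g t)"
      by (intro sum_norm_le) (auto simp: component_le_norm_cart intro!: mult_mono bd that)
    then show ?thesis by (simp add: mult_ac)
  qed
  \<comment> \<open>Any index will do; \<open>undefined\<close> merely names one, index types being
    nonempty.\<close>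
  have g0: "0 \<le> g t" for t using bd[OF x0, of undefined t] norm_ge_zero order_trans by blast
  have lip: "norm (f x t - f x0 t) \<le> (?K * g t) * norm (x - x0)" if "x \<in> ball x0 r" for x t
  proof (rule differentiable_bound[OF convex_ball, where f' = "\<lambda>y v. \<Sum>i\<in>UNIV. v $ i *\<^sub>R p i y t"])
    show "((\<lambda>x. f x t) has_derivative (\<lambda>v. \<Sum>i\<in>UNIV. v $ i *\<^sub>R p i y t)) (at y within ball x0 r)" if "y \<in> ball x0 r" for y
      by (rule has_derivative_at_withinI[OF der[OF that]])
    show "onorm (\<lambda>v. \<Sum>i\<in>UNIV. v $ i *\<^sub>R p i y t) \<le> ?K * g t" if "y \<in> ball x0 r" for y
      using sum_bd[OF that] g0 by (intro onorm_bound) auto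
  qed (use that x0 in auto)
  \<comment> \<open>One copy of the constant comes from the Lipschitz bound for the increment, the
    other from the linear part; hence the factor 2.\<close>
  have Rbd: "norm (?R x t) \<le> (2 * ?K * g t) * norm (x - x0)" if "x \<in> ball x0 r" for x t
  proof -
    have "norm (?R x t) \<le> norm (f x t - f x0 t) + norm (\<Sum>i\<in>UNIV. (x - x0) $ i *\<^sub>R p i x0 t)"
      unfolding diff_diff_eq[symmetric] by (rule norm_triangle_ineq4)
    then show ?thesis using lip[OF that, of t] sum_bd[OF x0, of "x - x0" t] by linarith
  qed
  have pint: "integrable M (p i x0)" for i
    by (rule Bochner_Integration.integrable_bound[OF g meas]) (auto intro!: AE_I2 bd[OF x0] order_trans[OF bd[OF x0] abs_ge_self])
  have Rint: "integrable M (?R x)" if "x \<in> ball x0 r" for x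
    using int[OF that] int[OF x0] pint by auto
  have Req: "(LINT t|M. f x t) - ((LINT t|M. f x0 t) + (\<Sum>i\<in>UNIV. (x - x0) $ i *\<^sub>R (LINT t|M. p i x0 t))) = (LINT t|M. ?R x t)"
    if "x \<in> ball x0 r" for x
    using int[OF that] int[OF x0] pint by (simp del: vector_minus_component)
  have bl: "bounded_linear (\<lambda>v::real^'n. \<Sum>i\<in>UNIV. v $ i *\<^sub>R q i)" for q :: "'n \<Rightarrow> 'b"
    by (intro bounded_linear_sum bounded_linear_compose[OF bounded_linear_scaleR_left bounded_linear_vec_nth])
  have lim: "((\<lambda>x. (1 / norm (x - x0)) *\<^sub>R (LINT t|M. ?R x t)) \<longlongrightarrow> 0) (at x0)"
    unfolding tendsto_at_iff_sequentially
  proof (intro allI impI)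
    fix X :: "nat \<Rightarrow> real^'n" assume X: "\<forall>i. X i \<in> UNIV - {x0}" "X \<longlonglongrightarrow> x0"
    \<comment> \<open>The dominating bound holds only inside the ball, so the sequence is shifted
      past its first \<open>N\<close> terms, which leaves the limit unchanged.\<close>
    obtain N where N: "\<And>i. i \<ge> N \<Longrightarrow> X i \<in> ball x0 r"
      using X(2) assms(1) unfolding lim_sequentially by (metis dist_commute mem_ball)
    define Y where "Y i = X (i + N)" for i
    have Y: "Y i \<in> ball x0 r" "Y i \<noteq> x0" for i using X N by (auto simp: Y_def)
    have Ylim: "Y \<longlonglongrightarrow> x0" unfolding Y_def using LIMSEQ_ignore_initial_segment[OF X(2)] .
    have "(\<lambda>i. LINT t|M. (1 / norm (Y i - x0)) *\<^sub>R ?R (Y i) t) \<longlonglongrightarrow> (LINT t|M. 0)"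
    proof (rule integral_dominated_convergence[where w = "\<lambda>t. 2 * ?K * g t"])
      show "AE t in M. (\<lambda>i. (1 / norm (Y i - x0)) *\<^sub>R ?R (Y i) t) \<longlonglongrightarrow> 0"
      proof (rule AE_I2)
        fix t
        have "((\<lambda>x. (1 / norm (x - x0)) *\<^sub>R ?R x t) \<longlongrightarrow> 0) (at x0)"
          using der[OF x0, of t] unfolding has_derivative_within by blast
        then show "(\<lambda>i. (1 / norm (Y i - x0)) *\<^sub>R ?R (Y i) t) \<longlonglongrightarrow> 0"
          unfolding tendsto_at_iff_sequentially using Y Ylim by (auto simp: o_def)
      qed
      show "AE t in M. norm ((1 / norm (Y i - x0)) *\<^sub>R ?R (Y i) t) \<le> 2 * ?K * g t" for i
      proof (rule AE_I2)
        fix t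
        have "norm (Y i - x0) > 0" using Y by simp
        then show "norm ((1 / norm (Y i - x0)) *\<^sub>R ?R (Y i) t) \<le> 2 * ?K * g t"
          using Rbd[OF Y(1), of i t] by (simp add: pos_divide_le_eq del: vector_minus_component)
      qed
    qed (use g Rint[OF Y(1)] in \<open>auto simp del: vector_minus_component\<close>)
    moreover have "(LINT t|M. (1 / norm (Y i - x0)) *\<^sub>R ?R (Y i) t) = (1 / norm (Y i - x0)) *\<^sub>R (LINT t|M. ?R (Y i) t)" for i
      by (rule integral_scaleR_right)
    ultimately have "(\<lambda>i. (1 / norm (Y i - x0)) *\<^sub>R (LINT t|M. ?R (Y i) t)) \<longlonglongrightarrow> 0"
      by (simp only: Bochner_Integration.integral_zero)
    then show "((\<lambda>x. (1 / norm (x - x0)) *\<^sub>R (LINT t|M. ?R x t)) \<circ> X) \<longlonglongrightarrow> 0"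
      unfolding Y_def o_def by (rule LIMSEQ_offset)
  qed
  show ?thesis
    unfolding has_derivative_within
  proof (intro conjI bl)
    have "\<forall>\<^sub>F x in at x0. x \<in> ball x0 r" using assms(1) by (auto simp: eventually_at dist_commute)
    then have "\<forall>\<^sub>F x in at x0. (1 / norm (x - x0)) *\<^sub>R (LINT t|M. ?R x t) = (1 / norm (x - x0)) *\<^sub>R
        ((LINT t|M. f x t) - ((LINT t|M. f x0 t) + (\<Sum>i\<in>UNIV. (x - x0) $ i *\<^sub>R (LINT t|M. p i x0 t))))"
      by eventually_elim (simp only: Req)
    from tendsto_cong[OF this] lim
    show "((\<lambda>x. (1 / norm (x - x0)) *\<^sub>R
        ((LINT t|M. f x t) - ((LINT t|M. f x0 t) + (\<Sum>i\<in>UNIV. (x - x0) $ i *\<^sub>R (LINT t|M. p i x0 t))))) \<longlongrightarrow> 0) (at x0)"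
      by blast
  qed
qed

text \<open>Near 0, u is bounded and \<open>c \<le> a\<close> makes \<open>norm y powr a\<close> at
  most \<open>norm y powr c\<close>. Far out, decay of order at least a + c beats the power a and
  leaves a rate of at least c.\<close>

lemma rapid_powr_bound:
  fixes u :: "real^'n::finite \<Rightarrow> real"
  assumes "rapid u" "0 < c" "c \<le> a"
  obtains C where "0 \<le> C" "\<And>y. y \<noteq> 0 \<Longrightarrow> norm y powr a * \<bar>u y\<bar> \<le> C * exp (- c * \<bar>ln (norm y)\<bar>)"
proof -
  obtain k :: nat where k: "a + c \<le> real k" using real_arch_simple by blast
  obtain C0 where C0: "\<And>x. norm x ^ 0 * \<bar>u x\<bar> \<le> C0" using assms(1) unfolding rapid_def by metis
  obtain C1 where C1: "\<And>x. norm x ^ k * \<bar>u x\<bar> \<le> C1" using assms(1) unfolding rapid_def by metis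
  have "0 \<le> norm (0::real^'n) ^ k * \<bar>u 0\<bar>" by simp
  from order_trans[OF this C1] C0[of 0] have pos: "0 \<le> C0" "0 \<le> C1" by auto
  have "norm y powr a * \<bar>u y\<bar> \<le> (C0 + C1) * exp (- c * \<bar>ln (norm y)\<bar>)" if y: "y \<noteq> 0" for y
  proof (cases "ln (norm y) \<le> 0")
    case True
    have "a * ln (norm y) \<le> c * ln (norm y)"
      using True assms(3) by (rule mult_right_mono_neg[rotated])
    then have "norm y powr a \<le> exp (- c * \<bar>ln (norm y)\<bar>)"
      using True y by (simp add: powr_def)
    then have "norm y powr a * \<bar>u y\<bar> \<le> exp (- c * \<bar>ln (norm y)\<bar>) * (C0 + C1)"
      using C0[of y] pos by (intro mult_mono) auto
    then show ?thesis by (simp add: mult.commute)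
  next
    case False
    have "norm y ^ k = exp (real k * ln (norm y))" using y by (simp add: exp_of_nat_mult)
    then have "norm y powr a = exp ((a - real k) * ln (norm y)) * norm y ^ k"
      using y by (simp add: powr_def exp_add[symmetric] algebra_simps)
    then have "norm y powr a * \<bar>u y\<bar> = exp ((a - real k) * ln (norm y)) * (norm y ^ k * \<bar>u y\<bar>)" by simp
    also have "\<dots> \<le> exp (- c * \<bar>ln (norm y)\<bar>) * (C0 + C1)"
    proof (intro mult_mono)
      have "(a - real k) * ln (norm y) \<le> - c * ln (norm y)"
        using False k by (intro mult_right_mono) auto
      then show "exp ((a - real k) * ln (norm y)) \<le> exp (- c * \<bar>ln (norm y)\<bar>)" using False by simp
    qed (use C1[of y] pos in auto)
    finally show ?thesis by (simp add: mult.commute)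
  qed
  with pos that[of "C0 + C1"] show ?thesis by auto
qed

text \<open>The bound separates into a factor in x and an integrable factor in t, as needed both for
  domination near a point and for Fubini. The two powers of \<open>norm x\<close> arise from
  bounding \<open>exp (c * \<bar>v\<bar>)\<close> by \<open>exp (- c * v) + exp (c * v)\<close> for
  v = \<open>ln (norm x)\<close>.\<close>

lemma rapid_dilation_bound:
  fixes u :: "real^'n::finite \<Rightarrow> real"
  assumes "rapid u" "0 < c" "c \<le> a"
  obtains C where "0 \<le> C" "\<And>x t. x \<noteq> 0 \<Longrightarrow>
    exp (a * t) * \<bar>u (exp t *\<^sub>R x)\<bar> \<le> C * (norm x powr (- a - c) + norm x powr (c - a)) * exp (- c * \<bar>t\<bar>)"
proof -
  obtain C where C: "0 \<le> C" "\<And>y. y \<noteq> 0 \<Longrightarrow> norm y powr a * \<bar>u y\<bar> \<le> C * exp (- c * \<bar>ln (norm y)\<bar>)"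
    using rapid_powr_bound[OF assms] by blast
  have "exp (a * t) * \<bar>u (exp t *\<^sub>R x)\<bar> \<le> C * (norm x powr (- a - c) + norm x powr (c - a)) * exp (- c * \<bar>t\<bar>)"
    if x: "x \<noteq> 0" for x t
  proof -
    let ?v = "ln (norm x)"
    have ln: "ln (norm (exp t *\<^sub>R x)) = t + ?v" using x by (simp add: ln_mult)
    have "exp (a * t) = exp (- a * ?v) * norm (exp t *\<^sub>R x) powr a"
      using x ln by (simp add: powr_def exp_add[symmetric] algebra_simps del: norm_scaleR)
    then have "exp (a * t) * \<bar>u (exp t *\<^sub>R x)\<bar> = exp (- a * ?v) * (norm (exp t *\<^sub>R x) powr a * \<bar>u (exp t *\<^sub>R x)\<bar>)"
      by simp
    also have "\<dots> \<le> exp (- a * ?v) * (C * exp (- c * \<bar>t + ?v\<bar>))"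
      using C(2)[of "exp t *\<^sub>R x"] x ln by (intro mult_left_mono) (auto simp del: norm_scaleR)
    also have "\<dots> \<le> exp (- a * ?v) * (C * ((exp (- c * ?v) + exp (c * ?v)) * exp (- c * \<bar>t\<bar>)))"
    proof (intro mult_left_mono)
      have "c * \<bar>t\<bar> \<le> c * (\<bar>t + ?v\<bar> + \<bar>?v\<bar>)" using assms(2) by (intro mult_left_mono) auto
      then have "exp (- c * \<bar>t + ?v\<bar>) \<le> exp (c * \<bar>?v\<bar> + - c * \<bar>t\<bar>)" by (simp add: algebra_simps)
      also have "\<dots> = exp (c * \<bar>?v\<bar>) * exp (- c * \<bar>t\<bar>)" by (rule exp_add)
      also have "\<dots> \<le> (exp (- c * ?v) + exp (c * ?v)) * exp (- c * \<bar>t\<bar>)"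
        by (intro mult_right_mono) (auto simp: abs_if)
      finally show "exp (- c * \<bar>t + ?v\<bar>) \<le> (exp (- c * ?v) + exp (c * ?v)) * exp (- c * \<bar>t\<bar>)" .
    qed (use C in auto)
    also have "\<dots> = C * (exp (- a * ?v) * exp (- c * ?v) + exp (- a * ?v) * exp (c * ?v)) * exp (- c * \<bar>t\<bar>)"
      by (simp add: algebra_simps)
    also have "exp (- a * ?v) * exp (- c * ?v) = norm x powr (- a - c)"
      using x by (simp add: powr_def exp_add[symmetric] algebra_simps)
    also have "exp (- a * ?v) * exp (c * ?v) = norm x powr (c - a)"
      using x by (simp add: powr_def exp_add[symmetric] algebra_simps)
    finally show ?thesis .
  qed
  with C(1) that show ?thesis by blast
qed

section \<open>Calculus of Schwartz functions\<close>

lemma schwartz_differentiable: "\<phi> \<in> schwartz \<Longrightarrow> \<phi> differentiable at x"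
proof -
  assume "\<phi> \<in> schwartz"
  then have "Ck_bounded rapid UNIV (Suc 0) \<phi>" unfolding schwartz_iff by blast
  then show ?thesis by auto
qed

lemma schwartz_has_derivative:
  "\<phi> \<in> schwartz \<Longrightarrow> (\<phi> has_derivative (\<lambda>v. \<Sum>i\<in>UNIV. v $ i *\<^sub>R partial_dir i \<phi> x)) (at x)"
  by (intro has_derivative_partial_dir schwartz_differentiable)

lemma schwartz_rapid: "\<phi> \<in> schwartz \<Longrightarrow> rapid (\<lambda>x. norm (\<phi> x))"
  unfolding schwartz_iff using Ck_bounded_bound by blast

lemma schwartz_partial_dir: "\<phi> \<in> schwartz \<Longrightarrow> partial_dir i \<phi> \<in> schwartz"
  unfolding schwartz_iff
proof
  fix k assume "\<forall>k. Ck_bounded rapid UNIV k \<phi>"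
  then have "Ck_bounded rapid UNIV (Suc k) \<phi>" by blast
  then show "Ck_bounded rapid UNIV k (partial_dir i \<phi>)" by auto
qed

lemma schwartz_continuous: "\<phi> \<in> schwartz \<Longrightarrow> continuous_on UNIV \<phi>"
  by (intro continuous_at_imp_continuous_on ballI differentiable_imp_continuous_within schwartz_differentiable)

lemma schwartz_measurable [measurable_dest]: "\<phi> \<in> schwartz \<Longrightarrow> \<phi> \<in> borel_measurable borel"
  by (intro borel_measurable_continuous_onI schwartz_continuous)

lemma schwartz_linear:
  assumes "bounded_linear L" "\<phi> \<in> schwartz"
  shows "(\<lambda>x. L (\<phi> x)) \<in> schwartz"
  using assms(2) unfolding schwartz_iff by (auto intro: Ck_bounded_linear[OF open_UNIV bound_class_rapid assms(1)])

lemma rapid_component_mult: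
  assumes "\<exists>C. \<forall>x. \<bar>u x\<bar> \<le> C * (1 + norm x)" "rapid v"
  shows "rapid (\<lambda>x. u x * v x)"
  unfolding rapid_def
proof
  fix k :: nat
  obtain C where C: "\<And>x. \<bar>u x\<bar> \<le> C * (1 + norm x)" using assms by blast
  have "0 \<le> C" using C[of 0] by simp
  obtain C0 where C0: "\<And>x. norm x ^ k * \<bar>v x\<bar> \<le> C0" using assms(2) unfolding rapid_def by metis
  obtain C1 where C1: "\<And>x. norm x ^ Suc k * \<bar>v x\<bar> \<le> C1" using assms(2) unfolding rapid_def by metis
  have "norm x ^ k * \<bar>u x * v x\<bar> \<le> C * (C0 + C1)" for x
  proof -
    have "norm x ^ k * \<bar>u x * v x\<bar> = \<bar>u x\<bar> * (norm x ^ k * \<bar>v x\<bar>)" by (simp add: abs_mult)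
    also have "\<dots> \<le> (C * (1 + norm x)) * (norm x ^ k * \<bar>v x\<bar>)" using C by (intro mult_right_mono) auto
    also have "\<dots> = C * (norm x ^ k * \<bar>v x\<bar> + norm x ^ Suc k * \<bar>v x\<bar>)" by (simp add: algebra_simps)
    also have "\<dots> \<le> C * (C0 + C1)" using C0[of x] C1[of x] \<open>0 \<le> C\<close> by (intro mult_left_mono add_mono) auto
    finally show ?thesis .
  qed
  then show "\<exists>C. \<forall>x. norm x ^ k * \<bar>u x * v x\<bar> \<le> C" by blast
qed

lemma schwartz_component_mult:
  assumes "\<phi> \<in> schwartz"
  shows "(\<lambda>x. x $ i *\<^sub>R \<phi> x) \<in> schwartz"
  unfolding schwartz_iff
proof
  fix k
  \<comment> \<open>Linear growth on the whole space is used for the multiplier here, since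
    \<open>moderate\<close> gives no control at the origin.\<close>
  let ?b = "\<lambda>u::real^'a \<Rightarrow> real. \<exists>C. \<forall>x. \<bar>u x\<bar> \<le> C * (1 + norm x)"
  have const: "Ck_bounded ?b UNIV k (\<lambda>_. c::real)" for c k
  proof (induction k arbitrary: c)
    have "?b (\<lambda>_. norm c)" for c :: real
    proof (intro exI allI)
      show "\<bar>norm c\<bar> \<le> norm c * (1 + norm x)" for x :: "real^'a"
        by (simp add: algebra_simps)
    qed
    note [simp] = this[simplified]
    case 0 show ?case by simp
    case (Suc k) then show ?case by (simp add: partial_dir_const)
  qed
  have "?b (\<lambda>x. norm (x $ i))"
    by (rule exI[of _ 1]) (auto simp: intro: order_trans[OF component_le_norm_cart])
  then have "Ck_bounded ?b UNIV k (\<lambda>x::real^'a. x $ i)"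
    using has_derivative_component
    by (cases k) (auto simp: partial_dir_component differentiable_def const)
  then show "Ck_bounded rapid UNIV k (\<lambda>x. x $ i *\<^sub>R \<phi> x)"
    using assms
    by (intro Ck_bounded_scaleR[OF open_UNIV bound_class_rapid rapid_component_mult]) (auto simp: schwartz_iff)
qed

lemma schwartz_powr_integrable:
  fixes \<phi> :: "real^'n::finite \<Rightarrow> complex"
  assumes "\<phi> \<in> schwartz" "- real CARD('n) < p"
  shows "integrable lborel (\<lambda>x. norm x powr p *\<^sub>R \<phi> x)"
proof -
  let ?n = "real CARD('n)"
  note [measurable] = schwartz_measurable[OF assms(1)]
  \<comment> \<open>The rate and the power are both n + p, which is positive because
    \<open>- n < p\<close>.\<close>
  obtain C where C: "0 \<le> C" "\<And>y. y \<noteq> 0 \<Longrightarrow> norm y powr (?n + p) * \<bar>norm (\<phi> y)\<bar> \<le> C * exp (- (?n + p) * \<bar>ln (norm y)\<bar>)"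
    using rapid_powr_bound[OF schwartz_rapid[OF assms(1)], of "?n + p" "?n + p"] assms(2) by auto
  show ?thesis
  proof (rule integrable_radial_bound[where c = "?n + p" and C = C])
    fix x :: "real^'n" assume x: "x \<noteq> 0"
    then show "norm x ^ DIM(real^'n) * norm (norm x powr p *\<^sub>R \<phi> x) \<le> C * exp (- (?n + p) * \<bar>ln (norm x)\<bar>)"
      using C(2)[OF x] by (simp add: powr_add powr_realpow)
  qed (use C assms in auto)
qed

lemma schwartz_integrable: "\<phi> \<in> schwartz \<Longrightarrow> integrable lborel \<phi>"
proof -
  assume \<phi>: "\<phi> \<in> schwartz"
  note [measurable] = schwartz_measurable[OF \<phi>]
  \<comment> \<open>The two sides may differ only at the origin, where \<open>0 powr 0\<close> is
    0.\<close>
  have "AE x in lborel. norm x powr 0 *\<^sub>R \<phi> x = \<phi> x"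
    using AE_lborel_singleton[of "0::real^'a"] by eventually_elim auto
  from Bochner_Integration.integrable_cong_AE[OF _ _ this] schwartz_powr_integrable[OF \<phi>, of 0] show ?thesis by simp
qed

text \<open>With r = \<open>exp t\<close> this is the classical integral of r^(a-1) \<phi>(r x) over
  r > 0, a Mellin transform along the ray through x.\<close>

definition mellin :: "real \<Rightarrow> (real^'n::finite \<Rightarrow> complex) \<Rightarrow> real^'n \<Rightarrow> complex" where
  "mellin a \<phi> x = (LINT t|lborel. exp (a * t) *\<^sub>R \<phi> (exp t *\<^sub>R x))"

lemma mellin_integrable:
  assumes "\<phi> \<in> schwartz" "0 < a" "x \<noteq> 0"
  shows "integrable lborel (\<lambda>t. exp (a * t) *\<^sub>R \<phi> (exp t *\<^sub>R x))"
proof -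
  note [measurable] = schwartz_measurable[OF assms(1)]
  obtain C where C: "0 \<le> C" "\<And>x t. x \<noteq> 0 \<Longrightarrow>
    exp (a * t) * \<bar>norm (\<phi> (exp t *\<^sub>R x))\<bar> \<le> C * (norm x powr (- a - a) + norm x powr (a - a)) * exp (- a * \<bar>t\<bar>)"
    using rapid_dilation_bound[OF schwartz_rapid[OF assms(1)] assms(2) order_refl] by blast
  show ?thesis
    by (rule Bochner_Integration.integrable_bound[OF integrable_mult_right[OF integrable_exp_abs[OF assms(2)]],
          of _ "C * (norm x powr (- a - a) + norm x powr (a - a))"])
       (use C(2)[OF assms(3)] in \<open>auto intro!: AE_I2 order_trans[OF _ abs_ge_self]\<close>)
qed

text \<open>The chain rule produces a factor \<open>exp t\<close>, so differentiation raises the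
  exponent by one. The ball of radius \<open>norm x / 2\<close> stays away from 0 and gives the
  bounds uniformity in y.\<close>

lemma mellin_has_derivative:
  fixes \<phi> :: "real^'n::finite \<Rightarrow> complex"
  assumes "\<phi> \<in> schwartz" "0 < a" "x \<noteq> 0"
  shows "(mellin a \<phi> has_derivative (\<lambda>v. \<Sum>i\<in>UNIV. v $ i *\<^sub>R mellin (a + 1) (partial_dir i \<phi>) x)) (at x)"
proof -
  let ?d = "norm x / 2"
  have "\<exists>C\<ge>0. \<forall>y t. norm y \<ge> ?d \<longrightarrow> exp ((a + 1) * t) * norm (partial_dir i \<phi> (exp t *\<^sub>R y)) \<le> C * exp (- a * \<bar>t\<bar>)" for i
  proof -
    obtain C where C: "0 \<le> C" "\<And>y t. y \<noteq> 0 \<Longrightarrow>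
      exp ((a + 1) * t) * \<bar>norm (partial_dir i \<phi> (exp t *\<^sub>R y))\<bar> \<le> C * (norm y powr (- (a + 1) - a) + norm y powr (a - (a + 1))) * exp (- a * \<bar>t\<bar>)"
      using rapid_dilation_bound[OF schwartz_rapid[OF schwartz_partial_dir[OF assms(1)]] assms(2), of "a + 1" i] by auto
    let ?D = "C * (?d powr (- (a + 1) - a) + ?d powr (a - (a + 1)))"
    have "exp ((a + 1) * t) * norm (partial_dir i \<phi> (exp t *\<^sub>R y)) \<le> ?D * exp (- a * \<bar>t\<bar>)" if y: "norm y \<ge> ?d" for y t
    proof -
      have "y \<noteq> 0" using y assms(3) by auto
      then have "exp ((a + 1) * t) * norm (partial_dir i \<phi> (exp t *\<^sub>R y)) \<le> C * (norm y powr (- (a + 1) - a) + norm y powr (a - (a + 1))) * exp (- a * \<bar>t\<bar>)"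
        using C(2)[of y t] by simp
      \<comment> \<open>Both powers of \<open>norm y\<close> have negative exponents, namely -(2a +
        1) and -1, so they are largest at the lower bound \<open>?d\<close>.\<close>
      also have "\<dots> \<le> ?D * exp (- a * \<bar>t\<bar>)"
        using y assms C(1) by (intro mult_right_mono mult_left_mono add_mono powr_mono2') auto
      finally show ?thesis .
    qed
    then show ?thesis using C(1) by (intro exI[of _ ?D]) auto
  qed
  then obtain C where C: "\<And>i. 0 \<le> C i" "\<And>i y t. norm y \<ge> ?d \<Longrightarrow>
      exp ((a + 1) * t) * norm (partial_dir i \<phi> (exp t *\<^sub>R y)) \<le> C i * exp (- a * \<bar>t\<bar>)"
    by metis
  have far: "norm y \<ge> ?d" if "y \<in> ball x ?d" for y
    using that norm_triangle_ineq2[of x "x - y"] by (simp add: dist_norm)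
  have "((\<lambda>x. LINT t|lborel. exp (a * t) *\<^sub>R \<phi> (exp t *\<^sub>R x)) has_derivative
    (\<lambda>v. \<Sum>i\<in>UNIV. v $ i *\<^sub>R (LINT t|lborel. exp ((a + 1) * t) *\<^sub>R partial_dir i \<phi> (exp t *\<^sub>R x)))) (at x)"
  proof (rule has_derivative_integral_dominated[where r = ?d and g = "\<lambda>t. (\<Sum>i\<in>UNIV. C i) * exp (- a * \<bar>t\<bar>)"])
    fix y t assume y: "y \<in> ball x ?d"
    show "integrable lborel (\<lambda>t. exp (a * t) *\<^sub>R \<phi> (exp t *\<^sub>R y))"
      using far[OF y] assms by (intro mellin_integrable) auto
    show "norm (exp ((a + 1) * t) *\<^sub>R partial_dir i \<phi> (exp t *\<^sub>R y)) \<le> (\<Sum>i\<in>UNIV. C i) * exp (- a * \<bar>t\<bar>)" for i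
    proof -
      have "C i \<le> (\<Sum>i\<in>UNIV. C i)" using C(1) by (intro member_le_sum) auto
      then have "C i * exp (- a * \<bar>t\<bar>) \<le> (\<Sum>i\<in>UNIV. C i) * exp (- a * \<bar>t\<bar>)" by (intro mult_right_mono) auto
      from order_trans[OF C(2)[OF far[OF y], of t i] this] show ?thesis by simp
    qed
    have "((\<lambda>y. exp t *\<^sub>R y) has_derivative (\<lambda>v. exp t *\<^sub>R v)) (at y)" by (auto intro!: derivative_eq_intros)
    note D = has_derivative_scaleR_right[OF has_derivative_compose[OF this schwartz_has_derivative[OF assms(1)]], of "exp (a * t)"]
    have "exp ((a + 1) * t) = exp (a * t) * exp t" by (simp add: distrib_right exp_add)
    then have "exp (a * t) *\<^sub>R (\<Sum>i\<in>UNIV. (exp t *\<^sub>R v) $ i *\<^sub>R partial_dir i \<phi> (exp t *\<^sub>R y)) =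
      (\<Sum>i\<in>UNIV. v $ i *\<^sub>R exp ((a + 1) * t) *\<^sub>R partial_dir i \<phi> (exp t *\<^sub>R y))" for v :: "real^'n"
      by (simp only: scaleR_sum_right vector_scaleR_component scaleR_scaleR mult_ac real_scaleR_def)
    with D
    show "((\<lambda>y. exp (a * t) *\<^sub>R \<phi> (exp t *\<^sub>R y)) has_derivative
       (\<lambda>v. \<Sum>i\<in>UNIV. v $ i *\<^sub>R exp ((a + 1) * t) *\<^sub>R partial_dir i \<phi> (exp t *\<^sub>R y))) (at y)"
      by simp
  next
    fix i
    note [measurable] = schwartz_measurable[OF schwartz_partial_dir[OF assms(1)]]
    show "(\<lambda>t. exp ((a + 1) * t) *\<^sub>R partial_dir i \<phi> (exp t *\<^sub>R x)) \<in> borel_measurable lborel" by measurable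
  qed (use assms in \<open>auto intro!: integrable_exp_abs[OF assms(2), simplified]\<close>)
  then show ?thesis unfolding mellin_def[abs_def] .
qed

lemma mellin_smooth:
  assumes "\<phi> \<in> schwartz" "0 < a"
  shows "Ck_bounded (\<lambda>_. True) (-{0}) k (mellin a \<phi>)"
proof (rule Ck_bounded_coinduct[where P = "\<lambda>f. \<exists>a \<phi>. 0 < a \<and> \<phi> \<in> schwartz \<and> f = mellin a \<phi>", OF open_nonzero bound_class_True])
  fix f :: "real^'a \<Rightarrow> complex" and i
  assume "\<exists>a \<phi>. 0 < a \<and> \<phi> \<in> schwartz \<and> f = mellin a \<phi>"
  then obtain a \<phi> where f: "0 < a" "\<phi> \<in> schwartz" "f = mellin a \<phi>" by blast
  note D = mellin_has_derivative[OF f(2,1)]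
  show "f differentiable at x" if "x \<in> -{0}" for x
    unfolding differentiable_def f(3) using D that by blast
  have "partial_dir i f x = mellin (a + 1) (partial_dir i \<phi>) x" if "x \<noteq> 0" for x
    unfolding f(3) using partial_dir_eqI[OF D[OF that], of i]
    by (simp add: axis_def if_distrib[of "\<lambda>c. c *\<^sub>R _"] cong: if_cong)
  then show "\<exists>g. (\<exists>a \<phi>. 0 < a \<and> \<phi> \<in> schwartz \<and> g = mellin a \<phi>) \<and> (\<forall>x\<in>-{0}. partial_dir i f x = g x)"
    using f schwartz_partial_dir[OF f(2)] by (intro exI[of _ "mellin (a + 1) (partial_dir i \<phi>)"]) (auto intro!: exI[of _ "a + 1"])
qed (use assms in auto)

section \<open>The Fourier transform on Schwartz functions\<close>

lemma cis_measurable [measurable]: "cis \<in> borel_measurable borel"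
  by (intro borel_measurable_continuous_onI continuous_intros)

lemma integrable_mult_cis:
  fixes f :: "'a \<Rightarrow> complex"
  assumes "integrable M f" "g \<in> borel_measurable M"
  shows "integrable M (\<lambda>x. f x * cis (g x))"
  by (rule Bochner_Integration.integrable_bound[OF assms(1)])
     (use assms in \<open>auto simp: norm_mult\<close>)

lemma fourier_integrable:
  fixes \<phi> :: "real^'n::finite \<Rightarrow> complex"
  assumes "integrable lborel \<phi>"
  shows "integrable lborel (\<lambda>\<xi>. \<phi> \<xi> * cis (- (x \<bullet> \<xi>)))"
  by (rule integrable_mult_cis[OF assms]) simp

lemma norm_fourier_le: "norm (fourier \<phi> x) \<le> (LINT \<xi>|lborel. norm (\<phi> \<xi>))"
  unfolding fourier_def by (rule order_trans[OF integral_norm_bound]) (simp add: norm_mult)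

lemma schwartz_cmult: "\<phi> \<in> schwartz \<Longrightarrow> (\<lambda>x. c * \<phi> x) \<in> schwartz"
  by (rule schwartz_linear[OF bounded_linear_mult_right])

lemma fourier_has_derivative:
  fixes \<phi> :: "real^'n::finite \<Rightarrow> complex"
  assumes "\<phi> \<in> schwartz"
  shows "(fourier \<phi> has_derivative (\<lambda>v. \<Sum>i\<in>UNIV. v $ i *\<^sub>R fourier (\<lambda>\<xi>. \<xi> $ i *\<^sub>R (- \<i> * \<phi> \<xi>)) x)) (at x)"
proof -
  note [measurable] = schwartz_measurable[OF assms]
  have "((\<lambda>x. LINT \<xi>|lborel. \<phi> \<xi> * cis (- (x \<bullet> \<xi>))) has_derivative
    (\<lambda>v. \<Sum>i\<in>UNIV. v $ i *\<^sub>R (LINT \<xi>|lborel. (\<xi> $ i *\<^sub>R (- \<i> * \<phi> \<xi>)) * cis (- (x \<bullet> \<xi>))))) (at x)"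
  proof (rule has_derivative_integral_dominated[where r = 1 and g = "\<lambda>\<xi>. \<Sum>i\<in>UNIV. norm (\<xi> $ i *\<^sub>R \<phi> \<xi>)"])
    fix y \<xi> :: "real^'n"
    show "integrable lborel (\<lambda>\<xi>. \<phi> \<xi> * cis (- (y \<bullet> \<xi>)))"
      by (intro fourier_integrable schwartz_integrable assms)
    show "norm ((\<xi> $ i *\<^sub>R (- \<i> * \<phi> \<xi>)) * cis (- (y \<bullet> \<xi>))) \<le> (\<Sum>i\<in>UNIV. norm (\<xi> $ i *\<^sub>R \<phi> \<xi>))" for i
    proof -
      have "norm (\<xi> $ i *\<^sub>R \<phi> \<xi>) \<le> (\<Sum>i\<in>UNIV. norm (\<xi> $ i *\<^sub>R \<phi> \<xi>))"
        by (rule member_le_sum[of i UNIV "\<lambda>i. norm (\<xi> $ i *\<^sub>R \<phi> \<xi>)"]) auto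
      then show ?thesis by (simp add: norm_mult)
    qed
    have "((\<lambda>y. cis (- (y \<bullet> \<xi>))) has_derivative (\<lambda>v. (- (v \<bullet> \<xi>)) *\<^sub>R (\<i> * cis (- (y \<bullet> \<xi>))))) (at y)"
      by (auto intro!: derivative_eq_intros)
    note D = has_derivative_mult_right[OF this, of "\<phi> \<xi>"]
    have "\<phi> \<xi> * ((- (v \<bullet> \<xi>)) *\<^sub>R (\<i> * cis (- (y \<bullet> \<xi>)))) =
       (\<Sum>i\<in>UNIV. v $ i *\<^sub>R ((\<xi> $ i *\<^sub>R (- \<i> * \<phi> \<xi>)) * cis (- (y \<bullet> \<xi>))))" for v
    proof -
      have "(\<Sum>i\<in>UNIV. v $ i *\<^sub>R ((\<xi> $ i *\<^sub>R (- \<i> * \<phi> \<xi>)) * cis (- (y \<bullet> \<xi>)))) =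
         (\<Sum>i\<in>UNIV. (v $ i * \<xi> $ i) *\<^sub>R ((- \<i> * \<phi> \<xi>) * cis (- (y \<bullet> \<xi>))))" by simp
      also have "\<dots> = (v \<bullet> \<xi>) *\<^sub>R ((- \<i> * \<phi> \<xi>) * cis (- (y \<bullet> \<xi>)))"
        by (simp only: scaleR_sum_left[symmetric] inner_vec_def inner_real_def)
      finally show ?thesis by simp
    qed
    with D show "((\<lambda>y. \<phi> \<xi> * cis (- (y \<bullet> \<xi>))) has_derivative
      (\<lambda>v. \<Sum>i\<in>UNIV. v $ i *\<^sub>R ((\<xi> $ i *\<^sub>R (- \<i> * \<phi> \<xi>)) * cis (- (y \<bullet> \<xi>))))) (at y)"
      by simp
  next
    show "integrable lborel (\<lambda>\<xi>. \<Sum>i\<in>UNIV. norm (\<xi> $ i *\<^sub>R \<phi> \<xi>))"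
      by (intro Bochner_Integration.integrable_sum integrable_norm schwartz_integrable schwartz_component_mult assms)
    note [measurable] = schwartz_measurable[OF schwartz_component_mult[OF schwartz_cmult[OF assms, of "- \<i>"]]]
    show "(\<lambda>\<xi>. (\<xi> $ i *\<^sub>R (- \<i> * \<phi> \<xi>)) * cis (- (x \<bullet> \<xi>))) \<in> borel_measurable lborel" for i
      by measurable
  qed simp
  then show ?thesis unfolding fourier_def[abs_def] .
qed

text \<open>Supplies a dominating function, independent of the shift, for differentiating an
  integral in a translation parameter.\<close>

lemma rapid_translate_bound:
  fixes u :: "real^'n::finite \<Rightarrow> real"
  assumes "rapid u"
  obtains C where "\<And>x y. norm y < 1 \<Longrightarrow> \<bar>u (x + y)\<bar> \<le> C / (1 + norm x) ^ k"
proof -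
  obtain C0 where C0: "\<And>x. norm x ^ 0 * \<bar>u x\<bar> \<le> C0" using assms unfolding rapid_def by metis
  obtain C1 where C1: "\<And>x. norm x ^ k * \<bar>u x\<bar> \<le> C1" using assms unfolding rapid_def by metis
  have "\<bar>u (x + y)\<bar> \<le> 3 ^ k * (C0 + C1) / (1 + norm x) ^ k" if "norm y < 1" for x y
  proof -
    let ?z = "x + y"
    have "norm x \<le> norm ?z + norm y" using norm_triangle_ineq4[of ?z y] by simp
    \<comment> \<open>1 + |x| is at most 2 + |z|, and both 2 and |z| are controlled by the maximum
      of 1 and |z|.\<close>
    then have "1 + norm x \<le> 3 * max 1 (norm ?z)" using that by linarith
    then have "(1 + norm x) ^ k \<le> (3 * max 1 (norm ?z)) ^ k" by (intro power_mono) auto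
    also have "\<dots> \<le> 3 ^ k * (1 + norm ?z ^ k)"
      by (cases "norm ?z \<le> 1") (auto simp: power_mult_distrib)
    finally have "\<bar>u ?z\<bar> * (1 + norm x) ^ k \<le> \<bar>u ?z\<bar> * (3 ^ k * (1 + norm ?z ^ k))"
      by (intro mult_left_mono) auto
    also have "\<dots> = 3 ^ k * (norm ?z ^ 0 * \<bar>u ?z\<bar> + norm ?z ^ k * \<bar>u ?z\<bar>)" by (simp add: algebra_simps)
    also have "\<dots> \<le> 3 ^ k * (C0 + C1)" by (intro mult_left_mono add_mono C0 C1) auto
    finally show ?thesis
      by (subst pos_le_divide_eq) (auto intro!: zero_less_power add_pos_nonneg)
  qed
  with that show ?thesis by blast
qed

text \<open>In the logarithmic radius the relevant quantity is r^n / (1 + r)^(n+1), which is at most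
  the smaller of r and 1/r; one power beyond the dimension is enough.\<close>

lemma integrable_inverse_power:
  "integrable lborel (\<lambda>x::real^'n::finite. 1 / (1 + norm x) ^ (CARD('n) + 1))"
proof (rule integrable_radial_bound[where c = 1 and C = 1])
  fix x :: "real^'n" assume x: "x \<noteq> 0"
  let ?n = "CARD('n)"
  have "norm x ^ ?n / (1 + norm x) ^ (?n + 1) \<le> exp (- \<bar>ln (norm x)\<bar>)"
  proof (cases "norm x \<le> 1")
    case True
    have "norm x ^ ?n \<le> norm x ^ 1" using True by (intro power_decreasing) (auto simp: Suc_le_eq)
    moreover have "1 \<le> (1 + norm x) ^ (?n + 1)" by (rule one_le_power) simp
    ultimately have "norm x ^ ?n / (1 + norm x) ^ (?n + 1) \<le> norm x / 1"
      by (intro frac_le) auto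
    also have "norm x / 1 = exp (- \<bar>ln (norm x)\<bar>)" using True x by simp
    finally show ?thesis by simp
  next
    case False
    have "norm x ^ (?n + 1) \<le> (1 + norm x) ^ (?n + 1)" by (intro power_mono) auto
    then have "norm x ^ ?n / (1 + norm x) ^ (?n + 1) \<le> norm x ^ ?n / norm x ^ (?n + 1)"
      using x by (intro divide_left_mono) (auto intro!: mult_pos_pos zero_less_power add_pos_nonneg)
    also have "\<dots> = exp (- \<bar>ln (norm x)\<bar>)" using False x by (simp add: exp_minus divide_inverse)
    finally show ?thesis .
  qed
  then show "norm x ^ DIM(real^'n) * norm (1 / (1 + norm x) ^ (CARD('n) + 1)) \<le> 1 * exp (- 1 * \<bar>ln (norm x)\<bar>)"
    by (simp add: norm_divide norm_power)
qed auto

lemma integral_lborel_translate: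
  fixes f :: "'a::euclidean_space \<Rightarrow> 'b::{banach, second_countable_topology}"
  assumes [measurable]: "f \<in> borel_measurable borel"
  shows "(LINT x|lborel. f (x + y)) = (LINT x|lborel. f x)"
  by (subst (2) lborel_distr_plus[of y, symmetric]) (simp add: integral_distr add.commute)

lemma integrable_lborel_translate:
  fixes f :: "'a::euclidean_space \<Rightarrow> 'b::{banach, second_countable_topology}"
  assumes "integrable lborel f"
  shows "integrable lborel (\<lambda>x. f (x + y))"
proof -
  have [measurable]: "f \<in> borel_measurable borel" using assms by auto
  show ?thesis
    using assms by (subst (asm) lborel_distr_plus[of y, symmetric]) (simp add: integrable_distr_eq add.commute)
qed

lemma fourier_translate:
  fixes \<phi> :: "real^'n::finite \<Rightarrow> complex"
  assumes "integrable lborel \<phi>"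
  shows "fourier (\<lambda>\<xi>. \<phi> (\<xi> + y)) x = cis (x \<bullet> y) * fourier \<phi> x"
proof -
  have [measurable]: "\<phi> \<in> borel_measurable borel" using assms by auto
  have "fourier (\<lambda>\<xi>. \<phi> (\<xi> + y)) x = (LINT \<xi>|lborel. (\<lambda>\<xi>. cis (x \<bullet> y) * (\<phi> \<xi> * cis (- (x \<bullet> \<xi>)))) (\<xi> + y))"
    unfolding fourier_def
    by (rule Bochner_Integration.integral_cong) (auto simp: inner_add_right cis_mult mult_ac)
  also have "\<dots> = (LINT \<xi>|lborel. cis (x \<bullet> y) * (\<phi> \<xi> * cis (- (x \<bullet> \<xi>))))"
    by (rule integral_lborel_translate) measurable
  finally show ?thesis by (simp add: fourier_def)
qed

text \<open>Differentiate the transform of a translate in the translation parameter.\<close>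

lemma fourier_partial_dir:
  fixes \<phi> :: "real^'n::finite \<Rightarrow> complex"
  assumes "\<phi> \<in> schwartz"
  shows "fourier (partial_dir i \<phi>) x = x $ i *\<^sub>R (\<i> * fourier \<phi> x)"
proof -
  let ?n = "CARD('n)"
  note [measurable] = schwartz_measurable[OF assms] schwartz_measurable[OF schwartz_partial_dir[OF assms]]
  have "\<exists>C. \<forall>\<xi> y. norm y < 1 \<longrightarrow> norm (partial_dir j \<phi> (\<xi> + y)) \<le> C / (1 + norm \<xi>) ^ (?n + 1)" for j
    using rapid_translate_bound[OF schwartz_rapid[OF schwartz_partial_dir[OF assms, of j]], of "?n + 1"] by (metis abs_norm_cancel)
  then obtain C where C: "\<And>j \<xi> y. norm y < 1 \<Longrightarrow> norm (partial_dir j \<phi> (\<xi> + y)) \<le> C j / (1 + norm \<xi>) ^ (?n + 1)"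
    by metis
  have C0: "0 \<le> C j" for j
    using order_trans[OF norm_ge_zero C[of 0 j 0]] by simp
  have "((\<lambda>y. LINT \<xi>|lborel. \<phi> (\<xi> + y) * cis (- (x \<bullet> \<xi>))) has_derivative
    (\<lambda>v. \<Sum>i\<in>UNIV. v $ i *\<^sub>R (LINT \<xi>|lborel. partial_dir i \<phi> (\<xi> + 0) * cis (- (x \<bullet> \<xi>))))) (at 0)"
  proof (rule has_derivative_integral_dominated[where r = 1 and g = "\<lambda>\<xi>. (\<Sum>j\<in>UNIV. C j) * (1 / (1 + norm \<xi>) ^ (?n + 1))"])
    fix y \<xi> :: "real^'n" assume y: "y \<in> ball 0 1"
    show "integrable lborel (\<lambda>\<xi>. \<phi> (\<xi> + y) * cis (- (x \<bullet> \<xi>)))"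
      by (intro fourier_integrable integrable_lborel_translate schwartz_integrable assms)
    show "norm (partial_dir i \<phi> (\<xi> + y) * cis (- (x \<bullet> \<xi>))) \<le> (\<Sum>j\<in>UNIV. C j) * (1 / (1 + norm \<xi>) ^ (?n + 1))" for i
    proof -
      have "C i \<le> (\<Sum>j\<in>UNIV. C j)" using C0 by (intro member_le_sum) auto
      then have "C i / (1 + norm \<xi>) ^ (?n + 1) \<le> (\<Sum>j\<in>UNIV. C j) / (1 + norm \<xi>) ^ (?n + 1)"
        by (intro divide_right_mono) auto
      from order_trans[OF C this] y show ?thesis by (simp add: norm_mult)
    qed
    have "((\<lambda>y. \<xi> + y) has_derivative (\<lambda>v. v)) (at y)" by (auto intro!: derivative_eq_intros)
    from has_derivative_mult_left[OF has_derivative_compose[OF this schwartz_has_derivative[OF assms]], of "cis (- (x \<bullet> \<xi>))"]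
    show "((\<lambda>y. \<phi> (\<xi> + y) * cis (- (x \<bullet> \<xi>))) has_derivative
      (\<lambda>v. \<Sum>i\<in>UNIV. v $ i *\<^sub>R (partial_dir i \<phi> (\<xi> + y) * cis (- (x \<bullet> \<xi>))))) (at y)"
      by (simp add: sum_distrib_right)
  next
    show "(\<lambda>\<xi>. partial_dir i \<phi> (\<xi> + 0) * cis (- (x \<bullet> \<xi>))) \<in> borel_measurable lborel" for i by measurable
    show "integrable lborel (\<lambda>\<xi>::real^'n. (\<Sum>j\<in>UNIV. C j) * (1 / (1 + norm \<xi>) ^ (?n + 1)))"
      by (intro integrable_mult_right integrable_inverse_power)
  qed simp
  then have 1: "((\<lambda>y. cis (x \<bullet> y) * fourier \<phi> x) has_derivative (\<lambda>v. \<Sum>i\<in>UNIV. v $ i *\<^sub>R fourier (partial_dir i \<phi>) x)) (at 0)"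
    unfolding fourier_translate[OF schwartz_integrable[OF assms], symmetric] by (simp add: fourier_def)
  have 2: "((\<lambda>y. cis (x \<bullet> y) * fourier \<phi> x) has_derivative (\<lambda>v. ((x \<bullet> v) *\<^sub>R \<i>) * fourier \<phi> x)) (at 0)"
    by (auto intro!: derivative_eq_intros)
  from fun_cong[OF has_derivative_unique[OF 1 2], of "axis i 1"] show ?thesis
    by (simp add: axis_def if_distrib[of "\<lambda>c. c *\<^sub>R _"] inner_vec_def if_distrib[of "\<lambda>c. _ * c"] cong: if_cong)
qed

text \<open>\<open>norm x\<close> is at most the sum of the absolute coordinates, and each
  coordinate is traded for a partial derivative of \<phi> before transforming. Every power costs one
  derivative, and the last step is the trivial supremum bound.\<close>

lemma rapid_fourier:
  fixes \<phi> :: "real^'n::finite \<Rightarrow> complex"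
  assumes "\<phi> \<in> schwartz"
  shows "rapid (\<lambda>x. norm (fourier \<phi> x))"
proof -
  have "\<exists>C. \<forall>x. norm x ^ k * norm (fourier \<phi> x) \<le> C" for k
    using assms
  proof (induction k arbitrary: \<phi>)
    case 0
    then show ?case using norm_fourier_le by auto
  next
    case (Suc k)
    have "\<exists>C. \<forall>x. norm x ^ k * norm (fourier (partial_dir i \<phi>) x) \<le> C" for i
      by (intro Suc.IH schwartz_partial_dir Suc.prems)
    then obtain C where C: "\<And>i x. norm x ^ k * norm (fourier (partial_dir i \<phi>) x) \<le> C i" by metis
    have "norm x ^ Suc k * norm (fourier \<phi> x) \<le> (\<Sum>i\<in>UNIV. C i)" for x
    proof -
      have "norm x ^ Suc k * norm (fourier \<phi> x) = norm x ^ k * norm (fourier \<phi> x) * norm x" by simp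
      also have "\<dots> \<le> norm x ^ k * norm (fourier \<phi> x) * (\<Sum>i\<in>UNIV. \<bar>x $ i\<bar>)"
        by (intro mult_left_mono norm_le_l1_cart) auto
      also have "\<dots> = (\<Sum>i\<in>UNIV. norm x ^ k * norm (fourier (partial_dir i \<phi>) x))"
        by (simp add: fourier_partial_dir[OF Suc.prems] sum_distrib_left norm_mult mult_ac)
      also have "\<dots> \<le> (\<Sum>i\<in>UNIV. C i)" by (intro sum_mono C)
      finally show ?thesis .
    qed
    then show ?case by blast
  qed
  then show ?thesis by (simp add: rapid_def)
qed

text \<open>Transforms of Schwartz functions are closed under partial derivatives, since
  differentiation becomes multiplication of \<phi> by a coordinate. With
  \<open>rapid_fourier\<close> for every member, coinduction covers all derivatives.\<close>

lemma fourier_schwartz: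
  fixes \<phi> :: "real^'n::finite \<Rightarrow> complex"
  assumes "\<phi> \<in> schwartz"
  shows "fourier \<phi> \<in> schwartz"
  unfolding schwartz_iff
proof
  fix k
  show "Ck_bounded rapid UNIV k (fourier \<phi>)"
  proof (rule Ck_bounded_coinduct[where P = "\<lambda>f. \<exists>\<phi>\<in>schwartz. f = fourier \<phi>", OF open_UNIV bound_class_rapid])
    fix f :: "real^'n \<Rightarrow> complex" and i assume "\<exists>\<phi>\<in>schwartz. f = fourier \<phi>"
    then obtain \<phi> where \<phi>: "\<phi> \<in> schwartz" "f = fourier \<phi>" by blast
    show "rapid (\<lambda>x. norm (f x))" using \<phi> rapid_fourier by blast
    show "f differentiable at x" for x
      unfolding differentiable_def \<phi>(2) using fourier_has_derivative[OF \<phi>(1)] by blast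
    have "partial_dir i f x = fourier (\<lambda>\<xi>. \<xi> $ i *\<^sub>R (- \<i> * \<phi> \<xi>)) x" for x
      unfolding \<phi>(2) using partial_dir_eqI[OF fourier_has_derivative[OF \<phi>(1)], of i x]
      by (simp add: axis_def if_distrib[of "\<lambda>c. c *\<^sub>R _"] cong: if_cong)
    then show "\<exists>g. (\<exists>\<phi>\<in>schwartz. g = fourier \<phi>) \<and> (\<forall>x\<in>UNIV. partial_dir i f x = g x)"
      using schwartz_component_mult[OF schwartz_cmult[OF \<phi>(1), of "- \<i>"], of i] by blast
  qed (use assms in blast)
qed

section \<open>Gaussians and Fourier inversion\<close>

lemma integrable_product_mult:
  fixes f :: "'a::euclidean_space \<Rightarrow> 'c::{banach, second_countable_topology, real_normed_div_algebra}"
    and g :: "'b::euclidean_space \<Rightarrow> 'c"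
  assumes "integrable lborel f" "integrable lborel g"
  shows "integrable (lborel \<Otimes>\<^sub>M lborel) (\<lambda>(x, y). f x * g y)"
proof (rule lborel_pair.Fubini_integrable)
  have [measurable]: "f \<in> borel_measurable borel" "g \<in> borel_measurable borel" using assms by auto
  show "(\<lambda>(x, y). f x * g y) \<in> borel_measurable (lborel \<Otimes>\<^sub>M lborel)" by measurable
  show "integrable lborel (\<lambda>x. LINT y|lborel. norm (case (x, y) of (x, y) \<Rightarrow> f x * g y))"
    using assms by (simp add: norm_mult)
  show "AE x in lborel. integrable lborel (\<lambda>y. case (x, y) of (x, y) \<Rightarrow> f x * g y)"
    using assms by simp
qed

text \<open>Fubini with a kernel of modulus 1. Integrability is the right generality, because it is
  applied to modulated Gaussians and to dilated transforms.\<close>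

lemma fourier_multiplication:
  fixes \<phi> \<psi> :: "real^'n::finite \<Rightarrow> complex"
  assumes "integrable lborel \<phi>" "integrable lborel \<psi>"
  shows "(LINT x|lborel. fourier \<phi> x * \<psi> x) = (LINT \<xi>|lborel. \<phi> \<xi> * fourier \<psi> \<xi>)"
proof -
  have [measurable]: "\<phi> \<in> borel_measurable borel" "\<psi> \<in> borel_measurable borel" using assms by auto
  have "integrable (lborel \<Otimes>\<^sub>M lborel) (\<lambda>p. (case p of (x, \<xi>) \<Rightarrow> \<psi> x * \<phi> \<xi>) * cis (- (fst p \<bullet> snd p)))"
    by (rule integrable_mult_cis[OF integrable_product_mult[OF assms(2,1)]]) measurable
  then have i: "integrable (lborel \<Otimes>\<^sub>M lborel) (\<lambda>(x, \<xi>). \<phi> \<xi> * \<psi> x * cis (- (x \<bullet> \<xi>)))"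
    by (simp add: split_beta' mult_ac)
  have "(LINT x|lborel. fourier \<phi> x * \<psi> x) = (LINT x|lborel. LINT \<xi>|lborel. \<phi> \<xi> * \<psi> x * cis (- (x \<bullet> \<xi>)))"
    unfolding fourier_def integral_mult_left_zero[symmetric] by (simp add: mult_ac)
  also have "\<dots> = (LINT \<xi>|lborel. LINT x|lborel. \<phi> \<xi> * \<psi> x * cis (- (x \<bullet> \<xi>)))"
    by (rule lborel_pair.Fubini_integral[OF i, symmetric])
  also have "\<dots> = (LINT \<xi>|lborel. \<phi> \<xi> * fourier \<psi> \<xi>)"
    unfolding fourier_def integral_mult_right_zero[symmetric] by (simp add: mult_ac inner_commute)
  finally show ?thesis .
qed

lemma
  fixes f :: "'a::euclidean_space \<Rightarrow> real \<Rightarrow> complex"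
  assumes f: "\<And>b. b \<in> Basis \<Longrightarrow> integrable lborel (f b)"
  shows integrable_prod_Basis: "integrable lborel (\<lambda>x. \<Prod>b\<in>Basis. f b (x \<bullet> b))"
    and integral_prod_Basis: "(LINT x|lborel. (\<Prod>b\<in>Basis. f b (x \<bullet> b))) = (\<Prod>b\<in>Basis. (LINT t|lborel. f b t))"
proof -
  interpret product_sigma_finite "\<lambda>_::'a. lborel :: real measure" ..
  have m: "(\<lambda>x. \<Prod>b\<in>Basis. f b (x \<bullet> b)) \<in> borel_measurable (borel :: 'a measure)"
  proof (rule borel_measurable_prod)
    fix b :: 'a assume "b \<in> Basis"
    from borel_measurable_integrable[OF f[OF this]] have [measurable]: "f b \<in> borel_measurable borel" by simp
    show "(\<lambda>x. f b (x \<bullet> b)) \<in> borel_measurable borel" by measurable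
  qed
  have t: "(\<lambda>g. \<Sum>b\<in>Basis. g b *\<^sub>R b) \<in> measurable (\<Pi>\<^sub>M b\<in>(Basis::'a set). lborel) borel" by measurable
  have eq: "(\<Prod>b\<in>Basis. f b ((\<Sum>c\<in>Basis. g c *\<^sub>R c) \<bullet> b)) = (\<Prod>b\<in>Basis. f b (g b))" for g
    by (intro prod.cong) auto
  show "integrable lborel (\<lambda>x. \<Prod>b\<in>Basis. f b (x \<bullet> b))"
    unfolding lborel_eq[where 'a = 'a]
    by (subst integrable_distr_eq[OF t m]) (simp only: eq, rule product_integrable_prod, use f in auto)
  show "(LINT x|lborel. (\<Prod>b\<in>Basis. f b (x \<bullet> b))) = (\<Prod>b\<in>Basis. (LINT t|lborel. f b t))"
    unfolding lborel_eq[where 'a = 'a]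
    by (subst integral_distr[OF t m]) (simp only: eq, rule product_integral_prod, use f in auto)
qed

text \<open>The transform is read off from the characteristic function of the standard normal
  distribution, after undoing its normalisation by \<open>sqrt (2 * pi)\<close>.\<close>

lemma
  fixes s :: real
  shows integrable_gaussian_1d: "integrable lborel (\<lambda>t::real. complex_of_real (exp (- t\<^sup>2 / 2)) * cis (- (s * t)))"
    and integral_gaussian_1d: "(LINT t|lborel. complex_of_real (exp (- t\<^sup>2 / 2)) * cis (- (s * t))) = complex_of_real (sqrt (2 * pi) * exp (- s\<^sup>2 / 2))"
proof -
  have d: "exp (- t\<^sup>2 / 2) = sqrt (2 * pi) * std_normal_density t" for t :: real
    by (simp add: std_normal_density_def)
  have "integrable lborel std_normal_density" by (rule integrable_normal_density) simp
  then have "integrable lborel (\<lambda>t. complex_of_real (exp (- t\<^sup>2 / 2)))"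
    unfolding d by (intro integrable_of_real integrable_mult_right)
  then show "integrable lborel (\<lambda>t::real. complex_of_real (exp (- t\<^sup>2 / 2)) * cis (- (s * t)))"
    by (rule integrable_mult_cis) simp
  have "complex_of_real (exp (- s\<^sup>2 / 2)) = char std_normal_distribution (- s)"
    by (simp add: char_std_normal_distribution)
  also have "\<dots> = (LINT t|lborel. std_normal_density t *\<^sub>R cis (- (s * t)))"
    unfolding char_def
    by (subst integral_density) (auto simp: cis_conv_exp normal_density_nonneg)
  finally have "complex_of_real (sqrt (2 * pi)) * complex_of_real (exp (- s\<^sup>2 / 2)) =
      (LINT t|lborel. complex_of_real (sqrt (2 * pi)) * (std_normal_density t *\<^sub>R cis (- (s * t))))"
    by (simp only: integral_mult_right_zero)
  moreover have "complex_of_real (sqrt (2 * pi)) * (std_normal_density t *\<^sub>R cis (- (s * t))) =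
      complex_of_real (exp (- t\<^sup>2 / 2)) * cis (- (s * t))" for t
    unfolding d by (simp add: scaleR_conv_of_real)
  ultimately show "(LINT t|lborel. complex_of_real (exp (- t\<^sup>2 / 2)) * cis (- (s * t))) = complex_of_real (sqrt (2 * pi) * exp (- s\<^sup>2 / 2))"
    by simp
qed

text \<open>The factor 1/2 in the exponent makes it an eigenfunction of \<open>fourier\<close>, with
  eigenvalue \<open>sqrt (2 * pi) ^ n\<close>.\<close>

definition gaussian :: "real^'n::finite \<Rightarrow> complex" where
  "gaussian x = complex_of_real (exp (- (x \<bullet> x) / 2))"

lemma gaussian_prod:
  fixes x y :: "real^'n::finite"
  shows "gaussian x * cis (- (y \<bullet> x)) = (\<Prod>b\<in>Basis. complex_of_real (exp (- (x \<bullet> b)\<^sup>2 / 2)) * cis (- ((y \<bullet> b) * (x \<bullet> b))))"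
proof -
  have "gaussian x = (\<Prod>b\<in>Basis. complex_of_real (exp (- (x \<bullet> b)\<^sup>2 / 2)))"
    unfolding gaussian_def of_real_prod[symmetric] exp_sum[OF finite_Basis, symmetric]
    by (subst euclidean_inner) (simp add: sum_negf sum_divide_distrib power2_eq_square)
  moreover have "cis (- (y \<bullet> x)) = (\<Prod>b\<in>Basis. cis (- ((y \<bullet> b) * (x \<bullet> b))))"
    unfolding cis_conv_exp exp_sum[OF finite_Basis, symmetric]
    by (subst euclidean_inner) (simp add: sum_negf sum_distrib_left)
  ultimately show ?thesis by (simp add: prod.distrib)
qed

lemma gaussian_integrable: "integrable lborel (gaussian :: real^'n::finite \<Rightarrow> complex)"
proof -
  have "integrable lborel (\<lambda>x::real^'n. gaussian x * cis (- (0 \<bullet> x)))"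
    unfolding gaussian_prod
    by (rule integrable_prod_Basis) (rule integrable_gaussian_1d)
  then show ?thesis by simp
qed

lemma fourier_gaussian:
  fixes x :: "real^'n::finite"
  shows "fourier gaussian x = complex_of_real (sqrt (2 * pi) ^ CARD('n)) * gaussian x"
proof -
  have "fourier gaussian x = (\<Prod>b\<in>Basis. complex_of_real (sqrt (2 * pi) * exp (- (x \<bullet> b)\<^sup>2 / 2)))"
    unfolding fourier_def gaussian_prod
    by (subst integral_prod_Basis[where f = "\<lambda>b t. complex_of_real (exp (- t\<^sup>2 / 2)) * cis (- ((x \<bullet> b) * t))"])
       (auto simp only: integral_gaussian_1d integrable_gaussian_1d)
  also have "\<dots> = complex_of_real (sqrt (2 * pi) ^ CARD('n)) * (\<Prod>b\<in>Basis. complex_of_real (exp (- (x \<bullet> b)\<^sup>2 / 2)))"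
    by (simp add: prod.distrib)
  also have "(\<Prod>b\<in>Basis. complex_of_real (exp (- (x \<bullet> b)\<^sup>2 / 2))) = gaussian x"
    using gaussian_prod[of x 0] by simp
  finally show ?thesis .
qed

lemma fourier_scale:
  fixes \<phi> :: "real^'n::finite \<Rightarrow> complex"
  assumes [measurable]: "\<phi> \<in> borel_measurable borel"
  shows "fourier (\<lambda>\<xi>. \<phi> (exp t *\<^sub>R \<xi>)) x = exp (- real CARD('n) * t) *\<^sub>R fourier \<phi> (exp (- t) *\<^sub>R x)"
proof -
  have "fourier \<phi> (exp (- t) *\<^sub>R x) = exp (real CARD('n) * t) *\<^sub>R (LINT \<xi>|lborel. \<phi> (exp t *\<^sub>R \<xi>) * cis (- (exp (- t) *\<^sub>R x \<bullet> exp t *\<^sub>R \<xi>)))"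
    unfolding fourier_def by (subst integral_lborel_scale[of _ t]) simp_all
  also have "(LINT \<xi>|lborel. \<phi> (exp t *\<^sub>R \<xi>) * cis (- (exp (- t) *\<^sub>R x \<bullet> exp t *\<^sub>R \<xi>))) = fourier (\<lambda>\<xi>. \<phi> (exp t *\<^sub>R \<xi>)) x"
  proof -
    have "exp (- t) *\<^sub>R x \<bullet> exp t *\<^sub>R \<xi> = x \<bullet> \<xi>" for \<xi> by (simp add: exp_minus field_simps)
    then show ?thesis by (simp only: fourier_def)
  qed
  finally show ?thesis by (simp add: exp_minus)
qed

lemma fourier_modulate: "fourier (\<lambda>\<xi>. \<phi> \<xi> * cis (- (x \<bullet> \<xi>))) y = fourier \<phi> (x + y)"
  by (simp add: fourier_def mult.assoc cis_mult inner_add_left)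

text \<open>Inversion by Gaussian regularisation: \<open>exp (- m)\<close> plays the role of the small parameter.\<close>

theorem fourier_inversion:
  fixes \<phi> :: "real^'n::finite \<Rightarrow> complex"
  assumes \<phi>: "\<phi> \<in> schwartz"
  shows "fourier (fourier \<phi>) x = complex_of_real ((2 * pi) ^ CARD('n)) * \<phi> (- x)"
proof -
  let ?c = "complex_of_real (sqrt (2 * pi) ^ CARD('n))"
  let ?e = "\<lambda>m::nat. exp (- real m)"
  note F = fourier_schwartz[OF \<phi>]
  note [measurable] = schwartz_measurable[OF \<phi>] schwartz_measurable[OF F]
  have [measurable]: "gaussian \<in> borel_measurable (borel :: (real^'n) measure)"
    using borel_measurable_integrable[OF gaussian_integrable] by simp
  have e: "?e \<longlonglongrightarrow> 0" by real_asymp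
  have scale: "(\<lambda>m. ?e m *\<^sub>R z) \<longlonglongrightarrow> 0" for z :: "real^'n"
    using tendsto_scaleR[OF e tendsto_const[of z]] by simp
  have g_lim: "(\<lambda>m. gaussian (?e m *\<^sub>R z)) \<longlonglongrightarrow> 1" for z :: "real^'n"
  proof -
    have "(\<lambda>m. gaussian (?e m *\<^sub>R z)) \<longlonglongrightarrow> complex_of_real (exp (- (0 \<bullet> (0::real^'n)) / 2))"
      unfolding gaussian_def by (intro tendsto_intros scale) simp
    then show ?thesis by simp
  qed
  have g_le: "norm (gaussian z) \<le> 1" for z :: "real^'n" by (simp add: gaussian_def)
  have 1: "(\<lambda>m. LINT \<xi>|lborel. fourier \<phi> \<xi> * (gaussian (?e m *\<^sub>R \<xi>) * cis (- (x \<bullet> \<xi>)))) \<longlonglongrightarrow> fourier (fourier \<phi>) x"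
    unfolding fourier_def[of "fourier \<phi>"]
  proof (rule integral_dominated_convergence[where w = "\<lambda>\<xi>. norm (fourier \<phi> \<xi>)"])
    show "AE \<xi> in lborel. (\<lambda>m. fourier \<phi> \<xi> * (gaussian (?e m *\<^sub>R \<xi>) * cis (- (x \<bullet> \<xi>)))) \<longlonglongrightarrow> fourier \<phi> \<xi> * cis (- (x \<bullet> \<xi>))"
      by (intro AE_I2) (use tendsto_mult[OF tendsto_const tendsto_mult[OF g_lim tendsto_const]] in auto)
    show "AE \<xi> in lborel. norm (fourier \<phi> \<xi> * (gaussian (?e m *\<^sub>R \<xi>) * cis (- (x \<bullet> \<xi>)))) \<le> norm (fourier \<phi> \<xi>)" for m
      using g_le by (intro AE_I2) (auto simp: norm_mult intro!: mult_left_le)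
  qed (use schwartz_integrable[OF F] in auto)
  \<comment> \<open>The multiplication formula moves the transform from \<phi> to the wide Gaussian.
    The result is a narrow Gaussian centred at \<open>- x\<close>, and the substitution y =
    \<open>exp (- m) *\<^sub>R w - x\<close> rescales it to a fixed one.\<close>
  have 2: "(LINT \<xi>|lborel. fourier \<phi> \<xi> * (gaussian (?e m *\<^sub>R \<xi>) * cis (- (x \<bullet> \<xi>)))) =
     ?c * (LINT w|lborel. \<phi> (?e m *\<^sub>R w - x) * gaussian w)" for m
  proof -
    have gi: "integrable lborel (\<lambda>\<xi>::real^'n. gaussian (?e m *\<^sub>R \<xi>))"
      by (rule integrable_lborel_scale[OF gaussian_integrable])
    have "(LINT \<xi>|lborel. fourier \<phi> \<xi> * (gaussian (?e m *\<^sub>R \<xi>) * cis (- (x \<bullet> \<xi>)))) =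
      (LINT y|lborel. \<phi> y * fourier (\<lambda>\<xi>. gaussian (?e m *\<^sub>R \<xi>) * cis (- (x \<bullet> \<xi>))) y)"
      by (rule fourier_multiplication[OF schwartz_integrable[OF \<phi>] fourier_integrable[OF gi]])
    also have "\<dots> = (LINT y|lborel. ?c * (exp (real CARD('n) * m) *\<^sub>R (\<phi> y * gaussian (exp m *\<^sub>R (x + y)))))"
    proof -
      have "fourier (\<lambda>\<xi>. gaussian (?e m *\<^sub>R \<xi>) * cis (- (x \<bullet> \<xi>))) y =
          ?c * (exp (real CARD('n) * m) *\<^sub>R gaussian (exp m *\<^sub>R (x + y)))" for y
        by (simp only: fourier_modulate) (simp add: fourier_scale fourier_gaussian)
      then show ?thesis by (simp only: mult_scaleR_left mult_scaleR_right mult_ac)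
    qed
    also have "\<dots> = ?c * (exp (real CARD('n) * m) *\<^sub>R (LINT y|lborel. \<phi> y * gaussian (exp m *\<^sub>R (x + y))))"
      by simp
    also have "(LINT y|lborel. \<phi> y * gaussian (exp m *\<^sub>R (x + y))) = (LINT z|lborel. \<phi> (z - x) * gaussian (exp m *\<^sub>R z))"
      using integral_lborel_translate[of "\<lambda>y. \<phi> y * gaussian (exp m *\<^sub>R (x + y))" "- x"] by simp
    also have "\<dots> = exp (real CARD('n) * (- m)) *\<^sub>R (LINT w|lborel. \<phi> (?e m *\<^sub>R w - x) * gaussian w)"
      by (subst integral_lborel_scale[of _ "- m"]) (simp_all add: exp_minus)
    finally show ?thesis by (simp add: exp_minus)
  qed
  obtain B where B: "\<And>y. norm (\<phi> y) \<le> B"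
    using schwartz_rapid[OF \<phi>] unfolding rapid_def by (metis abs_norm_cancel mult_1 power_0)
  have "(\<lambda>m. LINT w|lborel. \<phi> (?e m *\<^sub>R w - x) * gaussian w) \<longlonglongrightarrow> (LINT w|lborel. \<phi> (- x) * gaussian (w::real^'n))"
  proof (rule integral_dominated_convergence[where w = "\<lambda>w::real^'n. B * norm (gaussian w)"])
    show "AE w in lborel. (\<lambda>m. \<phi> (?e m *\<^sub>R w - x) * gaussian w) \<longlonglongrightarrow> \<phi> (- x) * gaussian w"
    proof (intro AE_I2 tendsto_mult tendsto_const)
      fix w :: "real^'n"
      have "isCont \<phi> (- x)" using schwartz_continuous[OF \<phi>] by (simp add: continuous_on_eq_continuous_at)
      moreover have "(\<lambda>m. ?e m *\<^sub>R w - x) \<longlonglongrightarrow> - x"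
        using tendsto_diff[OF scale[of w] tendsto_const[of x]] by simp
      ultimately show "(\<lambda>m. \<phi> (?e m *\<^sub>R w - x)) \<longlonglongrightarrow> \<phi> (- x)" by (rule isCont_tendsto_compose)
    qed
    show "AE w in lborel. norm (\<phi> (?e m *\<^sub>R w - x) * gaussian w) \<le> B * norm (gaussian w)" for m
      by (intro AE_I2) (auto simp: norm_mult intro!: mult_right_mono B)
  qed (use gaussian_integrable in auto)
  then have 3: "(\<lambda>m. ?c * (LINT w|lborel. \<phi> (?e m *\<^sub>R w - x) * gaussian w)) \<longlonglongrightarrow> ?c * (\<phi> (- x) * (LINT w|lborel. gaussian (w::real^'n)))"
    by (intro tendsto_mult tendsto_const) simp
  \<comment> \<open>The total mass is the transform at 0, hence \<open>?c\<close> once more; the two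
    factors \<open>?c\<close> combine to \<open>(2 * pi) ^ n\<close>.\<close>
  have "(LINT w|lborel. gaussian (w::real^'n)) = ?c"
    using fourier_gaussian[where 'n = 'n, of 0] by (simp add: fourier_def) (simp add: gaussian_def)
  then have "fourier (fourier \<phi>) x = ?c * (\<phi> (- x) * ?c)"
    using LIMSEQ_unique[OF 1 3[folded 2]] by simp
  also have "\<dots> = complex_of_real ((sqrt (2 * pi) * sqrt (2 * pi)) ^ CARD('n)) * \<phi> (- x)"
    by (simp only: power_mult_distrib of_real_mult mult_ac)
  finally show ?thesis by simp
qed

section \<open>Fourier transforms of homogeneous functions\<close>

lemma mellin_dilate:
  fixes \<phi> :: "real^'n::finite \<Rightarrow> complex"
  assumes "\<phi> \<in> schwartz"
  shows "mellin a \<phi> (exp s *\<^sub>R x) = exp (- a * s) *\<^sub>R mellin a \<phi> x"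
proof -
  note [measurable] = schwartz_measurable[OF assms]
  have "mellin a \<phi> (exp s *\<^sub>R x) = (LINT t|lborel. exp (- a * s) *\<^sub>R (\<lambda>t. exp (a * t) *\<^sub>R \<phi> (exp t *\<^sub>R x)) (t + s))"
    unfolding mellin_def
    by (rule Bochner_Integration.integral_cong) (auto simp: exp_add[symmetric] algebra_simps)
  also have "\<dots> = exp (- a * s) *\<^sub>R (LINT t|lborel. (\<lambda>t. exp (a * t) *\<^sub>R \<phi> (exp t *\<^sub>R x)) (t + s))"
    by (rule integral_scaleR_right)
  also have "(LINT t|lborel. (\<lambda>t. exp (a * t) *\<^sub>R \<phi> (exp t *\<^sub>R x)) (t + s)) = mellin a \<phi> x"
    unfolding mellin_def by (rule integral_lborel_translate) measurable
  finally show ?thesis .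
qed

lemma mellin_normalize:
  assumes "\<phi> \<in> schwartz" "x \<noteq> 0"
  shows "mellin a \<phi> (x /\<^sub>R norm x) = norm x powr a *\<^sub>R mellin a \<phi> x"
proof -
  have "x /\<^sub>R norm x = exp (- ln (norm x)) *\<^sub>R x" using assms(2) by (simp add: exp_minus)
  then show ?thesis using assms(2) by (simp only: mellin_dilate[OF assms(1)]) (simp add: powr_def)
qed

lemma Re_mellin:
  assumes "\<And>x. Im (\<phi> x) = 0"
  shows "complex_of_real (Re (mellin a \<phi> x)) = mellin a \<phi> x"
    and "Re (mellin a \<phi> x) = (LINT t|lborel. exp (a * t) * Re (\<phi> (exp t *\<^sub>R x)))"
proof -
  have "exp (a * t) *\<^sub>R \<phi> (exp t *\<^sub>R x) = complex_of_real (exp (a * t) * Re (\<phi> (exp t *\<^sub>R x)))" for t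
    using assms by (simp add: complex_eq_iff)
  then have "mellin a \<phi> x = complex_of_real (LINT t|lborel. exp (a * t) * Re (\<phi> (exp t *\<^sub>R x)))"
    unfolding mellin_def by (simp only: integral_complex_of_real)
  then show "complex_of_real (Re (mellin a \<phi> x)) = mellin a \<phi> x"
    "Re (mellin a \<phi> x) = (LINT t|lborel. exp (a * t) * Re (\<phi> (exp t *\<^sub>R x)))" by auto
qed

text \<open>\<open>Ce_inf\<close> asks for smoothness of the extension of degree 0. By homogeneity
  that extension is \<open>norm x powr a\<close> times the Mellin integral, and both factors are
  smooth off the origin.\<close>

lemma mellin_Ce_inf:
  fixes \<phi> :: "real^'n::finite \<Rightarrow> complex"
  assumes "\<phi> \<in> schwartz" "\<And>x. \<phi> (- x) = \<phi> x" "0 < a"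
  shows "(\<lambda>x. Re (mellin a \<phi> x)) \<in> Ce_inf"
proof -
  have "Ck_bounded (\<lambda>_. True) (-{0}) k (\<lambda>x. Re (mellin a \<phi> (x /\<^sub>R norm x)))" for k
  proof (rule Ck_bounded_cong[OF open_nonzero bound_class_True])
    show "Ck_bounded (\<lambda>_. True) (-{0}) k (\<lambda>x. norm x powr a *\<^sub>R Re (mellin a \<phi> x))"
      by (rule Ck_bounded_scaleR[OF open_nonzero bound_class_True _ moderate_Ck_powr
            Ck_bounded_linear[OF open_nonzero bound_class_True bounded_linear_Re mellin_smooth[OF assms(1,3)]]]) simp
    show "norm x powr a *\<^sub>R Re (mellin a \<phi> x) = Re (mellin a \<phi> (x /\<^sub>R norm x))" if "x \<in> -{0}" for x
      using that by (subst mellin_normalize[OF assms(1)]) auto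
  qed
  then show ?thesis
    using assms(2) by (simp add: Ce_inf_def smooth_on_open_iff[OF open_nonzero] mellin_def)
qed

lemma Ce_inf_linear:
  assumes "f \<in> Ce_inf" "g \<in> Ce_inf"
  shows "(\<lambda>x. c * f x + d * g x) \<in> Ce_inf"
proof -
  have "Ck_bounded (\<lambda>_. True) (-{0}) k (\<lambda>x. c * f (x /\<^sub>R norm x) + d * g (x /\<^sub>R norm x))" for k
    using assms
    by (intro Ck_bounded_add[OF open_nonzero bound_class_True]
        Ck_bounded_linear[OF open_nonzero bound_class_True bounded_linear_mult_right])
       (auto simp: Ce_inf_def smooth_on_open_iff[OF open_nonzero])
  then show ?thesis using assms by (simp add: Ce_inf_def smooth_on_open_iff[OF open_nonzero])
qed

lemma Ce_inf_cmult: "f \<in> Ce_inf \<Longrightarrow> (\<lambda>x. c * f x) \<in> Ce_inf"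
  using Ce_inf_linear[of f f c 0] by simp

lemma hr_mellin:
  assumes "\<phi> \<in> schwartz" "x \<noteq> 0"
  shows "hr (\<lambda>x. Re (mellin a \<phi> x)) (- a) x = Re (mellin a \<phi> x)"
  using assms(2) by (simp add: hr_def mellin_normalize[OF assms] powr_minus)

lemma integral_lborel_uminus:
  fixes f :: "'a::euclidean_space \<Rightarrow> 'b::{banach, second_countable_topology}"
  assumes [measurable]: "f \<in> borel_measurable borel"
  shows "(LINT x|lborel. f (- x)) = (LINT x|lborel. f x)"
  by (subst (2) lborel_affine[of "- 1" 0]) (simp_all add: density_1 integral_distr)

lemma fourier_even:
  fixes \<phi> :: "real^'n::finite \<Rightarrow> complex"
  assumes [measurable]: "\<phi> \<in> borel_measurable borel" and "\<And>x. \<phi> (- x) = \<phi> x"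
  shows "fourier \<phi> (- x) = fourier \<phi> x"
  using integral_lborel_uminus[of "\<lambda>\<xi>. \<phi> \<xi> * cis (- (x \<bullet> \<xi>))"] assms(2) by (simp add: fourier_def)

lemma fourier_real:
  fixes \<phi> :: "real^'n::finite \<Rightarrow> complex"
  assumes "\<phi> \<in> borel_measurable borel" "\<And>x. \<phi> (- x) = \<phi> x" "\<And>x. Im (\<phi> x) = 0"
  shows "Im (fourier \<phi> x) = 0"
proof -
  have "cnj (\<phi> \<xi>) = \<phi> \<xi>" for \<xi> using assms(3) by (simp add: complex_eq_iff)
  then have "cnj (fourier \<phi> x) = fourier \<phi> (- x)"
    unfolding fourier_def by (simp add: Bochner_Integration.integral_cnj[symmetric] cis_cnj)
  then have "cnj (fourier \<phi> x) = fourier \<phi> x" using fourier_even[OF assms(1,2)] by simp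
  then show ?thesis by (simp add: complex_eq_iff)
qed

lemma mellin_pairing_integrable:
  fixes \<phi> \<psi> :: "real^'n::finite \<Rightarrow> complex"
  assumes "\<phi> \<in> schwartz" "\<psi> \<in> schwartz" "0 < a" "a < real CARD('n)"
  shows "integrable (lborel \<Otimes>\<^sub>M lborel) (\<lambda>(x, t). exp (a * t) *\<^sub>R (\<phi> (exp t *\<^sub>R x) * \<psi> x))"
proof -
  let ?n = "real CARD('n)"
  note [measurable] = schwartz_measurable[OF assms(1)] schwartz_measurable[OF assms(2)]
  \<comment> \<open>\<open>c \<le> a\<close> is required by the dilation bound, and
    \<open>a + c < n\<close> keeps the worse power \<open>- a - c\<close> of \<open>norm x\<close>
    integrable at 0 against \<psi>.\<close>
  define c where "c = min a ((?n - a) / 2)"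
  have c: "0 < c" "c \<le> a" "a + c < ?n" using assms unfolding c_def by (auto simp: min_def field_simps)
  obtain C where C: "0 \<le> C" "\<And>x t. x \<noteq> 0 \<Longrightarrow>
    exp (a * t) * \<bar>norm (\<phi> (exp t *\<^sub>R x))\<bar> \<le> C * (norm x powr (- a - c) + norm x powr (c - a)) * exp (- c * \<bar>t\<bar>)"
    using rapid_dilation_bound[OF schwartz_rapid[OF assms(1)] c(1,2)] by blast
  let ?g = "\<lambda>x. C * (norm (norm x powr (- a - c) *\<^sub>R \<psi> x) + norm (norm x powr (c - a) *\<^sub>R \<psi> x))"
  have "integrable lborel ?g"
    using c assms by (intro integrable_mult_right Bochner_Integration.integrable_add integrable_norm schwartz_powr_integrable) auto
  then have gi: "integrable (lborel \<Otimes>\<^sub>M lborel) (\<lambda>(x, t). ?g x * exp (- c * \<bar>t\<bar>))"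
    by (rule integrable_product_mult) (rule integrable_exp_abs[OF c(1)])
  have ae: "AE p in lborel \<Otimes>\<^sub>M lborel. fst p \<noteq> (0::real^'n)"
  proof (rule lborel_pair.AE_pair_measure)
    show "AE x in lborel. AE y in lborel. fst (x, y) \<noteq> (0::real^'n)"
      using AE_lborel_singleton[of "0::real^'n"] by eventually_elim simp
  qed measurable
  show ?thesis
  proof (rule Bochner_Integration.integrable_bound[OF gi])
    show "AE p in lborel \<Otimes>\<^sub>M lborel. norm (case p of (x, t) \<Rightarrow> exp (a * t) *\<^sub>R (\<phi> (exp t *\<^sub>R x) * \<psi> x))
        \<le> norm (case p of (x, t) \<Rightarrow> ?g x * exp (- c * \<bar>t\<bar>))"
      using ae
    proof eventually_elim
      fix p :: "(real^'n) \<times> real" assume p: "fst p \<noteq> 0"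
      obtain x t where [simp]: "p = (x, t)" by (cases p)
      have "norm (exp (a * t) *\<^sub>R (\<phi> (exp t *\<^sub>R x) * \<psi> x)) = (exp (a * t) * \<bar>norm (\<phi> (exp t *\<^sub>R x))\<bar>) * norm (\<psi> x)"
        by (simp add: norm_mult)
      also have "\<dots> \<le> (C * (norm x powr (- a - c) + norm x powr (c - a)) * exp (- c * \<bar>t\<bar>)) * norm (\<psi> x)"
        using p by (intro mult_right_mono C(2)) auto
      also have "\<dots> = ?g x * exp (- c * \<bar>t\<bar>)" by (simp add: algebra_simps)
      finally show "norm (case p of (x, t) \<Rightarrow> exp (a * t) *\<^sub>R (\<phi> (exp t *\<^sub>R x) * \<psi> x))
        \<le> norm (case p of (x, t) \<Rightarrow> ?g x * exp (- c * \<bar>t\<bar>))" by simp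
    qed
  qed measurable
qed

lemma mellin_pairing:
  fixes \<phi> \<psi> :: "real^'n::finite \<Rightarrow> complex"
  assumes "\<phi> \<in> schwartz" "\<psi> \<in> schwartz" "0 < a" "a < real CARD('n)"
  shows "(LINT x|lborel. mellin a \<phi> x * \<psi> x) = (LINT t|lborel. exp (a * t) *\<^sub>R (LINT x|lborel. \<phi> (exp t *\<^sub>R x) * \<psi> x))"
proof -
  have "(LINT x|lborel. mellin a \<phi> x * \<psi> x) = (LINT x|lborel. LINT t|lborel. exp (a * t) *\<^sub>R (\<phi> (exp t *\<^sub>R x) * \<psi> x))"
    unfolding mellin_def integral_mult_left_zero[symmetric] by simp
  also have "\<dots> = (LINT t|lborel. LINT x|lborel. exp (a * t) *\<^sub>R (\<phi> (exp t *\<^sub>R x) * \<psi> x))"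
    by (rule lborel_pair.Fubini_integral[OF mellin_pairing_integrable[OF assms], symmetric])
  finally show ?thesis by simp
qed

text \<open>The Fourier transform turns the dilation by \<open>exp t\<close> into the dilation by \<open>exp (- t)\<close>, hence
  exchanges the Mellin exponents \<open>a\<close> and \<open>n - a\<close>.\<close>

lemma mellin_fourier_duality:
  fixes \<phi> \<psi> :: "real^'n::finite \<Rightarrow> complex"
  assumes \<phi>: "\<phi> \<in> schwartz" "\<And>x. \<phi> (- x) = \<phi> x" and \<psi>: "\<psi> \<in> schwartz"
    and a: "0 < a" "0 < b" "a + b = real CARD('n)"
  shows "(LINT x|lborel. mellin a (fourier \<phi>) x * fourier \<psi> x) =
    complex_of_real ((2 * pi) ^ CARD('n)) * (LINT x|lborel. mellin b \<phi> x * \<psi> x)"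
proof -
  let ?c = "complex_of_real ((2 * pi) ^ CARD('n))"
  note F = fourier_schwartz[OF \<phi>(1)]
  note [measurable] = schwartz_measurable[OF \<phi>(1)] schwartz_measurable[OF \<psi>] schwartz_measurable[OF F]
  \<comment> \<open>The transform is moved from \<psi> onto the dilated transform of \<phi>. Scaling
    and inversion return \<phi> with the reciprocal dilation, and evenness absorbs the
    reflection.\<close>
  have inner: "exp (a * t) *\<^sub>R (LINT x|lborel. fourier \<phi> (exp t *\<^sub>R x) * fourier \<psi> x) =
      ?c * (exp (b * - t) *\<^sub>R (LINT x|lborel. \<phi> (exp (- t) *\<^sub>R x) * \<psi> x))" for t
  proof -
    have "(LINT x|lborel. fourier \<phi> (exp t *\<^sub>R x) * fourier \<psi> x) = (LINT x|lborel. fourier \<psi> x * fourier \<phi> (exp t *\<^sub>R x))"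
      by (simp add: mult.commute)
    also have "\<dots> = (LINT x|lborel. \<psi> x * fourier (\<lambda>x. fourier \<phi> (exp t *\<^sub>R x)) x)"
      by (intro fourier_multiplication schwartz_integrable \<psi> integrable_lborel_scale F)
    also have "\<dots> = (LINT x|lborel. (?c * of_real (exp (- real CARD('n) * t))) * (\<phi> (exp (- t) *\<^sub>R x) * \<psi> x))"
    proof -
      have "fourier (\<lambda>x. fourier \<phi> (exp t *\<^sub>R x)) x = ?c * of_real (exp (- real CARD('n) * t)) * \<phi> (exp (- t) *\<^sub>R x)" for x
        unfolding fourier_scale[OF schwartz_measurable[OF F]] fourier_inversion[OF \<phi>(1)] \<phi>(2)
        by (simp add: scaleR_conv_of_real[where 'a = complex])
      then show ?thesis by (simp only: mult_ac)
    qed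
    also have "\<dots> = (?c * of_real (exp (- real CARD('n) * t))) * (LINT x|lborel. \<phi> (exp (- t) *\<^sub>R x) * \<psi> x)"
      by (rule integral_mult_right_zero)
    finally have "exp (a * t) *\<^sub>R (LINT x|lborel. fourier \<phi> (exp t *\<^sub>R x) * fourier \<psi> x) =
      ?c * ((exp (a * t) * exp (- real CARD('n) * t)) *\<^sub>R (LINT x|lborel. \<phi> (exp (- t) *\<^sub>R x) * \<psi> x))"
      by (simp add: scaleR_conv_of_real mult_ac)
    \<comment> \<open>The Jacobian of the dilation lowers the exponent from a to a - n = -b.\<close>
    also have "exp (a * t) * exp (- real CARD('n) * t) = exp (b * - t)"
      unfolding exp_add[symmetric] a(3)[symmetric] by (simp add: algebra_simps)
    finally show ?thesis .
  qed
  have "(LINT x|lborel. mellin a (fourier \<phi>) x * fourier \<psi> x) =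
      (LINT t|lborel. exp (a * t) *\<^sub>R (LINT x|lborel. fourier \<phi> (exp t *\<^sub>R x) * fourier \<psi> x))"
    by (rule mellin_pairing[OF F fourier_schwartz[OF \<psi>]]) (use a in auto)
  also have "\<dots> = ?c * (LINT t|lborel. exp (b * - t) *\<^sub>R (LINT x|lborel. \<phi> (exp (- t) *\<^sub>R x) * \<psi> x))"
    by (simp only: inner integral_mult_right_zero)
  also have "(LINT t|lborel. exp (b * - t) *\<^sub>R (LINT x|lborel. \<phi> (exp (- t) *\<^sub>R x) * \<psi> x)) =
      (LINT t|lborel. exp (b * t) *\<^sub>R (LINT x|lborel. \<phi> (exp t *\<^sub>R x) * \<psi> x))"
    by (rule integral_lborel_uminus[of "\<lambda>t::real. exp (b * t) *\<^sub>R (LINT x|lborel. \<phi> (exp t *\<^sub>R x) * \<psi> x)"]) measurable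
  also have "\<dots> = (LINT x|lborel. mellin b \<phi> x * \<psi> x)"
    by (rule mellin_pairing[OF \<phi>(1) \<psi>, symmetric]) (use a in auto)
  finally show ?thesis .
qed

lemma hr_cong: "(\<And>x. x \<in> sphere 0 1 \<Longrightarrow> f x = g x) \<Longrightarrow> hr f s = hr g s"
proof
  fix x :: "real^'a" assume "\<And>x. x \<in> sphere 0 1 \<Longrightarrow> f x = g x"
  \<comment> \<open>At the origin both sides vanish, because \<open>0 powr s\<close> is 0.\<close>
  then show "hr f s x = hr g s x" by (cases "x = 0") (auto simp: hr_def)
qed

lemma dpair_cmult: "dpair (hr (\<lambda>x. c * f x) s) \<psi> = complex_of_real c * dpair (hr f s) \<psi>"
proof -
  have "complex_of_real (hr (\<lambda>x. c * f x) s x) * \<psi> x = complex_of_real c * (complex_of_real (hr f s x) * \<psi> x)" for x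
    by (simp add: hr_def)
  then show ?thesis unfolding dpair_def by (simp only: integral_mult_right_zero)
qed

text \<open>An explicit solution of the relation that defines \<open>T_op\<close>. Evenness and
  reality of \<phi> make its transform real, so taking real parts of the Mellin integrals loses
  nothing.\<close>

lemma dpair_mellin_duality:
  fixes \<phi> \<psi> :: "real^'n::finite \<Rightarrow> complex"
  assumes \<phi>: "\<phi> \<in> schwartz" "\<And>x. \<phi> (- x) = \<phi> x" "\<And>x. Im (\<phi> x) = 0" and \<psi>: "\<psi> \<in> schwartz"
    and q: "- real CARD('n) < q" "q < 0"
  shows "dpair (hr (\<lambda>x. Re (mellin (real CARD('n) + q) (fourier \<phi>) x)) (- real CARD('n) - q)) (fourier \<psi>) =
    dpair (hr (\<lambda>x. (2 * pi) ^ CARD('n) * Re (mellin (- q) \<phi> x)) q) \<psi>"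
proof -
  let ?a = "real CARD('n) + q"
  note F = fourier_schwartz[OF \<phi>(1)]
  have Freal: "Im (fourier \<phi> x) = 0" for x
    by (rule fourier_real[OF schwartz_measurable[OF \<phi>(1)] \<phi>(2,3)])
  have pair: "dpair (hr (\<lambda>x. Re (mellin c \<eta> x)) (- c)) \<zeta> = (LINT x|lborel. mellin c \<eta> x * \<zeta> x)"
    if \<eta>: "\<eta> \<in> schwartz" "\<And>x. Im (\<eta> x) = 0" and "\<zeta> \<in> schwartz" for c and \<eta> \<zeta> :: "real^'n \<Rightarrow> complex"
  proof -
    have eq: "complex_of_real (hr (\<lambda>x. Re (mellin c \<eta> x)) (- c) x) * \<zeta> x = mellin c \<eta> x * \<zeta> x" if "x \<noteq> 0" for x
      by (simp only: hr_mellin[OF \<eta>(1) that] Re_mellin(1)[OF \<eta>(2)])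
    note [measurable] = schwartz_measurable[OF \<open>\<zeta> \<in> schwartz\<close>] schwartz_measurable[OF \<eta>(1)]
    have [measurable]: "mellin c \<eta> \<in> borel_measurable borel"
      unfolding mellin_def[abs_def] by measurable
    have [measurable]: "hr (\<lambda>x. Re (mellin c \<eta> x)) (- c) \<in> borel_measurable borel"
      unfolding hr_def by measurable
    show ?thesis
      unfolding dpair_def
    proof (rule integral_cong_AE)
      show "AE x in lborel. complex_of_real (hr (\<lambda>x. Re (mellin c \<eta> x)) (- c) x) * \<zeta> x = mellin c \<eta> x * \<zeta> x"
        using AE_lborel_singleton[of "0::real^'n"] by eventually_elim (rule eq)
    qed measurable
  qed
  have "dpair (hr (\<lambda>x. Re (mellin ?a (fourier \<phi>) x)) (- ?a)) (fourier \<psi>) = (LINT x|lborel. mellin ?a (fourier \<phi>) x * fourier \<psi> x)"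
    by (rule pair[OF F Freal fourier_schwartz[OF \<psi>]])
  also have "\<dots> = complex_of_real ((2 * pi) ^ CARD('n)) * (LINT x|lborel. mellin (- q) \<phi> x * \<psi> x)"
    by (rule mellin_fourier_duality[OF \<phi>(1,2) \<psi>]) (use q in auto)
  also have "(LINT x|lborel. mellin (- q) \<phi> x * \<psi> x) = dpair (hr (\<lambda>x. Re (mellin (- q) \<phi> x)) (- (- q))) \<psi>"
    by (rule pair[OF \<phi>(1,3) \<psi>, symmetric])
  finally show ?thesis by (simp add: dpair_cmult)
qed

section \<open>Pairings with functions on the sphere\<close>

lemma Ce_inf_continuous:
  assumes "h \<in> Ce_inf"
  shows "continuous_on (- {0}) (\<lambda>x. h (x /\<^sub>R norm x))"
proof -
  have "Ck_bounded (\<lambda>_. True) (-{0}) (Suc 0) (\<lambda>x. h (x /\<^sub>R norm x))"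
    using assms unfolding Ce_inf_def smooth_on_open_iff[OF open_nonzero] by blast
  then show ?thesis
    by (intro continuous_at_imp_continuous_on ballI differentiable_imp_continuous_within) auto
qed

lemma Ce_inf_measurable: "h \<in> Ce_inf \<Longrightarrow> (\<lambda>x. h (x /\<^sub>R norm x)) \<in> borel_measurable borel"
  by (rule borel_measurable_continuous_countable_exceptions[OF _ Ce_inf_continuous]) auto

lemma Ce_inf_bounded:
  fixes h :: "real^'n::finite \<Rightarrow> real"
  assumes "h \<in> Ce_inf"
  obtains B where "\<And>x. x \<noteq> 0 \<Longrightarrow> \<bar>h (x /\<^sub>R norm x)\<bar> \<le> B"
proof -
  have "compact ((\<lambda>x. h (x /\<^sub>R norm x)) ` sphere 0 1)"
    by (intro compact_continuous_image continuous_on_subset[OF Ce_inf_continuous[OF assms]]) auto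
  then obtain B where B: "\<forall>y\<in>(\<lambda>x. h (x /\<^sub>R norm x)) ` sphere 0 1. norm y \<le> B"
    using compact_imp_bounded bounded_iff by metis
  have "\<bar>h (x /\<^sub>R norm x)\<bar> \<le> B" if "x \<noteq> 0" for x
  proof -
    have "x /\<^sub>R norm x \<in> sphere 0 1" using that by simp
    from bspec[OF B imageI[OF this]] that show ?thesis by simp
  qed
  then show ?thesis using that by blast
qed

lemma hr_integrable:
  fixes h :: "real^'n::finite \<Rightarrow> real"
  assumes "h \<in> Ce_inf" "\<psi> \<in> schwartz" "- real CARD('n) < s"
  shows "integrable lborel (\<lambda>x. complex_of_real (hr h s x) * \<psi> x)"
proof -
  note [measurable] = schwartz_measurable[OF assms(2)] Ce_inf_measurable[OF assms(1)]
  obtain B where B: "\<And>x. x \<noteq> 0 \<Longrightarrow> \<bar>h (x /\<^sub>R norm x)\<bar> \<le> B" using Ce_inf_bounded[OF assms(1)] by blast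
  have "norm (complex_of_real (hr h s x) * \<psi> x) \<le> norm (B *\<^sub>R (norm x powr s *\<^sub>R \<psi> x))" for x
  proof (cases "x = 0")
    case False
    have "norm (complex_of_real (hr h s x) * \<psi> x) = \<bar>h (x /\<^sub>R norm x)\<bar> * (norm x powr s * norm (\<psi> x))"
      by (simp add: hr_def norm_mult abs_mult)
    also have "\<dots> \<le> \<bar>B\<bar> * (norm x powr s * norm (\<psi> x))"
      using B[OF False] by (intro mult_right_mono) auto
    finally show ?thesis by (simp add: abs_mult mult.assoc)
  qed (simp add: hr_def)
  then show ?thesis
    by (intro Bochner_Integration.integrable_bound[OF integrable_scaleR_right[OF schwartz_powr_integrable[OF assms(2,3)], of B]])
       (auto simp: hr_def)
qed

text \<open>Along a ray h is constant. The density r^n of polar coordinates and the factor r^q of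
  the distribution leave a Mellin integral of \<psi> with exponent n + q.\<close>

lemma dpair_eq_sphere_integral:
  fixes h :: "real^'n::finite \<Rightarrow> real"
  assumes h: "h \<in> Ce_inf" and \<psi>: "\<psi> \<in> schwartz" "\<And>x. Im (\<psi> x) = 0" and q: "- real CARD('n) < q"
  shows "dpair (hr h q) \<psi> = complex_of_real (sphere_integral (\<lambda>x. Re (mellin (real CARD('n) + q) \<psi> x) * h x))"
proof -
  let ?a = "real CARD('n) + q"
  note [measurable] = schwartz_measurable[OF \<psi>(1)] Ce_inf_measurable[OF h]
  have [measurable]: "mellin ?a \<psi> \<in> borel_measurable borel" "ball (0::real^'n) 1 \<in> sets borel"
    unfolding mellin_def[abs_def] by measurable
  have i: "integrable lborel (\<lambda>x. complex_of_real (hr h q x) * \<psi> x)"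
    by (rule hr_integrable[OF h \<psi>(1) q])
  have eq: "(LINT t|lborel. polar_weight x t *\<^sub>R (complex_of_real (hr h q (exp t *\<^sub>R x)) * \<psi> (exp t *\<^sub>R x))) =
     complex_of_real (real CARD('n) * (indicator (ball 0 1) x * (Re (mellin ?a \<psi> (x /\<^sub>R norm x)) * h (x /\<^sub>R norm x))))"
    (is "?L = ?R") if x: "x \<noteq> 0" for x
  proof -
    let ?k = "real CARD('n) * indicator (ball 0 1) x * norm x powr ?a * h (x /\<^sub>R norm x)"
    have "polar_weight x t *\<^sub>R (complex_of_real (hr h q (exp t *\<^sub>R x)) * \<psi> (exp t *\<^sub>R x)) =
       complex_of_real ?k * (exp (?a * t) *\<^sub>R \<psi> (exp t *\<^sub>R x))" for t
    proof -
      have u: "(exp t *\<^sub>R x) /\<^sub>R norm (exp t *\<^sub>R x) = x /\<^sub>R norm x" using x by (simp add: field_simps)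
      have "norm (exp t *\<^sub>R x) ^ CARD('n) * norm (exp t *\<^sub>R x) powr q = norm (exp t *\<^sub>R x) powr ?a"
        using x by (simp add: powr_add powr_realpow)
      also have "\<dots> = exp (?a * t) * norm x powr ?a"
        using x by (simp add: powr_def ln_mult distrib_left exp_add)
      finally have "polar_weight x t * hr h q (exp t *\<^sub>R x) = ?k * exp (?a * t)"
        unfolding polar_weight_def hr_def u by (simp add: mult_ac)
      then have "complex_of_real (polar_weight x t * hr h q (exp t *\<^sub>R x)) * \<psi> (exp t *\<^sub>R x)
         = complex_of_real (?k * exp (?a * t)) * \<psi> (exp t *\<^sub>R x)" by simp
      then show ?thesis by (simp only: scaleR_conv_of_real of_real_mult mult.assoc)
    qed
    then have "?L = complex_of_real ?k * mellin ?a \<psi> x"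
      by (simp only: mellin_def integral_mult_right_zero)
    also have "\<dots> = complex_of_real (real CARD('n) * indicator (ball 0 1) x * h (x /\<^sub>R norm x)) * mellin ?a \<psi> (x /\<^sub>R norm x)"
      unfolding mellin_normalize[OF \<psi>(1) x] by (simp add: scaleR_conv_of_real)
    also have "\<dots> = ?R"
      by (subst Re_mellin(1)[OF \<psi>(2), symmetric]) (simp only: of_real_mult mult_ac)
    finally show ?thesis .
  qed
  have "dpair (hr h q) \<psi> = (LINT x|lborel. LINT t|lborel. polar_weight x t *\<^sub>R (complex_of_real (hr h q (exp t *\<^sub>R x)) * \<psi> (exp t *\<^sub>R x)))"
    unfolding dpair_def by (rule integral_polar[OF i])
  also have "\<dots> = (LINT x|lborel. complex_of_real (real CARD('n) * (indicator (ball 0 1) x * (Re (mellin ?a \<psi> (x /\<^sub>R norm x)) * h (x /\<^sub>R norm x)))))"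
  proof (rule integral_cong_AE)
    show "AE x in lborel. (LINT t|lborel. polar_weight x t *\<^sub>R (complex_of_real (hr h q (exp t *\<^sub>R x)) * \<psi> (exp t *\<^sub>R x))) =
     complex_of_real (real CARD('n) * (indicator (ball 0 1) x * (Re (mellin ?a \<psi> (x /\<^sub>R norm x)) * h (x /\<^sub>R norm x))))"
      using AE_lborel_singleton[of "0::real^'n"] by eventually_elim (rule eq)
    have "integrable lborel (\<lambda>x. LINT t|lborel. polar_weight x t *\<^sub>R (complex_of_real (hr h q (exp t *\<^sub>R x)) * \<psi> (exp t *\<^sub>R x)))"
      by (rule lborel_pair.integrable_fst[OF integrable_polar[OF i]])
    then show "(\<lambda>x. LINT t|lborel. polar_weight x t *\<^sub>R (complex_of_real (hr h q (exp t *\<^sub>R x)) * \<psi> (exp t *\<^sub>R x))) \<in> borel_measurable lborel"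
      by (rule borel_measurable_integrable)
  qed measurable
  also have "\<dots> = complex_of_real (sphere_integral (\<lambda>x. Re (mellin ?a \<psi> x) * h x))"
    by (simp only: integral_complex_of_real sphere_integral_def integral_mult_right_zero)
  finally show ?thesis .
qed

section \<open>Recovering functions on the sphere from pairings\<close>

definition lognormal_moment :: "real \<Rightarrow> real" where
  "lognormal_moment a = (LINT t|lborel. exp (a * t) * exp (- t\<^sup>2))"

text \<open>The moment is the factor by which the Mellin integral of a cutoff extension multiplies
  the original function. It has to be divided out without affecting signs.\<close>

lemma lognormal_moment_pos:
  assumes "0 < a"
  shows "0 < lognormal_moment a"
proof -
  let ?f = "\<lambda>t::real. exp (a * t) * exp (- t\<^sup>2)"
  \<comment> \<open>Completing the square in \<open>\<bar>t\<bar>\<close> with a + 1 instead of a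
    leaves a spare factor \<open>exp (- \<bar>t\<bar>)\<close> for integrability.\<close>
  have bd: "?f t \<le> exp ((a + 1)\<^sup>2 / 4) * exp (- 1 * \<bar>t\<bar>)" for t
  proof -
    have "0 \<le> (\<bar>t\<bar> - (a + 1) / 2)\<^sup>2" by simp
    also have "\<dots> = t\<^sup>2 - (a * \<bar>t\<bar> + \<bar>t\<bar>) + (a + 1)\<^sup>2 / 4"
      by (simp add: power2_eq_square field_simps)
    finally have "a * \<bar>t\<bar> + - t\<^sup>2 \<le> (a + 1)\<^sup>2 / 4 + - 1 * \<bar>t\<bar>" by simp
    moreover have "a * t \<le> a * \<bar>t\<bar>" using assms by simp
    ultimately have "a * t + - t\<^sup>2 \<le> (a + 1)\<^sup>2 / 4 + - 1 * \<bar>t\<bar>" by linarith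
    then show ?thesis unfolding exp_add[symmetric] by simp
  qed
  have i: "integrable lborel ?f"
    by (rule Bochner_Integration.integrable_bound[OF integrable_mult_right[OF integrable_exp_abs[of 1], of "exp ((a + 1)\<^sup>2 / 4)"]])
       (use bd in \<open>auto intro!: AE_I2\<close>)
  have "lognormal_moment a \<noteq> 0"
  proof
    assume "lognormal_moment a = 0"
    then have "AE t::real in lborel. ?f t = 0"
      unfolding lognormal_moment_def by (subst (asm) integral_nonneg_eq_0_iff_AE[OF i]) auto
    \<comment> \<open>The integrand never vanishes, so a zero integral would make the whole line a
      null set.\<close>
    then have "AE t::real in lborel. False" by simp
    then have "emeasure lborel (space (lborel :: real measure)) = 0"
      by (subst (asm) AE_iff_measurable[OF _ refl]) auto
    then show False by simp
  qed
  moreover have "0 \<le> lognormal_moment a" unfolding lognormal_moment_def by (intro integral_nonneg_AE) auto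
  ultimately show ?thesis by simp
qed

lemma cutoff_extension_real: "Im (cutoff_extension h x) = 0"
  by (simp add: cutoff_extension_def)

lemma mellin_cutoff_extension:
  assumes "norm x = 1"
  shows "mellin a (cutoff_extension h) x = complex_of_real (lognormal_moment a * h x)"
proof -
  have "exp (a * t) *\<^sub>R cutoff_extension h (exp t *\<^sub>R x) = complex_of_real (exp (a * t) * exp (- t\<^sup>2)) * complex_of_real (h x)" for t
  proof -
    have "exp t *\<^sub>R x \<noteq> 0" "norm (exp t *\<^sub>R x) = exp t" "(exp t *\<^sub>R x) /\<^sub>R exp t = x" using assms by auto
    then have "cutoff_extension h (exp t *\<^sub>R x) = complex_of_real (h x * exp (- t\<^sup>2))"
      by (simp only: cutoff_extension_def lognormal_def if_False ln_exp)
    then show ?thesis by (simp add: scaleR_conv_of_real[where 'a = complex])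
  qed
  then show ?thesis
    unfolding mellin_def lognormal_moment_def
    by (simp only: integral_mult_left_zero integral_complex_of_real of_real_mult[symmetric])
qed

lemma fourier_fourier_cutoff_extension:
  fixes h :: "real^'n::finite \<Rightarrow> real"
  assumes "h \<in> Ce_inf"
  shows "fourier (fourier (cutoff_extension h)) = (\<lambda>x. complex_of_real ((2 * pi) ^ CARD('n)) * cutoff_extension h x)"
  using fourier_inversion[OF cutoff_extension_schwartz[OF assms]] cutoff_extension_even[OF assms] by auto

text \<open>A single test function suffices: paired with the cutoff extension of f - g, the
  difference of the two sides is the integral of a positive weight times (f - g)^2. Continuity then
  upgrades equality almost everywhere to equality on the sphere.\<close>

lemma hr_eqI:
  fixes f g :: "real^'n::finite \<Rightarrow> real"
  assumes f: "f \<in> Ce_inf" "g \<in> Ce_inf" "- real CARD('n) < s"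
    and eq: "dpair (hr f s) (cutoff_extension (\<lambda>x. f x - g x)) = dpair (hr g s) (cutoff_extension (\<lambda>x. f x - g x))"
    and x: "x \<in> sphere 0 1"
  shows "f x = g x"
proof (rule ccontr)
  assume neq: "f x \<noteq> g x"
  let ?d = "\<lambda>x. f x - g x"
  let ?D = "\<lambda>x. ?d (x /\<^sub>R norm x)"
  have d: "?d \<in> Ce_inf" using Ce_inf_linear[OF f(1,2), of 1 "- 1"] by simp
  note Z = cutoff_extension_schwartz[OF d]
  let ?p = "\<lambda>y. norm y powr s * (?D y)\<^sup>2 * lognormal y"
  have pe: "complex_of_real (hr f s y) * cutoff_extension ?d y - complex_of_real (hr g s y) * cutoff_extension ?d y = complex_of_real (?p y)" for y
    by (simp add: hr_def cutoff_extension_def power2_eq_square algebra_simps)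
  note ints = hr_integrable[OF f(1) Z f(3)] hr_integrable[OF f(2) Z f(3)]
  have "integrable lborel (\<lambda>y. complex_of_real (?p y))"
    using Bochner_Integration.integrable_diff[OF ints] unfolding pe .
  then have i: "integrable lborel ?p" by (simp only: complex_of_real_integrable_eq)
  have "complex_of_real (LINT y|lborel. ?p y) = 0"
    using Bochner_Integration.integral_diff[OF ints] eq unfolding pe by (simp only: dpair_def integral_complex_of_real) simp
  then have "(LINT y|lborel. ?p y) = 0" by simp
  then have ae: "AE y in lborel. ?p y = 0"
    by (subst (asm) integral_nonneg_eq_0_iff_AE[OF i]) (auto simp: lognormal_def)
  \<comment> \<open>The set is open and contains x, so it cannot be negligible.\<close>
  let ?U = "{y \<in> - {0}. ?D y \<noteq> 0}"
  have "open ?U"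
    using continuous_open_preimage[OF Ce_inf_continuous[OF d] open_nonzero, of "- {0}"]
    by (simp add: open_Compl vimage_def Int_def)
  moreover have "x \<in> ?U" using x neq by auto
  moreover have "AE y in lborel. y \<notin> ?U"
    using ae by eventually_elim (auto simp: lognormal_def)
  ultimately have "emeasure lborel ?U = 0"
    by (subst (asm) AE_iff_measurable[of ?U]) auto
  then have "?U \<in> null_sets lborel" using \<open>open ?U\<close> by (auto simp: null_sets_def)
  then have "negligible ?U" by (simp add: negligible_iff_null_sets null_sets_completionI)
  with \<open>open ?U\<close> \<open>x \<in> ?U\<close> show False using open_not_negligible by blast
qed

text \<open>By inversion the test function of \<open>hr_eqI\<close> is, up to a nonzero constant, a
  Fourier transform of a Schwartz function, namely its own double transform.\<close>

lemma hr_fourier_eqI: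
  fixes f g :: "real^'n::finite \<Rightarrow> real"
  assumes f: "f \<in> Ce_inf" "g \<in> Ce_inf" "- real CARD('n) < s"
    and eq: "\<And>\<psi>. \<psi> \<in> schwartz \<Longrightarrow> dpair (hr f s) (fourier \<psi>) = dpair (hr g s) (fourier \<psi>)"
    and x: "x \<in> sphere 0 1"
  shows "f x = g x"
proof (rule hr_eqI[OF f _ x])
  let ?d = "\<lambda>x. f x - g x"
  let ?c = "complex_of_real ((2 * pi) ^ CARD('n))"
  have d: "?d \<in> Ce_inf" using Ce_inf_linear[OF f(1,2), of 1 "- 1"] by simp
  have "dpair u (fourier (fourier (cutoff_extension ?d))) = ?c * dpair u (cutoff_extension ?d)" for u
    unfolding fourier_fourier_cutoff_extension[OF d] dpair_def
    by (simp only: mult.left_commute[of _ ?c] integral_mult_right_zero)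
  with eq[OF fourier_schwartz[OF cutoff_extension_schwartz[OF d]]]
  show "dpair (hr f s) (cutoff_extension ?d) = dpair (hr g s) (cutoff_extension ?d)" by simp
qed

text \<open>Choose \<phi> to be the transform of the cutoff extension of f. Its own transform is
  then a multiple of that extension, whose Mellin integral on the sphere is a multiple of f. The
  constant \<open>k\<close> collects the factor from inversion and the lognormal moment.\<close>

lemma fourier_homogeneous_exists:
  fixes f :: "real^'n::finite \<Rightarrow> real"
  assumes f: "f \<in> Ce_inf" and q: "- real CARD('n) < q" "q < 0"
  shows "\<exists>g\<in>Ce_inf. \<forall>\<psi>\<in>schwartz. dpair (hr f (- real CARD('n) - q)) (fourier \<psi>) = dpair (hr g q) \<psi>"
proof -
  let ?a = "real CARD('n) + q"
  let ?c = "(2 * pi) ^ CARD('n)"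
  let ?\<phi> = "fourier (cutoff_extension f)"
  define k where "k = ?c * lognormal_moment ?a"
  have k: "k \<noteq> 0" using lognormal_moment_pos[of ?a] q by (simp add: k_def)
  note Z = cutoff_extension_schwartz[OF f]
  have \<phi>: "?\<phi> \<in> schwartz" "\<And>x. ?\<phi> (- x) = ?\<phi> x" "\<And>x. Im (?\<phi> x) = 0"
    using fourier_schwartz[OF Z] fourier_even[OF schwartz_measurable[OF Z] cutoff_extension_even[OF f]]
      fourier_real[OF schwartz_measurable[OF Z] cutoff_extension_even[OF f] cutoff_extension_real] by auto
  let ?g = "\<lambda>x. ?c * Re (mellin (- q) ?\<phi> x)"
  have g: "(\<lambda>x. (1 / k) * ?g x) \<in> Ce_inf"
    by (intro Ce_inf_cmult mellin_Ce_inf \<phi>) (use q in auto)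
  have "Re (mellin ?a (fourier ?\<phi>) x) = k * f x" if "x \<in> sphere 0 1" for x
  proof -
    have "mellin ?a (fourier ?\<phi>) x = complex_of_real ?c * mellin ?a (cutoff_extension f) x"
      unfolding fourier_fourier_cutoff_extension[OF f] mellin_def
      by (simp only: mult_scaleR_right[symmetric] integral_mult_right_zero)
    then show ?thesis using that by (simp add: mellin_cutoff_extension k_def)
  qed
  then have "hr (\<lambda>x. Re (mellin ?a (fourier ?\<phi>) x)) s = hr (\<lambda>x. k * f x) s" for s
    by (rule hr_cong)
  then have "complex_of_real k * dpair (hr f (- real CARD('n) - q)) (fourier \<psi>) = dpair (hr ?g q) \<psi>" if "\<psi> \<in> schwartz" for \<psi>
    using dpair_mellin_duality[OF \<phi> that q] by (simp only: dpair_cmult)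
  then have "dpair (hr f (- real CARD('n) - q)) (fourier \<psi>) = dpair (hr (\<lambda>x. (1 / k) * ?g x) q) \<psi>" if "\<psi> \<in> schwartz" for \<psi>
    unfolding dpair_cmult[of "1 / k"] using that k by (simp add: field_simps)
  with g show ?thesis by blast
qed

section \<open>The operator and its positive cone\<close>

lemma T_op_spec:
  fixes f :: "real^'n::finite \<Rightarrow> real"
  assumes "f \<in> Ce_inf" "- real CARD('n) < q" "q < 0"
  shows "T_op q f \<in> Ce_inf"
    and "\<psi> \<in> schwartz \<Longrightarrow> dpair (hr f (- real CARD('n) - q)) (fourier \<psi>) = dpair (hr (T_op q f) q) \<psi>"
proof -
  have "\<exists>g. g \<in> Ce_inf \<and> (\<forall>\<phi>\<in>schwartz. dpair (hr f (- real CARD('n) - q)) (fourier \<phi>) = dpair (hr g q) \<phi>)"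
    using fourier_homogeneous_exists[OF assms] by blast
  from someI_ex[OF this] have "T_op q f \<in> Ce_inf \<and>
      (\<forall>\<phi>\<in>schwartz. dpair (hr f (- real CARD('n) - q)) (fourier \<phi>) = dpair (hr (T_op q f) q) \<phi>)"
    unfolding T_op_def .
  then show "T_op q f \<in> Ce_inf"
    "\<psi> \<in> schwartz \<Longrightarrow> dpair (hr f (- real CARD('n) - q)) (fourier \<psi>) = dpair (hr (T_op q f) q) \<psi>" by auto
qed

text \<open>The chosen value of \<open>T_op\<close> and the explicit function satisfy the same weak
  identity; uniqueness turns this into equality at points of the sphere.\<close>

lemma T_op_mellin:
  fixes \<phi> :: "real^'n::finite \<Rightarrow> complex"
  assumes \<phi>: "\<phi> \<in> schwartz" "\<And>x. \<phi> (- x) = \<phi> x" "\<And>x. Im (\<phi> x) = 0"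
    and q: "- real CARD('n) < q" "q < 0" and x: "x \<in> sphere 0 1"
  shows "T_op q (\<lambda>x. Re (mellin (real CARD('n) + q) (fourier \<phi>) x)) x = (2 * pi) ^ CARD('n) * Re (mellin (- q) \<phi> x)"
proof -
  let ?f = "\<lambda>x. Re (mellin (real CARD('n) + q) (fourier \<phi>) x)"
  let ?g = "\<lambda>x. (2 * pi) ^ CARD('n) * Re (mellin (- q) \<phi> x)"
  have f: "?f \<in> Ce_inf"
    by (intro mellin_Ce_inf fourier_schwartz fourier_even \<phi> schwartz_measurable) (use q in auto)
  have g: "?g \<in> Ce_inf"
    by (intro Ce_inf_cmult mellin_Ce_inf \<phi>) (use q in auto)
  note T = T_op_spec[OF f q]
  have "(\<lambda>x. T_op q ?f x - ?g x) \<in> Ce_inf" using Ce_inf_linear[OF T(1) g, of 1 "- 1"] by simp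
  note Z = cutoff_extension_schwartz[OF this]
  show ?thesis
    by (rule hr_eqI[OF T(1) g q(1) _ x]) (simp only: T(2)[OF Z, symmetric] dpair_mellin_duality[OF \<phi> Z q])
qed

theorem theorem3:
  fixes q :: real
  assumes "- real CARD('n::finite) < q" and "q < 0"
  shows "Pos (T_op q :: (real^'n \<Rightarrow> real) \<Rightarrow> _) = {h\<in>Ce_inf. positive_definite (hr h q)}"
proof (intro equalityI subsetI)
  let ?a = "real CARD('n) + q"
  fix h :: "real^'n \<Rightarrow> real" assume h: "h \<in> Pos (T_op q)"
  then have hC: "h \<in> Ce_inf" by (simp add: Pos_def)
  have "Im (dpair (hr h q) (fourier \<phi>)) = 0 \<and> 0 \<le> Re (dpair (hr h q) (fourier \<phi>))"
    if \<phi>: "\<phi> \<in> schwartz" "\<And>x. \<phi> (- x) = \<phi> x" "\<And>x. Im (\<phi> x) = 0" "\<And>x. 0 \<le> Re (\<phi> x)" for \<phi>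
  proof -
    \<comment> \<open>\<open>T_op\<close> sends this function to a positive multiple of a Mellin
      integral of \<phi>, which inherits nonnegativity; so h may be tested against it.\<close>
    let ?f = "\<lambda>x. Re (mellin ?a (fourier \<phi>) x)"
    have f: "?f \<in> Ce_inf"
      by (intro mellin_Ce_inf fourier_schwartz fourier_even \<phi> schwartz_measurable) (use assms in auto)
    have "0 \<le> Re (mellin (- q) \<phi> x)" for x
      unfolding Re_mellin(2)[OF \<phi>(3)] using \<phi>(4) by (intro integral_nonneg_AE) auto
    then have "\<forall>x\<in>sphere 0 1. 0 \<le> T_op q ?f x"
      using T_op_mellin[OF \<phi>(1,2,3) assms] by simp
    then have "0 \<le> sphere_integral (\<lambda>x. ?f x * h x)" using h f by (auto simp: Pos_def)
    moreover have "dpair (hr h q) (fourier \<phi>) = complex_of_real (sphere_integral (\<lambda>x. ?f x * h x))"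
      by (rule dpair_eq_sphere_integral[OF hC fourier_schwartz[OF \<phi>(1)]
            fourier_real[OF schwartz_measurable[OF \<phi>(1)] \<phi>(2,3)] assms(1)])
    ultimately show ?thesis by simp
  qed
  then show "h \<in> {h\<in>Ce_inf. positive_definite (hr h q)}"
    using hC by (auto simp: positive_definite_def)
next
  let ?a = "real CARD('n) + q"
  fix h :: "real^'n \<Rightarrow> real" assume "h \<in> {h\<in>Ce_inf. positive_definite (hr h q)}"
  then have hC: "h \<in> Ce_inf" and pd: "positive_definite (hr h q)" by auto
  have "0 \<le> sphere_integral (\<lambda>x. f x * h x)" if f: "f \<in> Ce_inf" and T: "\<forall>x\<in>sphere 0 1. 0 \<le> T_op q f x" for f
  proof -
    note S = T_op_spec[OF f assms]
    \<comment> \<open>The test function is built from \<open>T_op q f\<close>, whose sign is known,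
      and not from f itself.\<close>
    let ?\<phi> = "cutoff_extension (T_op q f)"
    let ?f = "\<lambda>x. Re (mellin ?a (fourier ?\<phi>) x)"
    define k where "k = (2 * pi) ^ CARD('n) * lognormal_moment (- q)"
    have k: "0 < k" using lognormal_moment_pos[of "- q"] assms by (simp add: k_def)
    note \<phi> = cutoff_extension_schwartz[OF S(1)] cutoff_extension_even[OF S(1)] cutoff_extension_real
    have F: "?f \<in> Ce_inf"
      by (intro mellin_Ce_inf fourier_schwartz fourier_even \<phi> schwartz_measurable) (use assms in auto)
    have "0 \<le> Re (?\<phi> x)" for x
      using T by (auto simp: cutoff_extension_def lognormal_def)
    then have "0 \<le> Re (dpair (hr h q) (fourier ?\<phi>))"
      using pd \<phi> unfolding positive_definite_def by blast
    then have nonneg: "0 \<le> sphere_integral (\<lambda>x. ?f x * h x)"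
      using dpair_eq_sphere_integral[OF hC fourier_schwartz[OF \<phi>(1)]
            fourier_real[OF schwartz_measurable[OF \<phi>(1)] \<phi>(2,3)] assms(1)] by simp
    have "(2 * pi) ^ CARD('n) * Re (mellin (- q) ?\<phi> x) = k * T_op q f x" if "x \<in> sphere 0 1" for x
      using that by (simp add: mellin_cutoff_extension k_def)
    then have "hr (\<lambda>x. (2 * pi) ^ CARD('n) * Re (mellin (- q) ?\<phi> x)) q = hr (\<lambda>x. k * T_op q f x) q"
      by (rule hr_cong)
    then have eq: "dpair (hr ?f (- real CARD('n) - q)) (fourier \<psi>) = dpair (hr (\<lambda>x. k * f x) (- real CARD('n) - q)) (fourier \<psi>)"
      if "\<psi> \<in> schwartz" for \<psi>
      using dpair_mellin_duality[OF \<phi> that assms] S(2)[OF that] by (simp only: dpair_cmult)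
    \<comment> \<open>The two distributions have the same Fourier transform, hence f is recovered
      from the test function up to the positive constant \<open>k\<close>.\<close>
    have feq: "?f x = k * f x" if "x \<in> sphere 0 1" for x
      by (rule hr_fourier_eqI[OF F Ce_inf_cmult[OF f] _ eq that]) (use assms in auto)
    have "sphere_integral (\<lambda>x. ?f x * h x) = k * sphere_integral (\<lambda>x. f x * h x)"
    proof -
      note [measurable] = Ce_inf_measurable[OF F] Ce_inf_measurable[OF f] Ce_inf_measurable[OF hC]
      have [measurable]: "ball (0::real^'n) 1 \<in> sets borel" by simp
      \<comment> \<open>\<open>feq\<close> is available only on the sphere, and
        \<open>x /\<^sub>R norm x\<close> lies there for all x except 0, a null set.\<close>
      have "(LINT x|lborel. indicator (ball 0 1) x * (?f (x /\<^sub>R norm x) * h (x /\<^sub>R norm x))) =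
        (LINT x|lborel. k * (indicator (ball 0 1) x * (f (x /\<^sub>R norm x) * h (x /\<^sub>R norm x))))"
      proof (rule integral_cong_AE)
        show "AE x in lborel. indicator (ball 0 1) x * (?f (x /\<^sub>R norm x) * h (x /\<^sub>R norm x)) =
          k * (indicator (ball 0 1) x * (f (x /\<^sub>R norm x) * h (x /\<^sub>R norm x)))"
          using AE_lborel_singleton[of "0::real^'n"]
        proof eventually_elim
          fix x :: "real^'n" assume "x \<noteq> 0"
          then have "?f (x /\<^sub>R norm x) = k * f (x /\<^sub>R norm x)" by (intro feq) simp
          then show "indicator (ball 0 1) x * (?f (x /\<^sub>R norm x) * h (x /\<^sub>R norm x)) =
            k * (indicator (ball 0 1) x * (f (x /\<^sub>R norm x) * h (x /\<^sub>R norm x)))" by (simp only: mult_ac)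
        qed
      qed measurable
      then show ?thesis by (simp add: sphere_integral_def)
    qed
    with nonneg k show ?thesis by (simp add: zero_le_mult_iff)
  qed
  with hC show "h \<in> Pos (T_op q)" by (auto simp: Pos_def)
qed

end
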